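(* Assume that (VD), (PI$_p(\Psi)$) and (cap$_p(\Psi)_{\le}$) hold. Then there exists $C\in[1,\infty)$ such that for any open subset $\Omega$ of $X$ satisfying the extension property (E) and any $u\in\mathcal{F}_p(\Omega)$, $$C^{-1}\Gamma_p\langle u\rangle(\Omega)\le\liminf_{r\downarrow0}\int_\Omega\frac1{m(B(y,r))}\int_{\Omega\cap B(y,r)}\frac{|u(x)-u(y)|^p}{\Psi(r)}\,m(dx)\,m(dy)$$ $$\le\limsup_{r\downarrow0}\int_\Omega\frac1{m(B(y,r))}\int_{\Omega\cap B(y,r)}\frac{|u(x)-u(y)|^p}{\Psi(d(x,y))}\,m(dx)\,m(dy)\le C\,\Gamma_p\langle u\rangle(\Omega).$$ Moreover, if $u\in\mathcal{F}_p$, then $$C^{-1}\mathcal{E}_p(u)\le\liminf_{r\downarrow0}\int_X\frac1{m(B(y,r))}\int_{B(y,r)}\frac{|u(x)-u(y)|^p}{\Psi(r)}\,m(dx)\,m(dy)$$ $$\le\sup_{r>0}\int_X\frac1{m(B(y,r))}\int_{B(y,r)}\frac{|u(x)-u(y)|^p}{\Psi(d(x,y))}\,m(dx)\,m(dy)\le C\,\mathcal{E}_p(u).$$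
   Context: **Setting.** $(X,d)$ is a locally compact, separable, complete metric space with at least two points, $m$ is a Radon measure on $X$ with full topological support, and $p\in(1,\infty)$. $B(x,r)=\{y\in X: d(x,y)<r\}$; $u_A=\frac1{m(A)}\int_A u\,dm$; $C_c(X)$ is the set of compactly supported continuous functions on $X$; $\mathbf{1}_A$ is the indicator function of $A$. $\mathcal{F}_p$ is a linear subspace of $L^p(X,m)$, $\mathcal{E}_p:\mathcal{F}_p\to[0,\infty)$ is such that $\mathcal{E}_p^{1/p}$ is a seminorm on $\mathcal{F}_p$, and $\{\Gamma_p\langle u\rangle\}_{u\in\mathcal{F}_p}$ is a family of finite Borel measures on $X$ such that: (1) for any $u\in\mathcal{F}_p$ and any $1$-Lipschitz $\varphi:\mathbb{R}\to\mathbb{R}$ with $\varphi(0)=0$, $\varphi(u)\in\mathcal{F}_p$ and $\mathcal{E}_p(\varphi(u))\le\mathcal{E}_p(u)$; and $\mathcal{E}_p^{-1}(0)\subset\mathbb{R}\mathbf{1}_X$; (2) $\mathcal{F}_p$ with the norm $\|\cdot\|_{L^p(X,m)}+\mathcal{E}_p(\cdot)^{1/p}$ is a reflexive Banach space; (3) $\mathcal{F}_p\cap C_c(X)$ is dense in $\mathcal{F}_p$ and is dense in $C_c(X)$ with respect to the uniform norm; (4) for any Borel $A\subset X$, $u\mapsto\Gamma_p\langle u\rangle(A)^{1/p}$ is a seminorm on $\mathcal{F}_p$; (5) $\mathcal{E}_p(u)=\Gamma_p\langle u\rangle(X)$ for any $u\in\mathcal{F}_p$; (6) if $u,v\in\mathcal{F}_p\cap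 C_c(X)$, $U\subset X$ is open and $(u-v)|_U$ is constant, then $\Gamma_p\langle u\rangle|_U=\Gamma_p\langle v\rangle|_U$ (restrictions to Borel subsets of $U$). **Scale function.** $\Psi:(0,\infty)\to(0,\infty)$ is a fixed continuous increasing bijection for which there are constants $C_\Psi\in[1,\infty)$, $\beta_1,\beta_2\in(0,\infty)$ with $C_\Psi^{-1}(R/r)^{\beta_1}\le\Psi(R)/\Psi(r)\le C_\Psi(R/r)^{\beta_2}$ for all $0<r\le R$. Integrands containing $\Psi(d(x,y))$ are understood for $x\ne y$. **(VD)**: there is $c_{\mathrm D}\in[1,\infty)$ with $m(B(x,2r))\le c_{\mathrm D}m(B(x,r))$ for all $x\in X$, $r>0$. **(PI$_p(\Psi)$)**: there are $C_{\mathrm P}\in(0,\infty)$, $A_{\mathrm P}\in[1,\infty)$ such that for all $x\in X$, $r>0$, $u\in\mathcal{F}_p$: $\int_{B(x,r)}|u-u_{B(x,r)}|^p\,dm\le C_{\mathrm P}\Psi(r)\,\Gamma_p\langle u\rangle(B(x,A_{\mathrm P}r))$. **(cap$_p(\Psi)_{\le}$)**: there are $C_{\mathrm{cap}},A_{\mathrm{cap},1},A_{\mathrm{cap},2}\in(1,\infty)$ such that for all $x\in X$ and $0<R<\operatorname{diam}(X,d)/A_{\mathrm{cap},2}$: $\inf\{\mathcal{E}_p(u): u\in\mathcal{F}_p,\ u=1\ m\text{-a.e. on }B(x,R),\ u=0\ m\text{-a.e. on }X\setminus B(x,A_{\mathrm{cap},1}R)\}\le C_{\mathrm{cap}}\,m(B(x,R))/\Psi(R)$.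 **Local spaces.** For a non-empty open $U\subset X$, $\mathcal{F}_{p,\mathrm{loc}}(U)$ is the set of ($m$-equivalence classes of) real-valued Borel functions $u$ on $U$ such that for each relatively compact open subset $A$ of $U$ there is $u^\#\in\mathcal{F}_p$ with $u=u^\#$ $m$-a.e. on $A$. For $u\in\mathcal{F}_{p,\mathrm{loc}}(U)$, the Radon measure $\Gamma_{p,U}\langle u\rangle$ on $U$ is given by $\Gamma_{p,U}\langle u\rangle(E)=\Gamma_p\langle u^\#\rangle(E)$ for relatively compact Borel $E$ in $U$ (where $A$ is any relatively compact open subset of $U$ with $E\subset A$ and $u^\#\in\mathcal{F}_p$ is any function with $u=u^\#$ $m$-a.e. on $A$; the value is independent of these choices), extended by monotone limits along exhaustions of $U$ by relatively compact open subsets. We also write $\Gamma_p\langle u\rangle$ for $\Gamma_{p,U}\langle u\rangle$. $\mathcal{F}_p(U)=\{u\in\mathcal{F}_{p,\mathrm{loc}}(U):\int_U|u|^p\,dm+\Gamma_{p,U}\langle u\rangle(U)<\infty\}$. **Extension property (E).** An open $\Omega\subset X$ with $\Omega\ne X$ satisfies (E) if for any $f\in\mathcal{F}_p(\Omega)$ there is $F\in\mathcal{F}_p$ with $f=F$ $m$-a.e. on $\Omega$ and $\Gamma_p\langle F\rangle(\partial\Omega)=0$. *)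

theory Defs
  imports "HOL-Analysis.Analysis"
begin

section \<open>Seminormed spaces of functions\<close>

text \<open>
  The following are stated for a set \<open>V\<close> of real functions that is closed under pointwise
  addition and scalar multiplication.  If \<open>N\<close> vanishes exactly on the functions that are zero
  almost everywhere, they express the corresponding properties of the normed space of
  almost-everywhere classes: functions at \<open>N\<close>-distance zero have the same limits and the same
  values under every functional in \<open>dual_space V N\<close>.
\<close>

definition function_subspace :: "('b \<Rightarrow> real) set \<Rightarrow> bool" where
  "function_subspace V \<longleftrightarrow>
     (\<lambda>x. 0) \<in> V \<and>
     (\<forall>u\<in>V. \<forall>v\<in>V. (\<lambda>x. u x + v x) \<in> V) \<and>
     (\<forall>c. \<forall>u\<in>V. (\<lambda>x. c * u x) \<in> V)"

definition seminorm_on :: "('b \<Rightarrow> real) set \<Rightarrow> (('b \<Rightarrow> real) \<Rightarrow> real) \<Rightarrow> bool" where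
  "seminorm_on V N \<longleftrightarrow>
     (\<forall>u\<in>V. 0 \<le> N u) \<and>
     (\<forall>c. \<forall>u\<in>V. N (\<lambda>x. c * u x) = \<bar>c\<bar> * N u) \<and>
     (\<forall>u\<in>V. \<forall>v\<in>V. N (\<lambda>x. u x + v x) \<le> N u + N v)"

definition complete_seminormed :: "('b \<Rightarrow> real) set \<Rightarrow> (('b \<Rightarrow> real) \<Rightarrow> real) \<Rightarrow> bool" where
  "complete_seminormed V N \<longleftrightarrow>
     (\<forall>s. (\<forall>n::nat. s n \<in> V) \<and>
          (\<forall>\<epsilon>>0. \<exists>M. \<forall>i\<ge>M. \<forall>j\<ge>M. N (\<lambda>x. s i x - s j x) < \<epsilon>) \<longrightarrow>
          (\<exists>u\<in>V. (\<lambda>n. N (\<lambda>x. s n x - u x)) \<longlonglongrightarrow> 0))"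

text \<open>
  Bounded linear functionals on \<open>V\<close>.  Requiring the value 0 outside \<open>V\<close> makes a functional
  determined by its values on \<open>V\<close> and keeps the dual closed under pointwise operations, so that
  the construction can be iterated.
\<close>

definition dual_space ::
  "('b \<Rightarrow> real) set \<Rightarrow> (('b \<Rightarrow> real) \<Rightarrow> real) \<Rightarrow> (('b \<Rightarrow> real) \<Rightarrow> real) set" where
  "dual_space V N =
     {\<phi>. (\<forall>u. u \<notin> V \<longrightarrow> \<phi> u = 0) \<and>
         (\<forall>u\<in>V. \<forall>v\<in>V. \<phi> (\<lambda>x. u x + v x) = \<phi> u + \<phi> v) \<and>
         (\<forall>c. \<forall>u\<in>V. \<phi> (\<lambda>x. c * u x) = c * \<phi> u) \<and>
         (\<exists>K. \<forall>u\<in>V. \<bar>\<phi> u\<bar> \<le> K * N u)}"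

definition dual_norm ::
  "('b \<Rightarrow> real) set \<Rightarrow> (('b \<Rightarrow> real) \<Rightarrow> real) \<Rightarrow> (('b \<Rightarrow> real) \<Rightarrow> real) \<Rightarrow> real" where
  "dual_norm V N \<phi> = (SUP u\<in>{u \<in> V. N u \<le> 1}. \<bar>\<phi> u\<bar>)"

definition reflexive_seminormed :: "('b \<Rightarrow> real) set \<Rightarrow> (('b \<Rightarrow> real) \<Rightarrow> real) \<Rightarrow> bool" where
  "reflexive_seminormed V N \<longleftrightarrow>
     (\<forall>\<Lambda> \<in> dual_space (dual_space V N) (dual_norm V N).
        \<exists>u\<in>V. \<forall>\<phi>\<in>dual_space V N. \<Lambda> \<phi> = \<phi> u)"


section \<open>The metric measure space\<close>

definition radon_measure :: "'a::topological_space measure \<Rightarrow> bool" where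
  "radon_measure m \<longleftrightarrow>
     sets m = sets borel \<and>
     (\<forall>K. compact K \<longrightarrow> emeasure m K < \<infinity>) \<and>
     (\<forall>A\<in>sets borel. emeasure m A = (SUP K\<in>{K. compact K \<and> K \<subseteq> A}. emeasure m K))"

definition full_support :: "'a::topological_space measure \<Rightarrow> bool" where
  "full_support m \<longleftrightarrow> (\<forall>U. open U \<and> U \<noteq> {} \<longrightarrow> 0 < emeasure m U)"

definition Lp_functions :: "'a measure \<Rightarrow> real \<Rightarrow> ('a \<Rightarrow> real) set" where
  "Lp_functions m p = {u \<in> borel_measurable m. integrable m (\<lambda>x. \<bar>u x\<bar> powr p)}"

definition Lp_norm :: "'a measure \<Rightarrow> real \<Rightarrow> ('a \<Rightarrow> real) \<Rightarrow> real" where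
  "Lp_norm m p u = (\<integral>x. \<bar>u x\<bar> powr p \<partial>m) powr (1 / p)"

definition Cc :: "('a::topological_space \<Rightarrow> real) set" where
  "Cc = {u. continuous_on UNIV u \<and> compact (closure {x. u x \<noteq> 0})}"

definition average :: "'a measure \<Rightarrow> 'a set \<Rightarrow> ('a \<Rightarrow> real) \<Rightarrow> real" where
  "average m A u = (LINT x:A|m. u x) / measure m A"

text \<open>The library's \<open>diameter\<close> is real-valued and meaningless for unbounded spaces.\<close>

definition ediam :: "'a::metric_space set \<Rightarrow> ennreal" where
  "ediam S = (SUP x\<in>S. SUP y\<in>S. ennreal (dist x y))"


section \<open>Energy forms with energy measures\<close>

text \<open>
  A subspace of the Lebesgue space is represented by the set \<open>\<F>\<close> of all representatives of its
  elements; \<open>ae_closed\<close>, \<open>energy_cong\<close> and \<open>measure_cong\<close> say that \<open>\<F>\<close>, \<open>\<E>\<close> and \<open>\<Gamma>\<close> are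
  given on almost-everywhere classes.  The values of \<open>\<E>\<close> and \<open>\<Gamma>\<close> outside \<open>\<F>\<close> are irrelevant.
\<close>

definition energy_norm ::
  "'a measure \<Rightarrow> real \<Rightarrow> (('a \<Rightarrow> real) \<Rightarrow> real) \<Rightarrow> ('a \<Rightarrow> real) \<Rightarrow> real" where
  "energy_norm m p \<E> u = Lp_norm m p u + \<E> u powr (1 / p)"

locale p_energy_form =
  fixes m :: "'a::polish_space measure"
    and p :: real
    and \<F> :: "('a \<Rightarrow> real) set"
    and \<E> :: "('a \<Rightarrow> real) \<Rightarrow> real"
    and \<Gamma> :: "('a \<Rightarrow> real) \<Rightarrow> 'a measure"
  assumes in_Lp: "\<F> \<subseteq> Lp_functions m p"
    and linear_subspace: "function_subspace \<F>"
    and ae_closed: "\<And>u v. u \<in> \<F> \<Longrightarrow> v \<in> borel_measurable m \<Longrightarrow> (AE x in m. u x = v x) \<Longrightarrow> v \<in> \<F>"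
    and energy_cong: "\<And>u v. u \<in> \<F> \<Longrightarrow> v \<in> \<F> \<Longrightarrow> (AE x in m. u x = v x) \<Longrightarrow> \<E> u = \<E> v"
    and measure_cong: "\<And>u v. u \<in> \<F> \<Longrightarrow> v \<in> \<F> \<Longrightarrow> (AE x in m. u x = v x) \<Longrightarrow> \<Gamma> u = \<Gamma> v"
    and energy_nonneg: "\<And>u. u \<in> \<F> \<Longrightarrow> 0 \<le> \<E> u"
    and energy_seminorm: "seminorm_on \<F> (\<lambda>u. \<E> u powr (1 / p))"
    and measure_sets: "\<And>u. u \<in> \<F> \<Longrightarrow> sets (\<Gamma> u) = sets borel"
    and measure_finite: "\<And>u. u \<in> \<F> \<Longrightarrow> finite_measure (\<Gamma> u)"
    and contraction:
      "\<And>u \<phi>. u \<in> \<F> \<Longrightarrow> 1-lipschitz_on UNIV \<phi> \<Longrightarrow> \<phi> (0::real) = (0::real) \<Longrightarrow>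
         (\<lambda>x. \<phi> (u x)) \<in> \<F> \<and> \<E> (\<lambda>x. \<phi> (u x)) \<le> \<E> u"
    and energy_kernel: "\<And>u. u \<in> \<F> \<Longrightarrow> \<E> u = 0 \<Longrightarrow> \<exists>c. AE x in m. u x = c"
    and banach: "complete_seminormed \<F> (energy_norm m p \<E>)"
    and reflexive: "reflexive_seminormed \<F> (energy_norm m p \<E>)"
    and dense_in_domain:
      "\<And>u \<epsilon>. u \<in> \<F> \<Longrightarrow> 0 < \<epsilon> \<Longrightarrow> \<exists>v\<in>\<F> \<inter> Cc. energy_norm m p \<E> (\<lambda>x. u x - v x) < \<epsilon>"
    and dense_in_Cc:
      "\<And>u \<epsilon>. u \<in> Cc \<Longrightarrow> 0 < \<epsilon> \<Longrightarrow> \<exists>v\<in>\<F> \<inter> Cc. \<forall>x. \<bar>u x - v x\<bar> < \<epsilon>"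
    and measure_seminorm:
      "\<And>A. A \<in> sets borel \<Longrightarrow> seminorm_on \<F> (\<lambda>u. measure (\<Gamma> u) A powr (1 / p))"
    and total_mass: "\<And>u. u \<in> \<F> \<Longrightarrow> \<E> u = measure (\<Gamma> u) UNIV"
    and strongly_local:
      "\<And>u v U c. u \<in> \<F> \<inter> Cc \<Longrightarrow> v \<in> \<F> \<inter> Cc \<Longrightarrow> open U \<Longrightarrow> (\<And>x. x \<in> U \<Longrightarrow> u x - v x = c) \<Longrightarrow>
         (\<And>A. A \<in> sets borel \<Longrightarrow> A \<subseteq> U \<Longrightarrow> emeasure (\<Gamma> u) A = emeasure (\<Gamma> v) A)"


section \<open>Scale function and analytic conditions\<close>

definition scale_function :: "(real \<Rightarrow> real) \<Rightarrow> bool" where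
  "scale_function \<Psi> \<longleftrightarrow>
     continuous_on {0<..} \<Psi> \<and> strict_mono_on {0<..} \<Psi> \<and> bij_betw \<Psi> {0<..} {0<..} \<and>
     (\<exists>C \<beta>\<^sub>1 \<beta>\<^sub>2. 1 \<le> C \<and> 0 < \<beta>\<^sub>1 \<and> 0 < \<beta>\<^sub>2 \<and>
        (\<forall>r R. 0 < r \<and> r \<le> R \<longrightarrow>
           inverse C * (R / r) powr \<beta>\<^sub>1 \<le> \<Psi> R / \<Psi> r \<and> \<Psi> R / \<Psi> r \<le> C * (R / r) powr \<beta>\<^sub>2))"

definition volume_doubling :: "'a::metric_space measure \<Rightarrow> bool" where
  "volume_doubling m \<longleftrightarrow>
     (\<exists>c\<ge>1. \<forall>x r. 0 < r \<longrightarrow> emeasure m (ball x (2 * r)) \<le> ennreal c * emeasure m (ball x r))"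

definition poincare_inequality ::
  "'a::metric_space measure \<Rightarrow> real \<Rightarrow> ('a \<Rightarrow> real) set \<Rightarrow> (('a \<Rightarrow> real) \<Rightarrow> 'a measure)
     \<Rightarrow> (real \<Rightarrow> real) \<Rightarrow> bool" where
  "poincare_inequality m p \<F> \<Gamma> \<Psi> \<longleftrightarrow>
     (\<exists>C A. 0 < C \<and> 1 \<le> A \<and>
        (\<forall>x r. \<forall>u\<in>\<F>. 0 < r \<longrightarrow>
           (\<integral>\<^sup>+y\<in>ball x r. ennreal (\<bar>u y - average m (ball x r) u\<bar> powr p) \<partial>m)
             \<le> ennreal (C * \<Psi> r) * emeasure (\<Gamma> u) (ball x (A * r))))"

definition capacity_upper_bound ::
  "'a::metric_space measure \<Rightarrow> ('a \<Rightarrow> real) set \<Rightarrow> (('a \<Rightarrow> real) \<Rightarrow> real) \<Rightarrow> (real \<Rightarrow> real) \<Rightarrow> bool" where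
  "capacity_upper_bound m \<F> \<E> \<Psi> \<longleftrightarrow>
     (\<exists>C A\<^sub>1 A\<^sub>2. 1 < C \<and> 1 < A\<^sub>1 \<and> 1 < A\<^sub>2 \<and>
        (\<forall>x R. 0 < R \<and> ennreal R < ediam (UNIV :: 'a set) / ennreal A\<^sub>2 \<longrightarrow>
           (INF u\<in>{u \<in> \<F>. (AE y in m. y \<in> ball x R \<longrightarrow> u y = 1) \<and>
                            (AE y in m. y \<notin> ball x (A\<^sub>1 * R) \<longrightarrow> u y = 0)}. ennreal (\<E> u))
             \<le> ennreal C * emeasure m (ball x R) / ennreal (\<Psi> R)))"


section \<open>Local spaces and the extension property\<close>

text \<open>A function on \<open>U\<close> is represented by a function on the whole space, whose values outside
  \<open>U\<close> play no role.\<close>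

definition relcompact_open_subsets :: "'a::topological_space set \<Rightarrow> 'a set set" where
  "relcompact_open_subsets U = {A. open A \<and> compact (closure A) \<and> closure A \<subseteq> U}"

definition local_domain ::
  "'a::topological_space measure \<Rightarrow> ('a \<Rightarrow> real) set \<Rightarrow> 'a set \<Rightarrow> ('a \<Rightarrow> real) set" where
  "local_domain m \<F> U =
     {u \<in> borel_measurable (restrict_space borel U).
        \<forall>A\<in>relcompact_open_subsets U. \<exists>v\<in>\<F>. AE x in m. x \<in> A \<longrightarrow> u x = v x}"

text \<open>
  The energy measure of \<open>u \<in> local_domain m \<F> U\<close>, evaluated at a Borel set \<open>E \<subseteq> U\<close>.  For fixed
  \<open>A\<close> the value \<open>emeasure (\<Gamma> v) (E \<inter> A)\<close> does not depend on the choice of \<open>v\<close>, and it increases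
  with \<open>A\<close>; so the supremum is \<open>emeasure (\<Gamma> v) E\<close> if \<open>E \<subseteq> A\<close>, and in general the monotone limit
  along any exhaustion of \<open>U\<close> by relatively compact open subsets.
\<close>

definition local_energy_measure ::
  "'a::topological_space measure \<Rightarrow> ('a \<Rightarrow> real) set \<Rightarrow> (('a \<Rightarrow> real) \<Rightarrow> 'a measure)
     \<Rightarrow> 'a set \<Rightarrow> ('a \<Rightarrow> real) \<Rightarrow> 'a set \<Rightarrow> ennreal" where
  "local_energy_measure m \<F> \<Gamma> U u E =
     (SUP (A, v)\<in>{(A, v). A \<in> relcompact_open_subsets U \<and> v \<in> \<F> \<and>
                          (AE x in m. x \<in> A \<longrightarrow> u x = v x)}. emeasure (\<Gamma> v) (E \<inter> A))"

definition finite_energy_domain ::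
  "'a::topological_space measure \<Rightarrow> real \<Rightarrow> ('a \<Rightarrow> real) set \<Rightarrow> (('a \<Rightarrow> real) \<Rightarrow> 'a measure)
     \<Rightarrow> 'a set \<Rightarrow> ('a \<Rightarrow> real) set" where
  "finite_energy_domain m p \<F> \<Gamma> U =
     {u \<in> local_domain m \<F> U.
        (\<integral>\<^sup>+x\<in>U. ennreal (\<bar>u x\<bar> powr p) \<partial>m) + local_energy_measure m \<F> \<Gamma> U u U < \<infinity>}"

definition extension_property ::
  "'a::topological_space measure \<Rightarrow> real \<Rightarrow> ('a \<Rightarrow> real) set \<Rightarrow> (('a \<Rightarrow> real) \<Rightarrow> 'a measure)
     \<Rightarrow> 'a set \<Rightarrow> bool" where
  "extension_property m p \<F> \<Gamma> \<Omega> \<longleftrightarrow>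
     open \<Omega> \<and> \<Omega> \<noteq> UNIV \<and>
     (\<forall>f\<in>finite_energy_domain m p \<F> \<Gamma> \<Omega>.
        \<exists>F\<in>\<F>. (AE x in m. x \<in> \<Omega> \<longrightarrow> f x = F x) \<and> emeasure (\<Gamma> F) (frontier \<Omega>) = 0)"


section \<open>Averaged difference functionals\<close>

text \<open>
  The weight is \<open>w x y = \<Psi> r\<close> or \<open>w x y = \<Psi> (dist x y)\<close>.  On the diagonal the integrand is
  \<open>0 powr p / w x x = 0\<close>, whatever \<open>w x x\<close> is, so the diagonal does not contribute.
\<close>

definition difference_energy ::
  "'a::metric_space measure \<Rightarrow> real \<Rightarrow> 'a set \<Rightarrow> ('a \<Rightarrow> real) \<Rightarrow> ('a \<Rightarrow> 'a \<Rightarrow> real) \<Rightarrow> real \<Rightarrow> ennreal" where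
  "difference_energy m p \<Omega> u w r =
     (\<integral>\<^sup>+y\<in>\<Omega>. 1 / emeasure m (ball y r) *
        (\<integral>\<^sup>+x\<in>\<Omega> \<inter> ball y r. ennreal (\<bar>u x - u y\<bar> powr p / w x y) \<partial>m) \<partial>m)"

end

(*
  Upper bounds.  By the Poincare inequality, averaged over the centre of the ball with Tonelli's theorem, the
  functional with weight Psi(r) is at most a constant times the energy near the set.  Spheres are non-empty, since
  otherwise the indicator function of a ball would have zero energy; hence the measure satisfies a reverse doubling
  condition, and summing over dyadic annuli gives the weight Psi(d(x,y)).

  Lower bounds.  A continuous v is discretized at scale r with a partition of unity of small energy.  By strong
  locality the energy of the discretization on a set is bounded by the functional of v at scale r near that set.  As r
  tends to 0 the discretizations converge to v in the Lebesgue space, and by reflexivity convex combinations of them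
  converge to v in energy (Mazur's lemma).  The upper bound and density extend the estimate to all v.  Applied to open
  subsets, it also makes up for the missing strong locality of the energy measures of discontinuous functions.

  Mazur's lemma also yields the continuous cutoff functions from which the partition of unity is made: the capacity
  bound only provides discontinuous ones.
*)
theory Submission
  imports Defs
begin

section \<open>Reflexive spaces\<close>

text \<open>No product or chain rule is assumed for the energy measures; available are the seminorm
  inequalities, contraction by 1-Lipschitz maps, and strong locality on
  \<open>\<F> \<inter> Cc\<close>. Hence all constructions use sums, truncations, minima and maxima.
  Near a net point the discretization \<open>w\<close> differs by a constant from a sum of boundedly
  many small terms, and locality exchanges the two. A local bound survives convex combinations
  because \<open>{h. measure_root K h \<le> B}\<close> is convex, and it survives the limit because
  \<open>measure_root K\<close> is dominated by \<open>energy_root\<close>. Elements of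
  \<open>\<F>\<close> are functions, not classes, so duality is developed for seminorms on sets of
  functions. The extension property serves the upper bound: pairs of points of
  \<open>\<Omega>\<close> at distance below \<open>r\<close> feel the energy of an extension
  \<open>F\<close> in a neighbourhood of \<open>\<Omega>\<close> that shrinks to
  \<open>closure \<Omega>\<close>, and the boundary carries no energy. Local energy is a supremum
  over pairs \<open>(A, v)\<close>; the lower bound treats each pair by itself, while for the upper
  bound the extension is one admissible \<open>v\<close> for all \<open>A\<close>.\<close>

lemma function_subspaceD:
  assumes "function_subspace V"
  shows function_subspace_zero: "(\<lambda>x. 0) \<in> V"
    and function_subspace_add: "u \<in> V \<Longrightarrow> v \<in> V \<Longrightarrow> (\<lambda>x. u x + v x) \<in> V"
    and function_subspace_scale: "u \<in> V \<Longrightarrow> (\<lambda>x. c * u x) \<in> V"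
  using assms unfolding function_subspace_def by blast+

lemma function_subspace_diff:
  assumes "function_subspace V" "u \<in> V" "v \<in> V"
  shows "(\<lambda>x. u x - v x) \<in> V"
  using function_subspace_add[OF assms(1,2) function_subspace_scale[OF assms(1,3), of "-1"]]
  by simp

lemma function_subspace_sum:
  assumes "function_subspace V" "\<And>i. i \<in> I \<Longrightarrow> f i \<in> V"
  shows "(\<lambda>x. \<Sum>i\<in>I. f i x) \<in> V"
  using assms(2)
  by (induction I rule: infinite_finite_induct)
     (simp_all add: function_subspace_zero[OF assms(1)] function_subspace_add[OF assms(1)])

lemma seminorm_onD:
  assumes "seminorm_on V N"
  shows seminorm_on_nonneg: "u \<in> V \<Longrightarrow> 0 \<le> N u"
    and seminorm_on_scale: "u \<in> V \<Longrightarrow> N (\<lambda>x. c * u x) = \<bar>c\<bar> * N u"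
    and seminorm_on_add: "u \<in> V \<Longrightarrow> v \<in> V \<Longrightarrow> N (\<lambda>x. u x + v x) \<le> N u + N v"
  using assms unfolding seminorm_on_def by blast+

lemma seminorm_on_zero:
  assumes "seminorm_on V N" "function_subspace V"
  shows "N (\<lambda>x. 0) = 0"
  using seminorm_on_scale[OF assms(1) function_subspace_zero[OF assms(2)], of 0] by simp

lemma seminorm_on_minus:
  assumes "seminorm_on V N" "u \<in> V"
  shows "N (\<lambda>x. - u x) = N u"
  using seminorm_on_scale[OF assms, of "-1"] by simp

lemma seminorm_on_diff:
  assumes "seminorm_on V N" "function_subspace V" "u \<in> V" "v \<in> V"
  shows "N (\<lambda>x. u x - v x) \<le> N u + N v"
  using seminorm_on_add[OF assms(1,3) function_subspace_scale[OF assms(2,4), of "-1"]]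
    seminorm_on_minus[OF assms(1,4)]
  by simp

lemma seminorm_on_sum:
  assumes "seminorm_on V N" "function_subspace V" "\<And>i. i \<in> I \<Longrightarrow> f i \<in> V"
  shows "N (\<lambda>x. \<Sum>i\<in>I. f i x) \<le> (\<Sum>i\<in>I. N (f i))"
  using assms(3)
proof (induction I rule: infinite_finite_induct)
  case (insert i I)
  have "N (\<lambda>x. f i x + (\<Sum>i\<in>I. f i x)) \<le> N (f i) + N (\<lambda>x. \<Sum>i\<in>I. f i x)"
    using insert.prems by (intro seminorm_on_add[OF assms(1)] function_subspace_sum[OF assms(2)]) auto
  then show ?case
    using insert by (auto intro: order_trans)
qed (simp_all add: seminorm_on_zero[OF assms(1,2)])

section \<open>Sublinear functionals and the Hahn-Banach theorem\<close>

definition sublinear_on :: "('b \<Rightarrow> real) set \<Rightarrow> (('b \<Rightarrow> real) \<Rightarrow> real) \<Rightarrow> bool" where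
  "sublinear_on V q \<longleftrightarrow>
     (\<forall>u\<in>V. \<forall>v\<in>V. q (\<lambda>x. u x + v x) \<le> q u + q v) \<and>
     (\<forall>c\<ge>0. \<forall>u\<in>V. q (\<lambda>x. c * u x) = c * q u)"

lemma sublinear_onD:
  assumes "sublinear_on V q"
  shows sublinear_on_add: "u \<in> V \<Longrightarrow> v \<in> V \<Longrightarrow> q (\<lambda>x. u x + v x) \<le> q u + q v"
    and sublinear_on_scale: "c \<ge> 0 \<Longrightarrow> u \<in> V \<Longrightarrow> q (\<lambda>x. c * u x) = c * q u"
  using assms unfolding sublinear_on_def by auto

text \<open>A sublinear \<open>q\<close> need not be even, so the reverse triangle inequality
  involves \<open>q (\<lambda>x. - v x)\<close>. It supplies the lower bounds that keep the infima
  over sublinear functionals finite.\<close>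

lemma sublinear_on_ge:
  assumes "sublinear_on V q" "function_subspace V" "u \<in> V" "v \<in> V"
  shows "q u - q (\<lambda>x. - v x) \<le> q (\<lambda>x. u x + v x)"
proof -
  have "q (\<lambda>x. (u x + v x) + (-1) * v x) \<le> q (\<lambda>x. u x + v x) + q (\<lambda>x. (-1) * v x)"
    by (intro sublinear_on_add[OF assms(1)] function_subspace_add[OF assms(2-4)]
        function_subspace_scale[OF assms(2,4)])
  then show ?thesis by simp
qed

lemma sublinear_on_zero:
  assumes "sublinear_on V q" "function_subspace V"
  shows "q (\<lambda>x. 0) = 0"
proof -
  have "q (\<lambda>x. 0 * 0) = 0 * q (\<lambda>x. 0)"
    by (intro sublinear_on_scale[OF assms(1)] function_subspace_zero[OF assms(2)]) simp
  then show ?thesis by simp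
qed

lemma
  fixes f :: "'i \<Rightarrow> real"
  assumes "0 \<le> c" "A \<noteq> {}"
  shows cINF_mult_left: "bdd_below (f ` A) \<Longrightarrow> (INF i\<in>A. c * f i) = c * (INF i\<in>A. f i)"
    and cSUP_mult_left: "bdd_above (f ` A) \<Longrightarrow> (SUP i\<in>A. c * f i) = c * (SUP i\<in>A. f i)"
proof -
  have mono: "mono (\<lambda>t. c * t)" using assms(1) by (auto simp: mono_def intro: mult_left_mono)
  have cont: "continuous (at t within S) (\<lambda>t. c * t)" for t S by (intro continuous_intros)
  show "bdd_below (f ` A) \<Longrightarrow> (INF i\<in>A. c * f i) = c * (INF i\<in>A. f i)"
    using continuous_at_Inf_mono[OF mono cont, of "f ` A"] assms(2) by (simp add: image_image)
  show "bdd_above (f ` A) \<Longrightarrow> (SUP i\<in>A. c * f i) = c * (SUP i\<in>A. f i)"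
    using continuous_at_Sup_mono[OF mono cont, of "f ` A"] assms(2) by (simp add: image_image)
qed

text \<open>Provides the lower bounds of chains for Zorn's lemma. For subadditivity, two members
  \<open>f\<close> and \<open>g\<close> are replaced by the smaller one, which is subadditive
  itself; \<open>- q (\<lambda>x. - u x)\<close> bounds all members from below.\<close>

lemma sublinear_on_INF_chain:
  assumes V: "function_subspace V" and "C \<noteq> {}"
    and sub: "\<And>f. f \<in> C \<Longrightarrow> sublinear_on V f"
    and le: "\<And>f u. f \<in> C \<Longrightarrow> u \<in> V \<Longrightarrow> f u \<le> q u"
    and chain: "\<And>f g. f \<in> C \<Longrightarrow> g \<in> C \<Longrightarrow> (\<forall>u\<in>V. f u \<le> g u) \<or> (\<forall>u\<in>V. g u \<le> f u)"
  shows "sublinear_on V (\<lambda>u. INF f\<in>C. f u)"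
    and "f \<in> C \<Longrightarrow> u \<in> V \<Longrightarrow> (INF f\<in>C. f u) \<le> f u"
proof -
  have bdd: "bdd_below ((\<lambda>f. f u) ` C)" if "u \<in> V" for u
  proof (rule bdd_belowI2)
    fix f assume f: "f \<in> C"
    have u': "(\<lambda>x. (-1) * u x) \<in> V" using function_subspace_scale[OF V that] .
    have "f (\<lambda>x. 0) - f (\<lambda>x. - u x) \<le> f (\<lambda>x. 0 + u x)"
      by (rule sublinear_on_ge[OF sub[OF f] V function_subspace_zero[OF V] that])
    then show "- q (\<lambda>x. - u x) \<le> f u"
      using sublinear_on_zero[OF sub[OF f] V] le[OF f u'] by simp
  qed
  show *: "(INF f\<in>C. f u) \<le> f u" if "f \<in> C" "u \<in> V" for f u
    using that by (intro cINF_lower bdd)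
  show "sublinear_on V (\<lambda>u. INF f\<in>C. f u)"
    unfolding sublinear_on_def
  proof (intro conjI ballI allI impI)
    fix u v assume uv: "u \<in> V" "v \<in> V"
    let ?w = "\<lambda>x. u x + v x"
    have w: "?w \<in> V" using function_subspace_add[OF V uv] .
    have "(INF f\<in>C. f ?w) \<le> f u + g v" if fg: "f \<in> C" "g \<in> C" for f g
      using chain[OF fg]
    proof
      assume "\<forall>u\<in>V. f u \<le> g u"
      moreover have "f ?w \<le> f u + f v" using sublinear_on_add[OF sub[OF fg(1)] uv] .
      ultimately show ?thesis using *[OF fg(1) w] uv by force
    next
      assume "\<forall>u\<in>V. g u \<le> f u"
      moreover have "g ?w \<le> g u + g v" using sublinear_on_add[OF sub[OF fg(2)] uv] .
      ultimately show ?thesis using *[OF fg(2) w] uv by force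
    qed
    then have "(INF f\<in>C. f ?w) - f u \<le> g v" if "f \<in> C" "g \<in> C" for f g
      using that by (simp add: algebra_simps)
    then have "(INF f\<in>C. f ?w) - f u \<le> (INF g\<in>C. g v)" if "f \<in> C" for f
      using that by (intro cINF_greatest \<open>C \<noteq> {}\<close>)
    then have "(INF f\<in>C. f ?w) - (INF g\<in>C. g v) \<le> (INF f\<in>C. f u)"
      by (intro cINF_greatest \<open>C \<noteq> {}\<close>) (simp add: algebra_simps)
    then show "(INF f\<in>C. f ?w) \<le> (INF f\<in>C. f u) + (INF g\<in>C. g v)" by simp
  next
    fix c :: real and u assume c: "0 \<le> c" and u: "u \<in> V"
    have "(INF f\<in>C. f (\<lambda>x. c * u x)) = (INF f\<in>C. c * f u)"
      using sub c u unfolding sublinear_on_def by (intro INF_cong) auto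
    also have "\<dots> = c * (INF f\<in>C. f u)"
      by (rule cINF_mult_left[OF c \<open>C \<noteq> {}\<close> bdd[OF u]])
    finally show "(INF f\<in>C. f (\<lambda>x. c * u x)) = c * (INF f\<in>C. f u)" .
  qed
qed

text \<open>The competitor that forces a minimal sublinear functional to be additive.\<close>

lemma sublinear_on_shift:
  assumes V: "function_subspace V" and q: "sublinear_on V q" and w: "w \<in> V"
  defines "r \<equiv> \<lambda>v. INF t\<in>{0..}. q (\<lambda>x. v x + t * w x) - t * q w"
  shows "sublinear_on V r" and "v \<in> V \<Longrightarrow> t \<ge> 0 \<Longrightarrow> r v \<le> q (\<lambda>x. v x + t * w x) - t * q w"
proof -
  have r_eq: "r v = (INF t\<in>{0..}. q (\<lambda>x. v x + t * w x) - t * q w)" for v by (simp add: r_def)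
  have hom: "q (\<lambda>x. c * u x) = c * q u" if "c \<ge> 0" "u \<in> V" for c u
    using sublinear_on_scale[OF q that] .
  have sub: "q (\<lambda>x. u x + v x) \<le> q u + q v" if "u \<in> V" "v \<in> V" for u v
    using sublinear_on_add[OF q that] .
  have tw: "(\<lambda>x. t * w x) \<in> V" for t using function_subspace_scale[OF V w] .
  have vtw: "(\<lambda>x. v x + t * w x) \<in> V" if "v \<in> V" for v t using function_subspace_add[OF V that tw] .
  have bdd: "bdd_below ((\<lambda>t. q (\<lambda>x. v x + t * w x) - t * q w) ` {0..})" if v: "v \<in> V" for v
  proof (rule bdd_belowI2)
    fix t :: real assume "t \<in> {0..}"
    then have "q (\<lambda>x. t * w x) = t * q w" using hom w by auto
    moreover have "q (\<lambda>x. t * w x) - q (\<lambda>x. - v x) \<le> q (\<lambda>x. t * w x + v x)"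
      by (rule sublinear_on_ge[OF q V tw v])
    moreover have "(\<lambda>x. t * w x + v x) = (\<lambda>x. v x + t * w x)" by (simp add: add.commute)
    ultimately show "- q (\<lambda>x. - v x) \<le> q (\<lambda>x. v x + t * w x) - t * q w" by simp
  qed
  show le: "r v \<le> q (\<lambda>x. v x + t * w x) - t * q w" if "v \<in> V" "t \<ge> 0" for v t
    unfolding r_def using that by (intro cINF_lower bdd) auto
  show "sublinear_on V r"
    unfolding sublinear_on_def
  proof (intro conjI ballI allI impI)
    fix u v assume uv: "u \<in> V" "v \<in> V"
    let ?Q = "\<lambda>v t. q (\<lambda>x. v x + t * w x) - t * q w"
    have "r (\<lambda>x. u x + v x) \<le> ?Q u s + ?Q v t" if st: "s \<ge> 0" "t \<ge> 0" for s t
    proof -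
      have "r (\<lambda>x. u x + v x) \<le> q (\<lambda>x. u x + v x + (s + t) * w x) - (s + t) * q w"
        using le[OF function_subspace_add[OF V uv], of "s + t"] st by simp
      also have "(\<lambda>x. u x + v x + (s + t) * w x) = (\<lambda>x. (u x + s * w x) + (v x + t * w x))"
        by (simp add: algebra_simps)
      also have "q \<dots> \<le> q (\<lambda>x. u x + s * w x) + q (\<lambda>x. v x + t * w x)"
        by (intro sub vtw uv)
      finally show ?thesis by (simp add: algebra_simps)
    qed
    then have "r (\<lambda>x. u x + v x) - ?Q u s \<le> ?Q v t" if "s \<ge> 0" "t \<ge> 0" for s t
      using that by (simp add: diff_le_eq add.commute)
    then have "r (\<lambda>x. u x + v x) - ?Q u s \<le> r v" if "s \<ge> 0" for s
      unfolding r_eq[of v] using that by (intro cINF_greatest) simp_all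
    then have "r (\<lambda>x. u x + v x) - r v \<le> ?Q u s" if "s \<ge> 0" for s
      using that by (simp add: diff_le_eq add.commute)
    then have "r (\<lambda>x. u x + v x) - r v \<le> r u"
      unfolding r_eq[of u] by (intro cINF_greatest) simp_all
    then show "r (\<lambda>x. u x + v x) \<le> r u + r v" by simp
  next
    fix c :: real and u assume c: "0 \<le> c" and u: "u \<in> V"
    \<comment> \<open>One inequality suffices: applied to \<open>1 / c\<close> and
      \<open>c * u\<close> it gives its own converse.\<close>
    have *: "r (\<lambda>x. c * u x) \<le> c * r u" if "c > 0" "u \<in> V" for c u
    proof -
      have "r (\<lambda>x. c * u x) / c \<le> q (\<lambda>x. u x + t * w x) - t * q w" if t: "t \<ge> 0" for t
      proof -
        have "r (\<lambda>x. c * u x) \<le> q (\<lambda>x. c * u x + (c * t) * w x) - (c * t) * q w"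
          using le[where v = "\<lambda>x. c * u x" and t = "c * t"] function_subspace_scale[OF V \<open>u \<in> V\<close>, of c] t \<open>c > 0\<close> by simp
        also have "(\<lambda>x. c * u x + (c * t) * w x) = (\<lambda>x. c * (u x + t * w x))"
          by (simp add: algebra_simps)
        also have "q \<dots> = c * q (\<lambda>x. u x + t * w x)"
          using \<open>c > 0\<close> by (intro hom vtw \<open>u \<in> V\<close>) simp
        finally show ?thesis using \<open>c > 0\<close> by (simp add: field_simps)
      qed
      then have "r (\<lambda>x. c * u x) / c \<le> r u"
        unfolding r_eq[of u] by (intro cINF_greatest) simp_all
      then show ?thesis using \<open>c > 0\<close> by (simp add: field_simps)
    qed
    show "r (\<lambda>x. c * u x) = c * r u"
    proof (cases "c = 0")
      case True
      have "r (\<lambda>x. 0) = 0"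
      proof (rule antisym)
        show "r (\<lambda>x. 0) \<le> 0"
          using le[OF function_subspace_zero[OF V], of 0] sublinear_on_zero[OF q V] by simp
        show "0 \<le> r (\<lambda>x. 0)"
          unfolding r_def using hom w by (intro cINF_greatest) auto
      qed
      then show ?thesis using True by simp
    next
      case False
      then have c: "c > 0" using c by simp
      have "r (\<lambda>x. (1/c) * (c * u x)) \<le> (1/c) * r (\<lambda>x. c * u x)"
        using c by (intro * function_subspace_scale[OF V u]) simp
      then have "r u \<le> r (\<lambda>x. c * u x) / c" using c by simp
      then have "c * r u \<le> r (\<lambda>x. c * u x)" using c by (simp add: field_simps)
      with *[OF c u] show ?thesis by simp
    qed
  qed
qed

text \<open>Nothing is extended from a subspace: a minimal sublinear functional below
  \<open>q\<close> is already linear. Minimality against the competitor \<open>r\<close> of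
  \<open>sublinear_on_shift\<close> gives \<open>L v = r v\<close>, which is at most
  \<open>L (v + w) - L w\<close>; this is the missing half of additivity.\<close>

theorem hahn_banach:
  assumes V: "function_subspace V" and q: "sublinear_on V q"
  obtains L where "\<And>u. u \<notin> V \<Longrightarrow> L u = 0"
    and "\<And>u v. u \<in> V \<Longrightarrow> v \<in> V \<Longrightarrow> L (\<lambda>x. u x + v x) = L u + L v"
    and "\<And>c u. u \<in> V \<Longrightarrow> L (\<lambda>x. c * u x) = c * L u"
    and "\<And>u. u \<in> V \<Longrightarrow> L u \<le> q u"
proof -
  \<comment> \<open>The value 0 outside \<open>V\<close> makes the order antisymmetric, and
    \<open>dual_space\<close> demands it of functionals anyway. The order \<open>P\<close> is
    reversed, so that a maximal element is a minimal functional.\<close>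
  define A where "A = {f. sublinear_on V f \<and> (\<forall>u\<in>V. f u \<le> q u) \<and> (\<forall>u. u \<notin> V \<longrightarrow> f u = 0)}"
  define P where "P = (\<lambda>f g :: ('a \<Rightarrow> real) \<Rightarrow> real. \<forall>u\<in>V. g u \<le> f u)"
  have ext: "sublinear_on V (\<lambda>u. if u \<in> V then f u else 0)" if "sublinear_on V f" for f
    using that function_subspace_add[OF V] function_subspace_scale[OF V]
    unfolding sublinear_on_def by simp
  have "\<exists>L\<in>A. \<forall>f\<in>A. P L f \<longrightarrow> f = L"
  proof (rule predicate_Zorn)
    show "partial_order_on A (relation_of P A)"
    proof (rule partial_order_on_relation_ofI)
      show "a = b" if "a \<in> A" "b \<in> A" "P a b" "P b a" for a b
      proof
        fix u show "a u = b u" using that unfolding A_def P_def by (cases "u \<in> V") (auto intro: antisym)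
      qed
    qed (auto simp: P_def intro: order_trans)
  next
    fix C assume "C \<in> Chains (relation_of P A)"
    then have CA: "C \<subseteq> A" and chain: "f \<in> C \<Longrightarrow> g \<in> C \<Longrightarrow> P f g \<or> P g f" for f g
      unfolding Chains_def relation_of_def by auto
    show "\<exists>u\<in>A. \<forall>a\<in>C. P a u"
    proof (cases "C = {}")
      case True
      have "(\<lambda>u. if u \<in> V then q u else 0) \<in> A" using ext[OF q] unfolding A_def by auto
      then show ?thesis using True by blast
    next
      case False
      let ?p = "\<lambda>u. INF f\<in>C. f u"
      note inf = sublinear_on_INF_chain[OF V False, of q]
      have p: "sublinear_on V ?p" and le: "\<And>f u. f \<in> C \<Longrightarrow> u \<in> V \<Longrightarrow> ?p u \<le> f u"
        using inf CA chain unfolding A_def P_def by blast+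
      obtain f0 where f0: "f0 \<in> C" using False by blast
      then have "?p u \<le> q u" if "u \<in> V" for u
        using le[OF f0 that] CA that unfolding A_def by force
      then have "(\<lambda>u. if u \<in> V then ?p u else 0) \<in> A" using ext[OF p] unfolding A_def by auto
      then show ?thesis using le unfolding P_def
        by (intro bexI[of _ "\<lambda>u. if u \<in> V then ?p u else 0"]) auto
    qed
  qed
  then obtain L where L: "L \<in> A" and min: "\<And>f. f \<in> A \<Longrightarrow> P L f \<Longrightarrow> f = L" by blast
  have sL: "sublinear_on V L" and Lq: "\<And>u. u \<in> V \<Longrightarrow> L u \<le> q u" and L0: "\<And>u. u \<notin> V \<Longrightarrow> L u = 0"
    using L unfolding A_def by auto
  have hom: "L (\<lambda>x. c * u x) = c * L u" if "c \<ge> 0" "u \<in> V" for c u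
    using sublinear_on_scale[OF sL that] .
  have add: "L (\<lambda>x. v x + w x) = L v + L w" if vw: "v \<in> V" "w \<in> V" for v w
  proof -
    define r where "r = (\<lambda>v. INF t\<in>{0..}. L (\<lambda>x. v x + t * w x) - t * L w)"
    define r' where "r' = (\<lambda>u. if u \<in> V then r u else 0)"
    have r: "sublinear_on V r" "\<And>v t. v \<in> V \<Longrightarrow> t \<ge> 0 \<Longrightarrow> r v \<le> L (\<lambda>x. v x + t * w x) - t * L w"
      using sublinear_on_shift[OF V sL vw(2)] unfolding r_def by auto
    have rL: "r u \<le> L u" if "u \<in> V" for u using r(2)[OF that, of 0] by simp
    from rL have "r' u \<le> q u" if "u \<in> V" for u using that Lq[OF that] unfolding r'_def by force
    then have "r' \<in> A" using ext[OF r(1)] unfolding A_def r'_def by simp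
    moreover have "P L r'" using rL unfolding P_def r'_def by auto
    ultimately have "r' = L" using min by blast
    moreover have "r' v = r v" using vw(1) unfolding r'_def by simp
    ultimately have "L v = r v" by simp
    then have "L v \<le> L (\<lambda>x. v x + w x) - L w" using r(2)[OF vw(1), of 1] by simp
    moreover have "L (\<lambda>x. v x + w x) \<le> L v + L w" using sublinear_on_add[OF sL vw] .
    ultimately show ?thesis by simp
  qed
  have hom': "L (\<lambda>x. c * u x) = c * L u" if u: "u \<in> V" for c u
  proof (cases "c \<ge> 0")
    case False
    have "L (\<lambda>x. c * u x + (-c) * u x) = L (\<lambda>x. c * u x) + L (\<lambda>x. (-c) * u x)"
      by (intro add function_subspace_scale[OF V u])
    moreover have "L (\<lambda>x. (-c) * u x) = (-c) * L u" using False u by (intro hom) auto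
    ultimately show ?thesis using sublinear_on_zero[OF sL V] by simp
  qed (use hom u in auto)
  show ?thesis by (rule that[of L]) (use L0 add hom' Lq in auto)
qed

section \<open>Dual spaces, separation of convex sets and Mazur's lemma\<close>

definition convex_functions :: "('b \<Rightarrow> real) set \<Rightarrow> bool" where
  "convex_functions K \<longleftrightarrow>
     (\<forall>f\<in>K. \<forall>g\<in>K. \<forall>s t. 0 \<le> s \<longrightarrow> 0 \<le> t \<longrightarrow> s + t = 1 \<longrightarrow> (\<lambda>x. s * f x + t * g x) \<in> K)"

lemma convex_functionsD:
  assumes "convex_functions K" "f \<in> K" "g \<in> K" "0 \<le> s" "0 \<le> t" "s + t = 1"
  shows "(\<lambda>x. s * f x + t * g x) \<in> K"
  using assms unfolding convex_functions_def by blast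

lemma function_subspace_dual_space:
  assumes "function_subspace V"
  shows "function_subspace (dual_space V N)"
  unfolding function_subspace_def
proof (intro conjI ballI allI)
  show "(\<lambda>x. 0) \<in> dual_space V N" unfolding dual_space_def by (auto intro: exI[of _ 0])
  fix \<phi> \<psi> assume \<phi>: "\<phi> \<in> dual_space V N"
  then obtain K where K: "\<And>u. u \<in> V \<Longrightarrow> \<bar>\<phi> u\<bar> \<le> K * N u" unfolding dual_space_def by blast
  show "(\<lambda>x. c * \<phi> x) \<in> dual_space V N" for c
  proof -
    have "\<bar>c * \<phi> u\<bar> \<le> (\<bar>c\<bar> * K) * N u" if "u \<in> V" for u
      using mult_left_mono[OF K[OF that], of "\<bar>c\<bar>"] by (simp add: abs_mult mult.assoc)
    then have "\<exists>K. \<forall>u\<in>V. \<bar>c * \<phi> u\<bar> \<le> K * N u" by blast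
    then show ?thesis using \<phi> unfolding dual_space_def by (simp add: algebra_simps)
  qed
  assume \<psi>: "\<psi> \<in> dual_space V N"
  then obtain K' where K': "\<And>u. u \<in> V \<Longrightarrow> \<bar>\<psi> u\<bar> \<le> K' * N u" unfolding dual_space_def by blast
  have "\<bar>\<phi> u + \<psi> u\<bar> \<le> (K + K') * N u" if "u \<in> V" for u
    using K[OF that] K'[OF that] by (simp add: algebra_simps)
  then have "\<exists>K. \<forall>u\<in>V. \<bar>\<phi> u + \<psi> u\<bar> \<le> K * N u" by blast
  then show "(\<lambda>x. \<phi> x + \<psi> x) \<in> dual_space V N"
    using \<phi> \<psi> unfolding dual_space_def by (simp add: algebra_simps)
qed

text \<open>\<open>dual_norm\<close> is a real supremum, so boundedness comes first. If
  \<open>N u = 0\<close>, then \<open>u\<close> cannot be normalized, but the bound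
  \<open>K * N u\<close> forces \<open>\<phi> u = 0\<close>.\<close>

lemma dual_norm_bound:
  assumes V: "function_subspace V" and N: "seminorm_on V N"
    and \<phi>: "\<phi> \<in> dual_space V N" and u: "u \<in> V"
  shows "\<bar>\<phi> u\<bar> \<le> dual_norm V N \<phi> * N u" and "0 \<le> dual_norm V N \<phi>"
proof -
  obtain K where K: "\<And>u. u \<in> V \<Longrightarrow> \<bar>\<phi> u\<bar> \<le> K * N u" using \<phi> unfolding dual_space_def by blast
  have hom: "\<phi> (\<lambda>x. c * u x) = c * \<phi> u" if "u \<in> V" for c u
    using \<phi> that unfolding dual_space_def by auto
  have "\<bar>\<phi> u\<bar> \<le> \<bar>K\<bar>" if "u \<in> V" "N u \<le> 1" for u
  proof -
    have "K * N u \<le> \<bar>K\<bar> * N u" using seminorm_on_nonneg[OF N that(1)] by (intro mult_right_mono) auto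
    also have "\<dots> \<le> \<bar>K\<bar>" using mult_left_mono[OF that(2), of "\<bar>K\<bar>"] by simp
    finally show ?thesis using K[OF that(1)] by simp
  qed
  then have bdd: "bdd_above ((\<lambda>u. \<bar>\<phi> u\<bar>) ` {u \<in> V. N u \<le> 1})" by (auto intro!: bdd_aboveI2)
  have le: "\<bar>\<phi> u\<bar> \<le> dual_norm V N \<phi>" if "u \<in> V" "N u \<le> 1" for u
    unfolding dual_norm_def using that by (intro cSUP_upper bdd) auto
  show "0 \<le> dual_norm V N \<phi>"
    using le[OF function_subspace_zero[OF V]] seminorm_on_zero[OF N V] by force
  show "\<bar>\<phi> u\<bar> \<le> dual_norm V N \<phi> * N u"
  proof (cases "N u = 0")
    case True
    then show ?thesis using K[OF u] by simp
  next
    case False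
    then have pos: "N u > 0" using seminorm_on_nonneg[OF N u] by simp
    have "\<bar>\<phi> (\<lambda>x. (1 / N u) * u x)\<bar> \<le> dual_norm V N \<phi>"
      using pos seminorm_on_scale[OF N u, of "1 / N u"]
      by (intro le function_subspace_scale[OF V u]) simp
    then have "\<bar>(1 / N u) * \<phi> u\<bar> \<le> dual_norm V N \<phi>" unfolding hom[OF u] .
    then show ?thesis using pos by (simp add: abs_mult field_simps)
  qed
qed

text \<open>The functional separating \<open>u\<close> from \<open>K\<close> is dominated by
  \<open>v \<mapsto> inf {N (v + t (k - u)) - t \<delta> | t \<ge> 0, k \<in> K}\<close>.\<close>

lemma convex_separation:
  assumes V: "function_subspace V" and N: "seminorm_on V N"
    and K: "K \<subseteq> V" "convex_functions K" "K \<noteq> {}" and u: "u \<in> V"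
    and \<delta>: "\<And>g. g \<in> K \<Longrightarrow> \<delta> \<le> N (\<lambda>x. g x - u x)"
  obtains \<phi> where "\<phi> \<in> dual_space V N" "\<And>g. g \<in> K \<Longrightarrow> \<phi> u + \<delta> \<le> \<phi> g"
proof -
  define I where "I = {0::real..} \<times> K"
  define h where "h = (\<lambda>v (t, g). N (\<lambda>x. v x + t * (g x - u x)) - t * \<delta>)"
  define q where "q = (\<lambda>v. INF i\<in>I. h v i)"
  have q_eq: "q v = (INF i\<in>I. h v i)" for v by (simp add: q_def)
  have ne: "I \<noteq> {}" using K(3) unfolding I_def by auto
  have gu: "(\<lambda>x. g x - u x) \<in> V" if "g \<in> K" for g
    using function_subspace_diff[OF V _ u] K(1) that by blast
  have tgu: "(\<lambda>x. t * (g x - u x)) \<in> V" if "g \<in> K" for g t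
    using function_subspace_scale[OF V gu[OF that]] .
  have lb: "- N v \<le> h v i" if v: "v \<in> V" and iI: "i \<in> I" for v i
  proof -
    obtain t g where i: "i = (t, g)" "t \<ge> 0" "g \<in> K" using iI unfolding I_def by auto
    have "N (\<lambda>x. (v x + t * (g x - u x)) - v x) \<le> N (\<lambda>x. v x + t * (g x - u x)) + N v"
      using i by (intro seminorm_on_diff[OF N V] function_subspace_add[OF V v] tgu v)
    moreover have "N (\<lambda>x. t * (g x - u x)) = t * N (\<lambda>x. g x - u x)"
      using seminorm_on_scale[OF N gu[OF i(3)], of t] i(2) by simp
    moreover have "t * \<delta> \<le> t * N (\<lambda>x. g x - u x)" using \<delta>[OF i(3)] i(2) by (intro mult_left_mono)
    ultimately show ?thesis unfolding i h_def by simp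
  qed
  have bdd: "bdd_below (h v ` I)" if "v \<in> V" for v
    using lb[OF that] by (intro bdd_belowI2) auto
  have le: "q v \<le> h v i" if "v \<in> V" "i \<in> I" for v i
    unfolding q_def using that by (intro cINF_lower bdd)
  have scale: "q (\<lambda>x. c * v x) \<le> c * q v" if c: "c > 0" and v: "v \<in> V" for c v
  proof -
    have "q (\<lambda>x. c * v x) / c \<le> h v i" if iI: "i \<in> I" for i
    proof -
      obtain t g where i: "i = (t, g)" "t \<ge> 0" "g \<in> K" using iI unfolding I_def by auto
      have "q (\<lambda>x. c * v x) \<le> h (\<lambda>x. c * v x) (c * t, g)"
        using i c by (intro le function_subspace_scale[OF V v]) (auto simp: I_def)
      also have "(\<lambda>x. c * v x + (c * t) * (g x - u x)) = (\<lambda>x. c * (v x + t * (g x - u x)))"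
        by (simp add: algebra_simps)
      then have "h (\<lambda>x. c * v x) (c * t, g) = c * h v i"
        using seminorm_on_scale[OF N function_subspace_add[OF V v tgu[OF i(3)]], of c t] c
        unfolding h_def i by (simp add: algebra_simps)
      finally show ?thesis using c by (simp add: field_simps)
    qed
    then have "q (\<lambda>x. c * v x) / c \<le> q v" unfolding q_eq[of v] by (intro cINF_greatest ne)
    then show ?thesis using c by (simp add: field_simps)
  qed
  have "sublinear_on V q"
    unfolding sublinear_on_def
  proof (intro conjI ballI allI impI)
    fix v w assume vw: "v \<in> V" "w \<in> V"
    have "q (\<lambda>x. v x + w x) \<le> h v i + h w j" if ij: "i \<in> I" "j \<in> I" for i j
    proof -
      obtain s f where i: "i = (s, f)" "s \<ge> 0" "f \<in> K" using ij unfolding I_def by auto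
      obtain t g where j: "j = (t, g)" "t \<ge> 0" "g \<in> K" using ij unfolding I_def by auto
      \<comment> \<open>Two shifts in the directions \<open>f - u\<close> and \<open>g - u\<close>
        merge into one of length \<open>s + t\<close> towards the weighted mean of \<open>f\<close>
        and \<open>g\<close>, which lies in \<open>K\<close> by convexity. If
        \<open>s + t = 0\<close>, both shifts vanish and any element of \<open>K\<close> will
        do.\<close>
      define k where "k = (if s + t = 0 then f else (\<lambda>x. s / (s + t) * f x + t / (s + t) * g x))"
      have k: "k \<in> K"
      proof (cases "s + t = 0")
        case False
        have "(\<lambda>x. s / (s + t) * f x + t / (s + t) * g x) \<in> K"
          using i j False by (intro convex_functionsD[OF K(2)]) (simp_all add: add_divide_distrib[symmetric])
        then show ?thesis using False unfolding k_def by simp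
      qed (use i in \<open>simp add: k_def\<close>)
      have eq: "(s + t) * (k x - u x) = s * (f x - u x) + t * (g x - u x)" for x
      proof (cases "s + t = 0")
        case True
        then have "s = 0" "t = 0" using i j by auto
        then show ?thesis by simp
      next
        case False
        then have "(s + t) * k x = s * f x + t * g x"
          unfolding k_def by (simp add: distrib_left)
        then show ?thesis by (simp add: algebra_simps)
      qed
      have "q (\<lambda>x. v x + w x) \<le> h (\<lambda>x. v x + w x) (s + t, k)"
        using i j k by (intro le function_subspace_add[OF V vw]) (auto simp: I_def)
      also have "\<dots> = N (\<lambda>x. (v x + s * (f x - u x)) + (w x + t * (g x - u x))) - (s + t) * \<delta>"
        unfolding h_def prod.case eq by (simp add: ac_simps)
      also have "\<dots> \<le> N (\<lambda>x. v x + s * (f x - u x)) + N (\<lambda>x. w x + t * (g x - u x)) - (s + t) * \<delta>"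
        using i j by (intro diff_right_mono seminorm_on_add[OF N] function_subspace_add[OF V] vw tgu)
      finally show ?thesis unfolding i j h_def by (simp add: algebra_simps)
    qed
    then have "q (\<lambda>x. v x + w x) - h v i \<le> h w j" if "i \<in> I" "j \<in> I" for i j
      using that by (simp add: diff_le_eq add.commute)
    then have "q (\<lambda>x. v x + w x) - h v i \<le> q w" if "i \<in> I" for i
      unfolding q_eq[of w] using that by (intro cINF_greatest ne)
    then have "q (\<lambda>x. v x + w x) - q w \<le> h v i" if "i \<in> I" for i
      using that by (simp add: diff_le_eq add.commute)
    then have "q (\<lambda>x. v x + w x) - q w \<le> q v"
      unfolding q_eq[of v] by (intro cINF_greatest ne)
    then show "q (\<lambda>x. v x + w x) \<le> q v + q w" by simp
  next
    fix c :: real and v assume c: "0 \<le> c" and v: "v \<in> V"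
    show "q (\<lambda>x. c * v x) = c * q v"
    proof (cases "c = 0")
      case True
      obtain k where k: "k \<in> K" using K(3) by blast
      have "q (\<lambda>x. 0) \<le> h (\<lambda>x. 0) (0, k)"
        using k by (intro le function_subspace_zero[OF V]) (auto simp: I_def)
      also have "\<dots> = 0" unfolding h_def using seminorm_on_zero[OF N V] by simp
      finally have "q (\<lambda>x. 0) \<le> 0" .
      moreover have "0 \<le> q (\<lambda>x. 0)"
        unfolding q_def using lb[OF function_subspace_zero[OF V]] seminorm_on_zero[OF N V]
        by (intro cINF_greatest ne) auto
      ultimately show ?thesis using True by simp
    next
      case False
      then have c: "c > 0" using c by simp
      have "q (\<lambda>x. (1/c) * (c * v x)) \<le> (1/c) * q (\<lambda>x. c * v x)"
        using c by (intro scale function_subspace_scale[OF V v]) simp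
      then have "q v \<le> q (\<lambda>x. c * v x) / c" using c by simp
      then have "c * q v \<le> q (\<lambda>x. c * v x)" using c by (simp add: field_simps)
      with scale[OF c v] show ?thesis by simp
    qed
  qed
  from hahn_banach[OF V this] obtain L where L0: "\<And>u. u \<notin> V \<Longrightarrow> L u = 0"
    and add: "\<And>u v. u \<in> V \<Longrightarrow> v \<in> V \<Longrightarrow> L (\<lambda>x. u x + v x) = L u + L v"
    and hom: "\<And>c u. u \<in> V \<Longrightarrow> L (\<lambda>x. c * u x) = c * L u"
    and Lq: "\<And>u. u \<in> V \<Longrightarrow> L u \<le> q u" by blast
  obtain k0 where k0: "k0 \<in> K" using K(3) by blast
  \<comment> \<open>The parameter \<open>t = 0\<close> in the infimum makes \<open>L\<close> bounded
    by \<open>N\<close>.\<close>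
  have LN: "L v \<le> N v" if "v \<in> V" for v
  proof -
    have "q v \<le> h v (0, k0)" using k0 that by (intro le) (auto simp: I_def)
    then show ?thesis using Lq[OF that] unfolding h_def by simp
  qed
  have "\<bar>L v\<bar> \<le> 1 * N v" if v: "v \<in> V" for v
    using LN[OF v] LN[OF function_subspace_scale[OF V v, of "-1"]] hom[OF v, of "-1"]
      seminorm_on_minus[OF N v] by simp
  then have "L \<in> dual_space V N" unfolding dual_space_def using L0 add hom by blast
  \<comment> \<open>The parameter \<open>t = 1\<close> with the direction \<open>g\<close> itself
    cancels the argument \<open>u - g\<close>, so that only \<open>- \<delta>\<close> is
    left.\<close>
  moreover have "L u + \<delta> \<le> L g" if g: "g \<in> K" for g
  proof -
    have ug: "(\<lambda>x. u x + (-1) * g x) \<in> V"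
      using function_subspace_add[OF V u function_subspace_scale[OF V, of g "-1"]] g K(1) by blast
    have "L (\<lambda>x. u x + (-1) * g x) \<le> h (\<lambda>x. u x + (-1) * g x) (1, g)"
      using Lq[OF ug] le[OF ug, of "(1, g)"] g by (auto simp: I_def)
    also have "\<dots> = - \<delta>" unfolding h_def using seminorm_on_zero[OF N V] by simp
    also have "L (\<lambda>x. u x + (-1) * g x) = L u - L g"
      using add[OF u function_subspace_scale[OF V, of g "-1"]] hom[of g "-1"] g K(1) by auto
    finally show ?thesis by simp
  qed
  ultimately show ?thesis by (rule that)
qed

text \<open>The limit superior of \<open>\<phi> (f k)\<close> as a functional of
  \<open>\<phi>\<close>, written with real suprema and infima; the assumed bounds keep these
  meaningful. It dominates the functional on the dual that acts as a weak limit of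
  \<open>f\<close>.\<close>

lemma sublinear_on_limsup:
  assumes N: "\<And>\<phi>. \<phi> \<in> W \<Longrightarrow> \<exists>B. \<forall>k::nat. \<bar>\<phi> (f k)\<bar> \<le> B"
  shows "sublinear_on W (\<lambda>\<phi>. INF n. SUP k\<in>{n..}. \<phi> (f k))"
    and "\<phi> \<in> W \<Longrightarrow> eventually (\<lambda>k. \<phi> (f k) \<le> B) sequentially \<Longrightarrow> (INF n. SUP k\<in>{n..}. \<phi> (f k)) \<le> B"
    and "\<phi> \<in> W \<Longrightarrow> \<forall>k. \<bar>\<phi> (f k)\<bar> \<le> B \<Longrightarrow> \<bar>INF n. SUP k\<in>{n..}. \<phi> (f k)\<bar> \<le> B"
proof -
  have up: "bdd_above ((\<lambda>k. \<phi> (f k)) ` {n..})" if \<phi>: "\<phi> \<in> W" for \<phi> n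
  proof -
    obtain B where "\<forall>k. \<bar>\<phi> (f k)\<bar> \<le> B" using N[OF \<phi>] by blast
    then have "\<phi> (f k) \<le> B" for k using abs_le_D1 by blast
    then show ?thesis by (intro bdd_aboveI2)
  qed
  have S: "\<phi> (f k) \<le> (SUP k\<in>{n..}. \<phi> (f k))" if "\<phi> \<in> W" "n \<le> k" for \<phi> n k
    using up[OF that(1)] that(2) by (intro cSUP_upper) auto
  have dn: "bdd_below (range (\<lambda>n. SUP k\<in>{n..}. \<phi> (f k)))" if \<phi>: "\<phi> \<in> W" for \<phi>
  proof -
    obtain B where B: "\<forall>k. \<bar>\<phi> (f k)\<bar> \<le> B" using N[OF \<phi>] by blast
    have "- B \<le> (SUP k\<in>{n..}. \<phi> (f k))" for n
      using S[OF \<phi> order_refl, of n] B[rule_format, of n] by linarith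
    then show ?thesis by (intro bdd_belowI2)
  qed
  have le: "(INF n. SUP k\<in>{n..}. \<phi> (f k)) \<le> (SUP k\<in>{n..}. \<phi> (f k))" if "\<phi> \<in> W" for \<phi> n
    by (intro cINF_lower dn that) simp
  show ev: "(INF n. SUP k\<in>{n..}. \<phi> (f k)) \<le> B"
    if \<phi>: "\<phi> \<in> W" and evt: "eventually (\<lambda>k. \<phi> (f k) \<le> B) sequentially" for \<phi> B
  proof -
    obtain n where "\<And>k. k \<ge> n \<Longrightarrow> \<phi> (f k) \<le> B" using evt unfolding eventually_sequentially by blast
    then have "(SUP k\<in>{n..}. \<phi> (f k)) \<le> B" by (intro cSUP_least) auto
    then show ?thesis using le[OF \<phi>, of n] by simp
  qed
  show "\<bar>INF n. SUP k\<in>{n..}. \<phi> (f k)\<bar> \<le> B" if \<phi>: "\<phi> \<in> W" and B: "\<forall>k. \<bar>\<phi> (f k)\<bar> \<le> B" for \<phi> B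
  proof -
    have "- B \<le> (SUP k\<in>{n..}. \<phi> (f k))" for n
      using S[OF \<phi> order_refl, of n] B[rule_format, of n] by linarith
    then have "- B \<le> (INF n. SUP k\<in>{n..}. \<phi> (f k))" by (intro cINF_greatest) auto
    moreover have "\<phi> (f k) \<le> B" for k using B abs_le_D1 by blast
    then have "(INF n. SUP k\<in>{n..}. \<phi> (f k)) \<le> B" by (intro ev \<phi>) auto
    ultimately show ?thesis by (simp add: abs_le_iff)
  qed
  show "sublinear_on W (\<lambda>\<phi>. INF n. SUP k\<in>{n..}. \<phi> (f k))"
    unfolding sublinear_on_def
  proof (intro conjI ballI allI impI)
    fix \<phi> \<psi> assume W: "\<phi> \<in> W" "\<psi> \<in> W"
    let ?L = "\<lambda>\<phi>. INF n. SUP k\<in>{n..}. \<phi> (f k)"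
    have evt: "eventually (\<lambda>k. \<phi> (f k) \<le> ?L \<phi> + e) sequentially" if "e > 0" "\<phi> \<in> W" for e \<phi>
    proof -
      have "\<exists>n. (SUP k\<in>{n..}. \<phi> (f k)) < ?L \<phi> + e"
        using cINF_less_iff[OF _ dn[OF that(2)], of "?L \<phi> + e"] that(1) by auto
      then obtain n where "(SUP k\<in>{n..}. \<phi> (f k)) < ?L \<phi> + e" by blast
      then have "\<phi> (f k) \<le> ?L \<phi> + e" if "k \<ge> n" for k using S[OF \<open>\<phi> \<in> W\<close> that] by linarith
      then show ?thesis unfolding eventually_sequentially by blast
    qed
    obtain B where B: "\<forall>k. \<bar>\<phi> (f k)\<bar> \<le> B" using N[OF W(1)] by blast
    obtain B' where B': "\<forall>k. \<bar>\<psi> (f k)\<bar> \<le> B'" using N[OF W(2)] by blast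
    have lb: "- (B + B') \<le> (SUP k\<in>{n..}. \<phi> (f k) + \<psi> (f k))" for n
    proof -
      have "bdd_above ((\<lambda>k. \<phi> (f k) + \<psi> (f k)) ` {n..})"
      proof (rule bdd_aboveI2)
        fix k show "\<phi> (f k) + \<psi> (f k) \<le> B + B'"
          using B[rule_format, of k] B'[rule_format, of k] by linarith
      qed
      then have "\<phi> (f n) + \<psi> (f n) \<le> (SUP k\<in>{n..}. \<phi> (f k) + \<psi> (f k))"
        by (intro cSUP_upper) auto
      then show ?thesis using B[rule_format, of n] B'[rule_format, of n] by linarith
    qed
    show "?L (\<lambda>x. \<phi> x + \<psi> x) \<le> ?L \<phi> + ?L \<psi>"
    proof (rule field_le_epsilon)
      fix e :: real assume "e > 0"
      then have "eventually (\<lambda>k. \<phi> (f k) + \<psi> (f k) \<le> ?L \<phi> + ?L \<psi> + e) sequentially"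
        using eventually_conj[OF evt[of "e/2", OF _ W(1)] evt[of "e/2", OF _ W(2)]]
        by (auto elim!: eventually_mono simp: field_simps)
      then obtain n where n: "\<And>k. k \<ge> n \<Longrightarrow> \<phi> (f k) + \<psi> (f k) \<le> ?L \<phi> + ?L \<psi> + e"
        unfolding eventually_sequentially by blast
      have "?L (\<lambda>x. \<phi> x + \<psi> x) \<le> (SUP k\<in>{n..}. \<phi> (f k) + \<psi> (f k))"
        using lb by (intro cINF_lower bdd_belowI2) auto
      also have "\<dots> \<le> ?L \<phi> + ?L \<psi> + e" using n by (intro cSUP_least) auto
      finally show "?L (\<lambda>x. \<phi> x + \<psi> x) \<le> ?L \<phi> + ?L \<psi> + e" .
    qed
  next
    fix c :: real and \<phi> assume c: "c \<ge> 0" and \<phi>: "\<phi> \<in> W"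
    have "(SUP k\<in>{n..}. c * \<phi> (f k)) = c * (SUP k\<in>{n..}. \<phi> (f k))" for n
      by (rule cSUP_mult_left[OF c _ up[OF \<phi>]]) simp
    then have "(INF n. SUP k\<in>{n..}. c * \<phi> (f k)) = (INF n. c * (SUP k\<in>{n..}. \<phi> (f k)))" by simp
    also have "\<dots> = c * (INF n. SUP k\<in>{n..}. \<phi> (f k))"
      by (rule cINF_mult_left[OF c _ dn[OF \<phi>]]) simp
    finally show "(INF n. SUP k\<in>{n..}. c * \<phi> (f k)) = c * (INF n. SUP k\<in>{n..}. \<phi> (f k))" .
  qed
qed

text \<open>A weak cluster point of \<open>f\<close>: extending the sublinear functional \<open>\<phi> \<mapsto> limsup \<phi> (f k)\<close> on the
  dual gives an element of the bidual, hence by reflexivity a point of \<open>V\<close>.\<close>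

theorem reflexive_mazur:
  assumes V: "function_subspace V" and N: "seminorm_on V N" and refl: "reflexive_seminormed V N"
    and f: "\<And>k. f k \<in> V" "\<And>k. N (f k) \<le> M"
  obtains u where "u \<in> V"
    "\<And>K e. K \<subseteq> V \<Longrightarrow> convex_functions K \<Longrightarrow> eventually (\<lambda>k. f k \<in> K) sequentially \<Longrightarrow> e > 0 \<Longrightarrow>
       \<exists>g\<in>K. N (\<lambda>x. g x - u x) < e"
proof -
  define W where "W = dual_space V N"
  have W: "function_subspace W" unfolding W_def by (rule function_subspace_dual_space[OF V])
  have bd: "\<bar>\<phi> (f k)\<bar> \<le> M * dual_norm V N \<phi>" if "\<phi> \<in> W" for \<phi> k
  proof -
    note * = dual_norm_bound[OF V N that[unfolded W_def] f(1)[of k]]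
    show ?thesis using *(1) mult_left_mono[OF f(2)[of k] *(2)] by (simp add: mult.commute)
  qed
  let ?q = "\<lambda>\<phi>. INF n. SUP k\<in>{n..}. \<phi> (f k)"
  have ex: "\<exists>B. \<forall>k. \<bar>\<phi> (f k)\<bar> \<le> B" if "\<phi> \<in> W" for \<phi> using bd[OF that] by blast
  note lim = sublinear_on_limsup[of W f, OF ex]
  from hahn_banach[OF W lim(1)] obtain L where L0: "\<And>\<phi>. \<phi> \<notin> W \<Longrightarrow> L \<phi> = 0"
    and add: "\<And>\<phi> \<psi>. \<phi> \<in> W \<Longrightarrow> \<psi> \<in> W \<Longrightarrow> L (\<lambda>x. \<phi> x + \<psi> x) = L \<phi> + L \<psi>"
    and hom: "\<And>c \<phi>. \<phi> \<in> W \<Longrightarrow> L (\<lambda>x. c * \<phi> x) = c * L \<phi>"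
    and Lq: "\<And>\<phi>. \<phi> \<in> W \<Longrightarrow> L \<phi> \<le> ?q \<phi>" by blast
  have le: "L \<phi> \<le> B" if "\<phi> \<in> W" "eventually (\<lambda>k. \<phi> (f k) \<le> B) sequentially" for \<phi> B
    using Lq[OF that(1)] lim(2)[OF _ that] by simp
  have "\<bar>L \<phi>\<bar> \<le> M * dual_norm V N \<phi>" if \<phi>: "\<phi> \<in> W" for \<phi>
  proof -
    have "\<phi> (f k) \<le> M * dual_norm V N \<phi>" "- \<phi> (f k) \<le> M * dual_norm V N \<phi>" for k
      using bd[OF \<phi>, of k] by linarith+
    then have "L \<phi> \<le> M * dual_norm V N \<phi>" "L (\<lambda>x. (-1) * \<phi> x) \<le> M * dual_norm V N \<phi>"
      by (auto intro!: le \<phi> function_subspace_scale[OF W, of _ "-1", simplified])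
    then show ?thesis using hom[OF \<phi>, of "-1"] by (simp add: abs_le_iff)
  qed
  then have "L \<in> dual_space W (dual_norm V N)"
    unfolding dual_space_def using L0 add hom by blast
  \<comment> \<open>\<open>u\<close> represents \<open>L\<close> on the whole dual, so this one
    point serves every convex set \<open>K\<close>.\<close>
  then obtain u where u: "u \<in> V" "\<And>\<phi>. \<phi> \<in> W \<Longrightarrow> L \<phi> = \<phi> u"
    using refl unfolding reflexive_seminormed_def W_def by blast
  show ?thesis
  proof (rule that[OF u(1)])
    fix K :: "('a \<Rightarrow> real) set" and e :: real
    assume K: "K \<subseteq> V" "convex_functions K" and ev: "eventually (\<lambda>k. f k \<in> K) sequentially" and "e > 0"
    show "\<exists>g\<in>K. N (\<lambda>x. g x - u x) < e"
    proof (rule ccontr)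
      assume "\<not> ?thesis"
      then have ge: "\<And>g. g \<in> K \<Longrightarrow> e \<le> N (\<lambda>x. g x - u x)" by force
      have "K \<noteq> {}" using ev unfolding eventually_sequentially by blast
      \<comment> \<open>A separating functional satisfies
        \<open>\<phi> (f k) \<ge> \<phi> u + e\<close> eventually, hence
        \<open>L \<phi> \<ge> \<phi> u + e\<close>, although
        \<open>L \<phi> = \<phi> u\<close>.\<close>
      from convex_separation[OF V N K this u(1) ge] obtain \<phi>
        where \<phi>: "\<phi> \<in> W" "\<And>g. g \<in> K \<Longrightarrow> \<phi> u + e \<le> \<phi> g" unfolding W_def by blast
      have "eventually (\<lambda>k. (-1) * \<phi> (f k) \<le> - (\<phi> u + e)) sequentially"
        using ev by eventually_elim (use \<phi>(2) in force)
      then have "L (\<lambda>x. (-1) * \<phi> x) \<le> - (\<phi> u + e)"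
        by (intro le function_subspace_scale[OF W \<phi>(1)])
      then show False using hom[OF \<phi>(1), of "-1"] u(2)[OF \<phi>(1)] \<open>e > 0\<close> by simp
    qed
  qed
qed

section \<open>Powers and the Minkowski inequality\<close>

text \<open>The crude constant comes from bounding the sum by twice the larger term; constants are
  not tracked sharply anywhere.\<close>

lemma abs_powr_add_le:
  fixes a b p :: real
  assumes "0 \<le> p"
  shows "\<bar>a + b\<bar> powr p \<le> 2 powr p * (\<bar>a\<bar> powr p + \<bar>b\<bar> powr p)"
proof -
  have "\<bar>a + b\<bar> powr p \<le> (2 * max \<bar>a\<bar> \<bar>b\<bar>) powr p"
    using assms by (intro powr_mono2) auto
  also have "\<dots> = 2 powr p * max \<bar>a\<bar> \<bar>b\<bar> powr p" by (simp add: powr_mult)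
  also have "max \<bar>a\<bar> \<bar>b\<bar> powr p \<le> \<bar>a\<bar> powr p + \<bar>b\<bar> powr p" by (auto simp: max_def)
  finally show ?thesis by simp
qed

lemma abs_powr_diff_le:
  fixes a b c p :: real
  assumes "0 \<le> p"
  shows "\<bar>a - b\<bar> powr p \<le> 2 powr p * (\<bar>a - c\<bar> powr p + \<bar>b - c\<bar> powr p)"
  using abs_powr_add_le[OF assms, of "a - c" "c - b"] by (simp add: abs_minus_commute)

lemma sum_powr_le:
  fixes a :: "'i \<Rightarrow> real"
  assumes "0 \<le> p" "\<And>i. i \<in> I \<Longrightarrow> 0 \<le> a i"
  shows "(\<Sum>i\<in>I. a i) powr p \<le> real (card I) powr p * (\<Sum>i\<in>I. a i powr p)"
proof (cases "finite I \<and> I \<noteq> {}")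
  case True
  define M where "M = Max (a ` I)"
  obtain j where j: "j \<in> I" "M = a j"
    using True Max_in[of "a ` I"] unfolding M_def by blast
  have "(\<Sum>i\<in>I. a i) \<le> (\<Sum>i\<in>I. M)"
    using True unfolding M_def by (intro sum_mono Max_ge) auto
  then have "(\<Sum>i\<in>I. a i) powr p \<le> (real (card I) * M) powr p"
    using assms by (intro powr_mono2 sum_nonneg) auto
  also have "\<dots> = real (card I) powr p * a j powr p"
    using j assms(2) by (simp add: powr_mult)
  also have "\<dots> \<le> real (card I) powr p * (\<Sum>i\<in>I. a i powr p)"
    using True j by (intro mult_left_mono member_le_sum) auto
  finally show ?thesis .
qed auto

text \<open>Convexity of \<open>powr\<close> is applied at positive arguments; a vanishing argument
  is handled by \<open>s powr p \<le> s\<close> for \<open>0 \<le> s \<le> 1\<close>.\<close>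

lemma powr_convex_combination:
  fixes p s t a b :: real
  assumes "1 \<le> p" "0 \<le> s" "0 \<le> t" "s + t = 1" "0 \<le> a" "0 \<le> b"
  shows "(s * a + t * b) powr p \<le> s * a powr p + t * b powr p"
proof -
  have le: "s powr p \<le> s" if "0 \<le> s" "s \<le> 1" for s :: real
    using powr_mono'[OF assms(1), of s] that by simp
  have *: "(s * a) powr p \<le> s * a powr p" if "0 \<le> s" "s \<le> 1" "0 \<le> a" for s a :: real
    using that le[of s] by (simp add: powr_mult mult_right_mono)
  consider "a = 0" | "b = 0" | "a > 0" "b > 0" using assms by linarith
  then show ?thesis
  proof cases
    case 3
    then show ?thesis
      using convex_onD[OF powr_convex[OF assms(1)], of t a b] assms by (simp add: eq_diff_eq[symmetric])
  qed (use *[of t b] *[of s a] assms in auto)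
qed

text \<open>Minkowski's inequality from convexity: with the weights \<open>s = a / (a + b)\<close>
  and \<open>t = b / (a + b)\<close>, the sum \<open>|u| + |v|\<close> is \<open>a + b\<close> times
  a convex combination of the normalized functions \<open>|u| / a\<close> and
  \<open>|v| / b\<close>. A vanishing norm is treated separately, since it cannot be
  normalized.\<close>

lemma seminorm_on_Lp_norm:
  assumes p: "1 < p" and V: "V \<subseteq> Lp_functions M p" "function_subspace V"
  shows "seminorm_on V (Lp_norm M p)"
  unfolding seminorm_on_def
proof (intro conjI ballI allI)
  fix u assume u: "u \<in> V"
  show "0 \<le> Lp_norm M p u" unfolding Lp_norm_def by simp
  show "Lp_norm M p (\<lambda>x. c * u x) = \<bar>c\<bar> * Lp_norm M p u" for c
    using p unfolding Lp_norm_def by (simp add: abs_mult powr_mult powr_powr)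
  fix v assume v: "v \<in> V"
  define a where "a = Lp_norm M p u"
  define b where "b = Lp_norm M p v"
  have [measurable]: "u \<in> borel_measurable M" "v \<in> borel_measurable M"
    and int: "integrable M (\<lambda>x. \<bar>u x\<bar> powr p)" "integrable M (\<lambda>x. \<bar>v x\<bar> powr p)"
      "integrable M (\<lambda>x. \<bar>u x + v x\<bar> powr p)"
    using u v V(1) function_subspace_add[OF V(2) u v] unfolding Lp_functions_def by auto
  have ap: "(\<integral>x. \<bar>u x\<bar> powr p \<partial>M) = a powr p" "(\<integral>x. \<bar>v x\<bar> powr p \<partial>M) = b powr p"
    using p unfolding a_def b_def Lp_norm_def by (simp_all add: powr_powr)
  have ab: "a \<ge> 0" "b \<ge> 0" unfolding a_def b_def Lp_norm_def by simp_all
  have zero: "AE x in M. w x = 0" if "integrable M (\<lambda>x. \<bar>w x\<bar> powr p)" "(\<integral>x. \<bar>w x\<bar> powr p \<partial>M) = 0" for w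
    using that integral_nonneg_eq_0_iff_AE[of M "\<lambda>x. \<bar>w x\<bar> powr p"] by auto
  have "(\<integral>x. \<bar>u x + v x\<bar> powr p \<partial>M) \<le> (a + b) powr p"
  proof -
    consider "a = 0" | "b = 0" | "a > 0" "b > 0" using ab by linarith
    then show ?thesis
    proof cases
      case 1
      then have "AE x in M. \<bar>u x + v x\<bar> powr p = \<bar>v x\<bar> powr p" using zero[OF int(1)] ap p by auto
      then have "(\<integral>x. \<bar>u x + v x\<bar> powr p \<partial>M) = (\<integral>x. \<bar>v x\<bar> powr p \<partial>M)"
        by (intro integral_cong_AE) auto
      then show ?thesis using ap 1 by simp
    next
      case 2
      then have "AE x in M. \<bar>u x + v x\<bar> powr p = \<bar>u x\<bar> powr p" using zero[OF int(2)] ap p by auto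
      then have "(\<integral>x. \<bar>u x + v x\<bar> powr p \<partial>M) = (\<integral>x. \<bar>u x\<bar> powr p \<partial>M)"
        by (intro integral_cong_AE) auto
      then show ?thesis using ap 2 by simp
    next
      case 3
      define s where "s = a / (a + b)"
      define t where "t = b / (a + b)"
      have st: "0 \<le> s" "0 \<le> t" "s + t = 1"
        using 3 unfolding s_def t_def by (simp_all add: add_divide_distrib[symmetric])
      have pw: "\<bar>u x + v x\<bar> powr p \<le> (a + b) powr p * (s * (\<bar>u x\<bar> powr p / a powr p) + t * (\<bar>v x\<bar> powr p / b powr p))" for x
      proof -
        have "(a + b) * (s * (\<bar>u x\<bar> / a) + t * (\<bar>v x\<bar> / b)) = \<bar>u x\<bar> + \<bar>v x\<bar>"
          using 3 unfolding s_def t_def by (simp add: distrib_left)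
        then have "\<bar>u x + v x\<bar> powr p \<le> ((a + b) * (s * (\<bar>u x\<bar> / a) + t * (\<bar>v x\<bar> / b))) powr p"
          using p by (intro powr_mono2) auto
        also have "\<dots> = (a + b) powr p * (s * (\<bar>u x\<bar> / a) + t * (\<bar>v x\<bar> / b)) powr p"
          using 3 st by (intro powr_mult)
        also have "\<dots> \<le> (a + b) powr p * (s * (\<bar>u x\<bar> / a) powr p + t * (\<bar>v x\<bar> / b) powr p)"
          using 3 st p by (intro mult_left_mono powr_convex_combination) auto
        finally show ?thesis using 3 by (simp add: powr_divide)
      qed
      have "(\<integral>x. \<bar>u x + v x\<bar> powr p \<partial>M)
          \<le> (\<integral>x. (a + b) powr p * (s * (\<bar>u x\<bar> powr p / a powr p) + t * (\<bar>v x\<bar> powr p / b powr p)) \<partial>M)"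
        using int by (intro integral_mono pw) auto
      also have "\<dots> = (a + b) powr p * (s * ((\<integral>x. \<bar>u x\<bar> powr p \<partial>M) / a powr p) + t * ((\<integral>x. \<bar>v x\<bar> powr p \<partial>M) / b powr p))"
        using int by simp
      also have "\<dots> = (a + b) powr p" using ap 3 st by simp
      finally show ?thesis .
    qed
  qed
  then have "(\<integral>x. \<bar>u x + v x\<bar> powr p \<partial>M) powr (1 / p) \<le> ((a + b) powr p) powr (1 / p)"
    using p by (intro powr_mono2) auto
  also have "\<dots> = a + b" using p ab by (simp add: powr_powr)
  finally show "Lp_norm M p (\<lambda>x. u x + v x) \<le> Lp_norm M p u + Lp_norm M p v"
    unfolding Lp_norm_def[of M p "\<lambda>x. u x + v x"] a_def b_def .
qed

lemma Lp_norm_mono: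
  assumes "0 < p" "u \<in> borel_measurable M" "v \<in> Lp_functions M p" "AE x in M. \<bar>u x\<bar> \<le> \<bar>v x\<bar>"
  shows "Lp_norm M p u \<le> Lp_norm M p v"
proof -
  have int: "integrable M (\<lambda>x. \<bar>v x\<bar> powr p)" using assms(3) unfolding Lp_functions_def by auto
  have le: "AE x in M. \<bar>u x\<bar> powr p \<le> \<bar>v x\<bar> powr p"
    using assms(4) by eventually_elim (use assms(1) in \<open>simp add: powr_mono2\<close>)
  have "integrable M (\<lambda>x. \<bar>u x\<bar> powr p)"
    by (rule Bochner_Integration.integrable_bound[OF int]) (use assms(2) le in auto)
  then show ?thesis
    unfolding Lp_norm_def using int le assms(1) by (intro powr_mono2 integral_mono_AE) auto
qed

section \<open>Doubling spaces\<close>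

locale doubling_space =
  fixes m :: "'a::polish_space measure" and cD :: real
  assumes loc_compact: "locally compact (UNIV :: 'a set)"
    and radon: "radon_measure m"
    and full_supp: "full_support m"
    and cD: "1 \<le> cD"
    and doubling: "\<And>x r. 0 < r \<Longrightarrow> emeasure m (ball x (2 * r)) \<le> ennreal cD * emeasure m (ball x r)"
begin

lemma sets_m [simp, measurable_cong]: "sets m = sets borel"
  using radon unfolding radon_measure_def by simp

lemma space_m [simp]: "space m = UNIV"
  using sets_eq_imp_space_eq[OF sets_m] by simp

lemma borel_measurable_m: "borel_measurable m = borel_measurable borel"
  by (rule measurable_cong_sets) simp_all

text \<open>A compact neighbourhood contains one ball of finite measure about \<open>x\<close>, and
  doubling carries finiteness to all radii.\<close>

lemma emeasure_ball_finite: "emeasure m (ball x r) < \<infinity>"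
proof -
  obtain U K where U: "open U" "x \<in> U" "U \<subseteq> K" "compact K"
    using loc_compact[unfolded locally_def, rule_format, of UNIV x] by (auto simp: openin_open)
  then obtain e where e: "e > 0" "ball x e \<subseteq> U" by (meson openE)
  have "emeasure m (ball x (2 ^ n * e)) < \<infinity>" for n
  proof (induction n)
    case 0
    have "emeasure m (ball x e) \<le> emeasure m K"
      using e U borel_compact[of K] by (intro emeasure_mono) auto
    then show ?case using radon U unfolding radon_measure_def by (auto simp: less_le_trans le_less_trans)
  next
    case (Suc n)
    have "emeasure m (ball x (2 * (2 ^ n * e))) \<le> ennreal cD * emeasure m (ball x (2 ^ n * e))"
      using e by (intro doubling) simp
    also have "\<dots> < \<infinity>" using Suc by (simp add: ennreal_mult_less_top)
    finally show ?case by (simp add: mult.assoc)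
  qed
  moreover obtain n where "r / e < 2 ^ n" using real_arch_pow[of 2 "r / e"] by auto
  then have "ball x r \<subseteq> ball x (2 ^ n * e)" using e by (intro subset_ball) (simp add: field_simps)
  then have "emeasure m (ball x r) \<le> emeasure m (ball x (2 ^ n * e))" by (intro emeasure_mono) auto
  ultimately show ?thesis using le_less_trans by blast
qed

definition V :: "'a \<Rightarrow> real \<Rightarrow> real" where "V x r = measure m (ball x r)"

lemma emeasure_ball: "emeasure m (ball x r) = ennreal (V x r)"
  unfolding V_def using emeasure_ball_finite[of x r] by (intro emeasure_eq_ennreal_measure) auto

lemma V_nonneg [simp]: "0 \<le> V x r"
  unfolding V_def by simp

lemma V_pos: "0 < r \<Longrightarrow> 0 < V x r"
  using full_supp[unfolded full_support_def, rule_format, of "ball x r"] emeasure_ball[of x r]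
  by (auto simp: ball_eq_empty ennreal_eq_0_iff zero_less_iff_neq_zero)

lemma V_mono: "ball x r \<subseteq> ball y s \<Longrightarrow> V x r \<le> V y s"
  unfolding V_def using emeasure_ball_finite[of y s]
  by (intro measure_mono_fmeasurable) (auto simp: fmeasurable_def)

lemma V_double: "0 < r \<Longrightarrow> V x (2 * r) \<le> cD * V x r"
  using doubling[of r x] cD by (simp add: emeasure_ball flip: ennreal_mult)

lemma V_double_pow: "0 < r \<Longrightarrow> V x (2 ^ k * r) \<le> cD ^ k * V x r"
proof (induction k)
  case (Suc k)
  have "V x (2 * (2 ^ k * r)) \<le> cD * V x (2 ^ k * r)" using Suc by (intro V_double) simp
  also have "\<dots> \<le> cD * (cD ^ k * V x r)" using Suc cD by (intro mult_left_mono) auto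
  finally show ?case by (simp add: mult.assoc)
qed simp

text \<open>The general volume comparison: in its applications the distance of the centres and both
  radii are bounded multiples of one scale, and \<open>2 ^ k\<close> is a power of two above the
  ratio.\<close>

lemma V_compare: "0 < r \<Longrightarrow> dist x y + s \<le> 2 ^ k * r \<Longrightarrow> V y s \<le> cD ^ k * V x r"
proof -
  assume "0 < r" and le: "dist x y + s \<le> 2 ^ k * r"
  have "ball y s \<subseteq> ball x (2 ^ k * r)"
  proof
    fix z assume "z \<in> ball y s"
    then show "z \<in> ball x (2 ^ k * r)" using le dist_triangle[of x z y] by simp
  qed
  then show ?thesis using V_mono V_double_pow[OF \<open>0 < r\<close>] by (meson order_trans)
qed

lemma sigma_finite: "sigma_finite_measure m"
proof
  fix x0 :: 'a
  have "(\<Union>n. ball x0 (real n)) = UNIV"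
    by (auto intro: reals_Archimedean2)
  then show "\<exists>A. countable A \<and> A \<subseteq> sets m \<and> \<Union> A = space m \<and> (\<forall>a\<in>A. emeasure m a \<noteq> \<infinity>)"
    using emeasure_ball_finite by (intro exI[of _ "range (\<lambda>n. ball x0 (real n))"]) (auto simp: less_top)
qed

text \<open>The kernel \<open>of_bool (dist x y < r)\<close> is jointly measurable, so parameter
  integrals of it are measurable. The indicator of a ball is rewritten in this way in the
  measurability arguments below, too.\<close>

lemma measurable_V [measurable]: "(\<lambda>x. V x r) \<in> borel_measurable borel"
proof -
  interpret sigma_finite_measure m by (rule sigma_finite)
  have [measurable_cong]: "sets m = sets borel" by simp
  have "(\<lambda>x. \<integral>\<^sup>+y. of_bool (dist x y < r) \<partial>m) \<in> borel_measurable borel"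
    by measurable
  also have "(\<lambda>x. \<integral>\<^sup>+y. of_bool (dist x y < r) \<partial>m) = (\<lambda>x. emeasure m (ball x r))"
  proof
    fix x
    have "(\<integral>\<^sup>+y. of_bool (dist x y < r) \<partial>m) = (\<integral>\<^sup>+y. indicator (ball x r) y \<partial>m)"
      by (intro nn_integral_cong) (auto simp: indicator_def)
    then show "(\<integral>\<^sup>+y. of_bool (dist x y < r) \<partial>m) = emeasure m (ball x r)" by simp
  qed
  finally have "(\<lambda>x. enn2real (emeasure m (ball x r))) \<in> borel_measurable borel" by measurable
  then show ?thesis by (simp add: emeasure_ball)
qed

section \<open>Separated sets, nets and compactness of closed balls\<close>

definition separated :: "real \<Rightarrow> 'a set \<Rightarrow> bool" where
  "separated \<rho> P \<longleftrightarrow> (\<forall>x\<in>P. \<forall>y\<in>P. x \<noteq> y \<longrightarrow> \<rho> \<le> dist x y)"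

text \<open>Volume counting: the balls of radius \<open>\<rho> / 2\<close> about the points are
  disjoint, lie in \<open>ball x (R + \<rho> / 2)\<close>, and each carries at least the fraction
  \<open>1 / cD ^ k\<close> of its volume. The condition on \<open>k\<close> is what
  \<open>V_compare\<close> demands at radius \<open>\<rho> / 2\<close> for centres at distance below
  \<open>R\<close>.\<close>

lemma separated_card:
  assumes P: "separated \<rho> P" "P \<subseteq> ball x R" and "0 < \<rho>" and k: "4 * R + \<rho> \<le> 2 ^ k * \<rho>"
  shows "finite P \<and> card P \<le> cD ^ k"
proof (cases "P = {}")
  case False
  then have "ball x R \<noteq> {}" using P(2) by blast
  then have R: "R > 0" by simp
  have card: "real (card Q) \<le> cD ^ k" if Q: "finite Q" "Q \<subseteq> P" for Q
  proof -
    have le: "V x (R + \<rho> / 2) \<le> cD ^ k * V q (\<rho> / 2)" if "q \<in> Q" for q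
    proof -
      have "dist q x < R" using that Q P by (auto simp: dist_commute)
      then show ?thesis using k \<open>0 < \<rho>\<close> by (intro V_compare) auto
    qed
    have "real (card Q) * V x (R + \<rho> / 2) = (\<Sum>q\<in>Q. V x (R + \<rho> / 2))" by simp
    also have "\<dots> \<le> (\<Sum>q\<in>Q. cD ^ k * V q (\<rho> / 2))" by (intro sum_mono le)
    also have "\<dots> = cD ^ k * (\<Sum>q\<in>Q. measure m (ball q (\<rho> / 2)))"
      by (simp add: sum_distrib_left V_def)
    also have "(\<Sum>q\<in>Q. measure m (ball q (\<rho> / 2))) = measure m (\<Union>q\<in>Q. ball q (\<rho> / 2))"
    proof (rule measure_finite_Union[symmetric])
      show "disjoint_family_on (\<lambda>q. ball q (\<rho> / 2)) Q"
        unfolding disjoint_family_on_def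
      proof (intro ballI impI)
        fix a b assume ab: "a \<in> Q" "b \<in> Q" "a \<noteq> b"
        then have "\<rho> \<le> dist a b" using P(1) Q unfolding separated_def by blast
        then show "ball a (\<rho> / 2) \<inter> ball b (\<rho> / 2) = {}"
          by (intro disjoint_ballI) simp
      qed
    qed (use Q emeasure_ball_finite in \<open>auto simp: less_top\<close>)
    also have "\<dots> \<le> V x (R + \<rho> / 2)"
      unfolding V_def
    proof (rule measure_mono_fmeasurable)
      show "(\<Union>q\<in>Q. ball q (\<rho> / 2)) \<subseteq> ball x (R + \<rho> / 2)"
      proof
        fix y assume "y \<in> (\<Union>q\<in>Q. ball q (\<rho> / 2))"
        then obtain q where "q \<in> Q" "dist q y < \<rho> / 2" by auto
        moreover have "dist x q < R" using \<open>q \<in> Q\<close> Q P by auto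
        ultimately show "y \<in> ball x (R + \<rho> / 2)" using dist_triangle[of x y q] by simp
      qed
    qed (use emeasure_ball_finite in \<open>auto simp: fmeasurable_def intro!: borel_open\<close>)
    finally have "real (card Q) * V x (R + \<rho> / 2) \<le> cD ^ k * V x (R + \<rho> / 2)"
      using cD by (simp add: mult_left_mono)
    then show ?thesis using V_pos[of "R + \<rho> / 2" x] R \<open>0 < \<rho>\<close> by simp
  qed
  have "finite P"
  proof (rule ccontr)
    assume "infinite P"
    moreover obtain n where "cD ^ k < real n" using reals_Archimedean2 by blast
    ultimately show False using infinite_arbitrarily_large[of P n] card by fastforce
  qed
  then show ?thesis using card[of P] by simp
qed (use cD in auto)

text \<open>The sizes of separated subsets of the ball are bounded, so there is one of maximal size;
  an uncovered point could be added to it.\<close>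

lemma separated_net:
  assumes "0 < \<rho>"
  obtains P where "finite P" "separated \<rho> P" "P \<subseteq> ball x R" "ball x R \<subseteq> (\<Union>y\<in>P. ball y \<rho>)"
proof -
  obtain k where "(4 * R + \<rho>) / \<rho> < 2 ^ k" using real_arch_pow[of 2] by auto
  then have k: "4 * R + \<rho> \<le> 2 ^ k * \<rho>" using assms by (simp add: field_simps)
  let ?Q = "\<lambda>P. separated \<rho> P \<and> P \<subseteq> ball x R"
  obtain n where n: "cD ^ k < real n" using reals_Archimedean2 by blast
  have Q0: "?Q {}" by (simp add: separated_def)
  have "\<forall>P. ?Q P \<longrightarrow> card P < n"
    using separated_card[OF _ _ assms k] n by fastforce
  from ex_has_greatest_nat[where P = ?Q and f = card, OF Q0 this]
  obtain P where P: "?Q P" and max: "\<And>Q. ?Q Q \<Longrightarrow> card Q \<le> card P" by blast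
  have fin: "finite P" using separated_card[OF _ _ assms k] P by blast
  have "ball x R \<subseteq> (\<Union>y\<in>P. ball y \<rho>)"
  proof
    fix z assume z: "z \<in> ball x R"
    show "z \<in> (\<Union>y\<in>P. ball y \<rho>)"
    proof (rule ccontr)
      assume no: "z \<notin> (\<Union>y\<in>P. ball y \<rho>)"
      then have "?Q (insert z P)" "z \<notin> P"
        using P z assms unfolding separated_def by (auto simp: dist_commute not_less)
      then show False using max[of "insert z P"] fin by simp
    qed
  qed
  then show ?thesis using that fin P by blast
qed

text \<open>Doubling makes the complete space proper: nets of a slightly larger open ball give total
  boundedness.\<close>

lemma compact_cball [simp]: "compact (cball x R :: 'a set)"
  unfolding compact_eq_totally_bounded
proof (intro conjI allI impI)
  show "complete (cball x R)" by (simp add: complete_eq_closed)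
  fix e :: real assume "e > 0"
  then obtain P where "finite P" "ball x (R + 1) \<subseteq> (\<Union>y\<in>P. ball y e)" using separated_net by metis
  moreover have "cball x R \<subseteq> ball x (R + 1)" by auto
  ultimately show "\<exists>k. finite k \<and> cball x R \<subseteq> (\<Union>x\<in>k. ball x e)" by blast
qed

text \<open>The discretization samples a function at points whose oscillation \<open>G\<close> is at
  most the mean. If no such point existed, the strict inequality at the centre would make the
  integral finite, and strict monotonicity of the integral would contradict that the constant mean
  integrates to the same value.\<close>

lemma exists_le_mean:
  assumes [measurable]: "G \<in> borel_measurable borel" and r: "0 < r"
  obtains z where "z \<in> ball x r" "G z * ennreal (V x r) \<le> (\<integral>\<^sup>+y\<in>ball x r. G y \<partial>m)"
proof (rule ccontr)
  assume "\<not> thesis"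
  then have less: "(\<integral>\<^sup>+y\<in>ball x r. G y \<partial>m) < G z * ennreal (V x r)" if "z \<in> ball x r" for z
    using that \<open>\<And>z. z \<in> ball x r \<Longrightarrow> _ \<Longrightarrow> thesis\<close> by (auto simp: not_le[symmetric])
  define I where "I = (\<integral>\<^sup>+y\<in>ball x r. G y \<partial>m)"
  have [measurable]: "ball x r \<in> sets borel" by simp
  note V = V_pos[OF r, of x]
  have V1: "ennreal (1 / V x r) * ennreal (V x r) = 1"
    using V by (simp flip: ennreal_mult)
  have "x \<in> ball x r" using r by simp
  from less_le_trans[OF less[OF this] top_greatest] have fin: "I \<noteq> \<infinity>" unfolding I_def by simp
  have gt: "I * ennreal (1 / V x r) < G z" if "z \<in> ball x r" for z
  proof (rule ccontr)
    assume "\<not> ?thesis"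
    then have "G z * ennreal (V x r) \<le> I * ennreal (1 / V x r) * ennreal (V x r)"
      by (intro mult_right_mono) auto
    then show False using less[OF that] unfolding I_def[symmetric] mult.assoc V1 by simp
  qed
  have mean: "(\<integral>\<^sup>+y. I * ennreal (1 / V x r) * indicator (ball x r) y \<partial>m) = I"
    by (subst nn_integral_cmult_indicator) (auto simp: emeasure_ball mult.assoc V1)
  have "(\<integral>\<^sup>+y. I * ennreal (1 / V x r) * indicator (ball x r) y \<partial>m) < (\<integral>\<^sup>+y. G y * indicator (ball x r) y \<partial>m)"
  proof (rule nn_integral_less)
    show "(\<integral>\<^sup>+y. I * ennreal (1 / V x r) * indicator (ball x r) y \<partial>m) \<noteq> \<infinity>" unfolding mean by (rule fin)
    show "AE y in m. I * ennreal (1 / V x r) * indicator (ball x r) y \<le> G y * indicator (ball x r) y"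
      using gt by (intro AE_I2) (auto simp: indicator_def less_imp_le)
    show "\<not> (AE y in m. G y * indicator (ball x r) y \<le> I * ennreal (1 / V x r) * indicator (ball x r) y)"
    proof
      assume "AE y in m. G y * indicator (ball x r) y \<le> I * ennreal (1 / V x r) * indicator (ball x r) y"
      then have "AE y in m. y \<notin> ball x r"
        by eventually_elim (use gt in \<open>force simp: not_le[symmetric]\<close>)
      then have "emeasure m (ball x r) = 0"
        by (subst (asm) AE_iff_measurable[where N = "ball x r"]) auto
      then show False using V by (simp add: emeasure_ball)
    qed
  qed measurable
  then show False unfolding mean by (simp add: I_def)
qed

text \<open>Indexed form of \<open>separated_card\<close>; it bounds the number of neighbours of a
  net point and the overlap of enlarged balls.\<close>

lemma separated_index_card:
  assumes inj: "inj_on x I" and sep: "separated \<rho> (x ` I)" and "0 < \<rho>" "4 * R + \<rho> \<le> 2 ^ k * \<rho>"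
  shows "finite {i \<in> I. dist y (x i) < R}" "real (card {i \<in> I. dist y (x i) < R}) \<le> cD ^ k"
proof -
  let ?A = "{i \<in> I. dist y (x i) < R}"
  have "separated \<rho> (x ` ?A)" using sep unfolding separated_def by auto
  moreover have "x ` ?A \<subseteq> ball y R" by auto
  ultimately have "finite (x ` ?A) \<and> card (x ` ?A) \<le> cD ^ k" using assms(3,4) by (rule separated_card)
  moreover have "inj_on x ?A" using inj by (rule inj_on_subset) auto
  ultimately show "finite ?A" "real (card ?A) \<le> cD ^ k" by (auto simp: finite_image_iff card_image)
qed

end

section \<open>Energy spaces\<close>

lemma compact_closed_subset: "compact T \<Longrightarrow> closed S \<Longrightarrow> S \<subseteq> T \<Longrightarrow> compact S"
  using compact_Int_closed[of T S] by (simp add: Int_absorb1)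

lemma Cc_compose2:
  assumes u: "u \<in> Cc" and v: "v \<in> Cc" and h: "continuous_on UNIV (\<lambda>(a, b). h a b)" "h 0 0 = (0::real)"
  shows "(\<lambda>x. h (u x) (v x)) \<in> Cc"
proof -
  have "continuous_on UNIV (\<lambda>x. (\<lambda>(a, b). h a b) (u x, v x))"
    using u v unfolding Cc_def
    by (intro continuous_on_compose2[OF h(1)] continuous_intros) auto
  moreover have "closure {x. h (u x) (v x) \<noteq> 0} \<subseteq> closure {x. u x \<noteq> 0} \<union> closure {x. v x \<noteq> 0}"
    unfolding closure_Un[symmetric] using h(2) by (intro closure_mono) auto
  moreover have "compact (closure {x. u x \<noteq> 0} \<union> closure {x. v x \<noteq> 0})"
    using u v unfolding Cc_def by (intro compact_Un) auto
  ultimately show ?thesis unfolding Cc_def by (auto intro: compact_closed_subset)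
qed

lemma Cc_add: "u \<in> Cc \<Longrightarrow> v \<in> Cc \<Longrightarrow> (\<lambda>x. u x + v x) \<in> Cc"
  by (rule Cc_compose2) (auto simp: split_beta intro!: continuous_intros)

lemma Cc_diff: "u \<in> Cc \<Longrightarrow> v \<in> Cc \<Longrightarrow> (\<lambda>x. u x - v x) \<in> Cc"
  by (rule Cc_compose2) (auto simp: split_beta intro!: continuous_intros)

lemma Cc_max: "u \<in> Cc \<Longrightarrow> v \<in> Cc \<Longrightarrow> (\<lambda>x. max (u x) (v x)) \<in> Cc"
  by (rule Cc_compose2) (auto simp: split_beta intro!: continuous_intros)

lemma Cc_min: "u \<in> Cc \<Longrightarrow> v \<in> Cc \<Longrightarrow> (\<lambda>x. min (u x) (v x)) \<in> Cc"
  by (rule Cc_compose2) (auto simp: split_beta intro!: continuous_intros)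

lemma Cc_compose:
  assumes "u \<in> Cc" "continuous_on UNIV h" "h 0 = (0::real)"
  shows "(\<lambda>x. h (u x)) \<in> Cc"
proof (rule Cc_compose2[OF assms(1) assms(1), of "\<lambda>a b. h a"])
  have "continuous_on UNIV (\<lambda>z :: real \<times> real. h (fst z))"
    by (rule continuous_on_compose2[OF assms(2)]) (auto intro: continuous_on_fst continuous_on_id)
  then show "continuous_on UNIV (\<lambda>(a :: real, b :: real). h a)" by (simp add: split_beta)
qed (fact assms(3))

lemma Cc_zero [simp]: "(\<lambda>x. 0) \<in> Cc"
  unfolding Cc_def by simp

lemma Cc_sum:
  assumes "\<And>i. i \<in> I \<Longrightarrow> f i \<in> Cc"
  shows "(\<lambda>x. \<Sum>i\<in>I. f i x) \<in> Cc"
  using assms by (induction I rule: infinite_finite_induct) (auto intro: Cc_add)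

lemma Cc_bounded_support:
  assumes "(u :: 'a::metric_space \<Rightarrow> real) \<in> Cc"
  obtains R where "R > 0" "\<And>x. x \<notin> ball x0 R \<Longrightarrow> u x = 0"
proof -
  have "bounded (closure {x. u x \<noteq> 0})" using assms unfolding Cc_def by (intro compact_imp_bounded) auto
  then obtain R where R: "closure {x. u x \<noteq> 0} \<subseteq> ball x0 R"
    using bounded_subset_ballD by blast
  have "u x = 0" if "x \<notin> ball x0 (max R 1)" for x
  proof (rule ccontr)
    assume "u x \<noteq> 0"
    then have "x \<in> ball x0 R" using R closure_subset[of "{x. u x \<noteq> 0}"] by blast
    then show False using that by auto
  qed
  then show ?thesis by (intro that[of "max R 1"]) auto
qed

lemma lipschitz_pos: "1-lipschitz_on UNIV (\<lambda>t::real. max 0 t)"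
proof (rule lipschitz_onI)
  show "dist (max 0 x) (max 0 y) \<le> 1 * dist x y" for x y :: real
    unfolding dist_real_def mult_1 by linarith
qed simp

lemma lipschitz_min1: "1-lipschitz_on UNIV (\<lambda>t::real. min t 1)"
proof (rule lipschitz_onI)
  show "dist (min x 1) (min y 1) \<le> 1 * dist x y" for x y :: real
    unfolding dist_real_def mult_1 by linarith
qed simp

lemma lipschitz_clamp: "1-lipschitz_on UNIV (\<lambda>t::real. max 0 (min t 1))"
  using lipschitz_on_compose2[OF lipschitz_min1 lipschitz_on_subset[OF lipschitz_pos]] by simp

text \<open>Transfers the functional from \<open>u\<close> to a representative in
  \<open>\<F>\<close>. The congruence of integrals asks for no measurability, which matters because
  an element of \<open>local_domain\<close> is arbitrary outside its open set.\<close>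

lemma difference_energy_cong:
  assumes "AE x in m. x \<in> S \<longrightarrow> u x = v x"
  shows "difference_energy m p S u w r = difference_energy m p S v w r"
  unfolding difference_energy_def
proof (rule nn_integral_cong_AE)
  show "AE y in m. 1 / emeasure m (ball y r) * (\<integral>\<^sup>+x\<in>S \<inter> ball y r. ennreal (\<bar>u x - u y\<bar> powr p / w x y) \<partial>m) * indicator S y
      = 1 / emeasure m (ball y r) * (\<integral>\<^sup>+x\<in>S \<inter> ball y r. ennreal (\<bar>v x - v y\<bar> powr p / w x y) \<partial>m) * indicator S y"
    using assms
  proof eventually_elim
    case (elim y)
    show ?case
    proof (cases "y \<in> S")
      case True
      have "(\<integral>\<^sup>+x\<in>S \<inter> ball y r. ennreal (\<bar>u x - u y\<bar> powr p / w x y) \<partial>m)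
          = (\<integral>\<^sup>+x\<in>S \<inter> ball y r. ennreal (\<bar>v x - v y\<bar> powr p / w x y) \<partial>m)"
        by (rule nn_integral_cong_AE) (use assms in eventually_elim, use elim True in \<open>auto simp: indicator_def\<close>)
      then show ?thesis by simp
    qed simp
  qed
qed

lemma difference_energy_mono_set:
  assumes "A \<subseteq> S"
  shows "difference_energy m p A u w r \<le> difference_energy m p S u w r"
  unfolding difference_energy_def using assms
  by (intro nn_integral_mono mult_mono) (auto simp: indicator_def)

text \<open>The constants of the three analytic conditions are parameters, so that every constant
  obtained inside is uniform in functions, sets and radii.\<close>

locale energy_space = doubling_space m cD + p_energy_form m p \<F> \<E> \<Gamma>
  for m :: "'a::polish_space measure" and cD p :: real and \<F> \<E> \<Gamma> +
  fixes \<Psi> :: "real \<Rightarrow> real" and C\<^sub>P A\<^sub>P C\<^sub>c A\<^sub>1 A\<^sub>2 :: real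
  assumes p: "1 < p"
    and two_points: "\<exists>x y :: 'a. x \<noteq> y"
    and scale: "scale_function \<Psi>"
    and C\<^sub>P: "0 < C\<^sub>P" and A\<^sub>P: "1 \<le> A\<^sub>P"
    and poincare: "\<And>x r u. u \<in> \<F> \<Longrightarrow> 0 < r \<Longrightarrow>
      (\<integral>\<^sup>+y\<in>ball x r. ennreal (\<bar>u y - average m (ball x r) u\<bar> powr p) \<partial>m)
        \<le> ennreal (C\<^sub>P * \<Psi> r) * emeasure (\<Gamma> u) (ball x (A\<^sub>P * r))"
    and C\<^sub>c: "1 < C\<^sub>c" and A\<^sub>1: "1 < A\<^sub>1" and A\<^sub>2: "1 < A\<^sub>2"
    and capacity: "\<And>x R. 0 < R \<Longrightarrow> ennreal R < ediam (UNIV :: 'a set) / ennreal A\<^sub>2 \<Longrightarrow>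
      (INF u\<in>{u \<in> \<F>. (AE y in m. y \<in> ball x R \<longrightarrow> u y = 1) \<and>
                        (AE y in m. y \<notin> ball x (A\<^sub>1 * R) \<longrightarrow> u y = 0)}. ennreal (\<E> u))
        \<le> ennreal C\<^sub>c * emeasure m (ball x R) / ennreal (\<Psi> R)"
begin

section \<open>Energy seminorms and lattice operations\<close>

lemmas \<F>_zero = function_subspace_zero[OF linear_subspace]
  and \<F>_add = function_subspace_add[OF linear_subspace]
  and \<F>_scale = function_subspace_scale[OF linear_subspace]
  and \<F>_diff = function_subspace_diff[OF linear_subspace]
  and \<F>_sum = function_subspace_sum[OF linear_subspace]

lemma \<F>_measurable: "u \<in> \<F> \<Longrightarrow> u \<in> borel_measurable borel"
  using in_Lp borel_measurable_m unfolding Lp_functions_def by auto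

text \<open>The roots are the seminorms; estimates are made for them and raised to the power
  \<open>p\<close> at the end.\<close>

definition energy_root :: "('a \<Rightarrow> real) \<Rightarrow> real" where "energy_root u = \<E> u powr (1 / p)"

definition measure_root :: "'a set \<Rightarrow> ('a \<Rightarrow> real) \<Rightarrow> real" where "measure_root A u = measure (\<Gamma> u) A powr (1 / p)"

lemma energy_eq: "u \<in> \<F> \<Longrightarrow> \<E> u = energy_root u powr p"
  using p energy_nonneg[of u] by (simp add: energy_root_def powr_powr)

lemma energy_measure_eq: "measure (\<Gamma> u) A = measure_root A u powr p"
  using p by (simp add: measure_root_def powr_powr)

lemma seminorm_energy_root: "seminorm_on \<F> energy_root"
  using energy_seminorm by (simp add: energy_root_def[abs_def])

lemma seminorm_measure_root: "A \<in> sets borel \<Longrightarrow> seminorm_on \<F> (measure_root A)"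
  using measure_seminorm by (simp add: measure_root_def[abs_def])

lemma seminorm_energy_norm: "seminorm_on \<F> (energy_norm m p \<E>)"
  using seminorm_energy_root seminorm_on_Lp_norm[OF p in_Lp linear_subspace]
  unfolding seminorm_on_def energy_norm_def energy_root_def[symmetric]
  by (simp add: distrib_left) (smt (verit))

lemma emeasure_\<Gamma>: "u \<in> \<F> \<Longrightarrow> emeasure (\<Gamma> u) A = ennreal (measure (\<Gamma> u) A)"
  by (simp add: finite_measure.emeasure_eq_measure[OF measure_finite])

lemma measure_\<Gamma>_le: "u \<in> \<F> \<Longrightarrow> A \<in> sets borel \<Longrightarrow> measure (\<Gamma> u) A \<le> \<E> u"
  unfolding total_mass
  by (rule finite_measure.finite_measure_mono[OF measure_finite]) (auto simp: measure_sets)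

lemma measure_root_le: "u \<in> \<F> \<Longrightarrow> A \<in> sets borel \<Longrightarrow> measure_root A u \<le> energy_root u"
  using measure_\<Gamma>_le p unfolding measure_root_def energy_root_def by (intro powr_mono2) auto

lemma measure_\<Gamma>_zero: "A \<in> sets borel \<Longrightarrow> measure (\<Gamma> (\<lambda>x. 0)) A = 0"
  using seminorm_on_zero[OF seminorm_measure_root linear_subspace, of A] energy_measure_eq[of "\<lambda>x. 0" A] by simp

lemma energy_root_contraction:
  assumes "u \<in> \<F>" "1-lipschitz_on UNIV \<phi>" "\<phi> (0::real) = (0::real)"
  shows "(\<lambda>x. \<phi> (u x)) \<in> \<F>" "energy_root (\<lambda>x. \<phi> (u x)) \<le> energy_root u"
  using contraction[OF assms] p energy_nonneg unfolding energy_root_def by (auto intro!: powr_mono2)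

text \<open>Writing the maximum as \<open>v + max 0 (u - v)\<close> reduces it to the contraction
  property; this explains the asymmetric constants.\<close>

lemma energy_root_max:
  assumes uv: "u \<in> \<F>" "v \<in> \<F>"
  shows "(\<lambda>x. max (u x) (v x)) \<in> \<F>" "energy_root (\<lambda>x. max (u x) (v x)) \<le> energy_root u + 2 * energy_root v"
proof -
  note d = \<F>_diff[OF uv]
  note pos = energy_root_contraction[OF d lipschitz_pos]
  have eq: "(\<lambda>x. max (u x) (v x)) = (\<lambda>x. v x + max 0 (u x - v x))" by auto
  show "(\<lambda>x. max (u x) (v x)) \<in> \<F>" unfolding eq using pos by (intro \<F>_add uv) simp
  have "energy_root (\<lambda>x. v x + max 0 (u x - v x)) \<le> energy_root v + energy_root (\<lambda>x. max 0 (u x - v x))"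
    using pos by (intro seminorm_on_add[OF seminorm_energy_root] uv) simp
  then show "energy_root (\<lambda>x. max (u x) (v x)) \<le> energy_root u + 2 * energy_root v"
    unfolding eq using pos seminorm_on_diff[OF seminorm_energy_root linear_subspace uv] by simp
qed

lemma energy_root_min:
  assumes uv: "u \<in> \<F>" "v \<in> \<F>"
  shows "(\<lambda>x. min (u x) (v x)) \<in> \<F>" "energy_root (\<lambda>x. min (u x) (v x)) \<le> 2 * energy_root u + energy_root v"
proof -
  note d = \<F>_diff[OF uv]
  note pos = energy_root_contraction[OF d lipschitz_pos]
  have eq: "(\<lambda>x. min (u x) (v x)) = (\<lambda>x. u x - max 0 (u x - v x))" by auto
  show "(\<lambda>x. min (u x) (v x)) \<in> \<F>" unfolding eq using pos by (intro \<F>_diff uv) simp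
  have "energy_root (\<lambda>x. u x - max 0 (u x - v x)) \<le> energy_root u + energy_root (\<lambda>x. max 0 (u x - v x))"
    using pos by (intro seminorm_on_diff[OF seminorm_energy_root linear_subspace] uv) simp
  then show "energy_root (\<lambda>x. min (u x) (v x)) \<le> 2 * energy_root u + energy_root v"
    unfolding eq using pos seminorm_on_diff[OF seminorm_energy_root linear_subspace uv] by simp
qed

lemma Lp_norm_eq_0:
  assumes "u \<in> \<F>" "Lp_norm m p u = 0"
  shows "AE x in m. u x = 0"
proof -
  have int: "integrable m (\<lambda>x. \<bar>u x\<bar> powr p)" using in_Lp assms(1) unfolding Lp_functions_def by auto
  have "(\<integral>x. \<bar>u x\<bar> powr p \<partial>m) = 0" using assms(2) p unfolding Lp_norm_def by (simp add: powr_eq_0_iff)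
  then show ?thesis using integral_nonneg_eq_0_iff_AE[OF int] by auto
qed

text \<open>Mazur's lemma with the limit identified. The point \<open>w\<close> of
  \<open>reflexive_mazur\<close> equals \<open>u\<close> almost everywhere, because every Lebesgue
  ball about \<open>u\<close> is convex, contains \<open>f k\<close> eventually, and so has points
  arbitrarily close to \<open>w\<close>. In applications \<open>K\<close> carries the property that
  the approximation has to keep.\<close>

lemma energy_mazur:
  assumes f: "\<And>k. f k \<in> \<F>" "\<And>k. energy_root (f k) \<le> M" and u: "u \<in> \<F>"
    and lim: "(\<lambda>k. Lp_norm m p (\<lambda>x. f k x - u x)) \<longlonglongrightarrow> 0"
    and K: "K \<subseteq> \<F>" "convex_functions K" "eventually (\<lambda>k. f k \<in> K) sequentially" and "\<epsilon> > 0"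
  obtains h where "h \<in> K" "energy_norm m p \<E> (\<lambda>x. h x - u x) < \<epsilon>"
proof -
  let ?L = "Lp_norm m p" and ?N = "energy_norm m p \<E>"
  note L = seminorm_on_Lp_norm[OF p in_Lp linear_subspace]
  have LN: "?L w \<le> ?N w" for w unfolding energy_norm_def by simp
  obtain B where B: "\<And>k. ?L (\<lambda>x. f k x - u x) \<le> B"
    using Bseq_eq_bounded convergent_imp_Bseq[OF convergentI[OF lim]] unfolding Bseq_def
    by (metis abs_le_D1 real_norm_def)
  have "?N (f k) \<le> B + ?L u + M" for k
  proof -
    have "?L (\<lambda>x. (f k x - u x) + u x) \<le> ?L (\<lambda>x. f k x - u x) + ?L u"
      by (intro seminorm_on_add[OF L] \<F>_diff f u)
    then show ?thesis using B[of k] f(2)[of k] unfolding energy_norm_def energy_root_def by simp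
  qed
  then obtain w where w: "w \<in> \<F>" and mazur: "\<And>K \<epsilon>. K \<subseteq> \<F> \<Longrightarrow> convex_functions K \<Longrightarrow>
      eventually (\<lambda>k. f k \<in> K) sequentially \<Longrightarrow> \<epsilon> > 0 \<Longrightarrow> \<exists>h\<in>K. ?N (\<lambda>x. h x - w x) < \<epsilon>"
    using reflexive_mazur[where V = \<F> and N = ?N and f = f and M = "B + ?L u + M", OF linear_subspace
        seminorm_energy_norm reflexive f(1)] by blast
  have "?L (\<lambda>x. u x - w x) \<le> 0 + \<delta>" if "\<delta> > 0" for \<delta>
  proof -
    define K' where "K' = {h \<in> \<F>. ?L (\<lambda>x. h x - u x) \<le> \<delta> / 2}"
    have "convex_functions K'"
      unfolding convex_functions_def
    proof (intro ballI allI impI)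
      fix a b and s t :: real assume ab: "a \<in> K'" "b \<in> K'" and st: "0 \<le> s" "0 \<le> t" "s + t = 1"
      have F: "a \<in> \<F>" "b \<in> \<F>" using ab unfolding K'_def by auto
      have "u x = s * u x + t * u x" for x using st(3) by (simp flip: distrib_right)
      then have "(\<lambda>x. s * a x + t * b x - u x) = (\<lambda>x. s * (a x - u x) + t * (b x - u x))"
        by (auto simp: algebra_simps)
      then have "?L (\<lambda>x. s * a x + t * b x - u x) = ?L (\<lambda>x. s * (a x - u x) + t * (b x - u x))" by simp
      also have "\<dots> \<le> ?L (\<lambda>x. s * (a x - u x)) + ?L (\<lambda>x. t * (b x - u x))"
        by (intro seminorm_on_add[OF L] \<F>_scale \<F>_diff F u)
      also have "\<dots> = s * ?L (\<lambda>x. a x - u x) + t * ?L (\<lambda>x. b x - u x)"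
        using st seminorm_on_scale[OF L \<F>_diff[OF F(1) u], of s] seminorm_on_scale[OF L \<F>_diff[OF F(2) u], of t]
        by simp
      also have "\<dots> \<le> s * (\<delta> / 2) + t * (\<delta> / 2)"
        using ab st unfolding K'_def by (intro add_mono mult_left_mono) auto
      also have "\<dots> = \<delta> / 2" using st by (simp flip: distrib_right)
      finally show "(\<lambda>x. s * a x + t * b x) \<in> K'"
        unfolding K'_def using F by (auto intro: \<F>_add \<F>_scale)
    qed
    moreover have "eventually (\<lambda>k. f k \<in> K') sequentially"
      using order_tendstoD(2)[OF lim, of "\<delta> / 2"] \<open>\<delta> > 0\<close> f(1) unfolding K'_def
      by (auto elim!: eventually_mono)
    ultimately obtain h where h: "h \<in> K'" "?N (\<lambda>x. h x - w x) < \<delta> / 2"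
      using mazur[of K' "\<delta> / 2"] \<open>\<delta> > 0\<close> unfolding K'_def by auto
    then have hF: "h \<in> \<F>" and hu: "?L (\<lambda>x. h x - u x) \<le> \<delta> / 2" unfolding K'_def by auto
    have "?L (\<lambda>x. (h x - w x) - (h x - u x)) \<le> ?L (\<lambda>x. h x - w x) + ?L (\<lambda>x. h x - u x)"
      by (intro seminorm_on_diff[OF L linear_subspace] \<F>_diff hF u w)
    then show ?thesis using hu h(2) LN[of "\<lambda>x. h x - w x"] by simp
  qed
  then have "?L (\<lambda>x. u x - w x) \<le> 0" by (rule field_le_epsilon)
  then have "?L (\<lambda>x. u x - w x) = 0" using seminorm_on_nonneg[OF L \<F>_diff[OF u w]] by simp
  then have ae: "AE x in m. u x - w x = 0" by (rule Lp_norm_eq_0[OF \<F>_diff[OF u w]])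
  obtain h where h: "h \<in> K" "?N (\<lambda>x. h x - w x) < \<epsilon>" using mazur[OF K \<open>\<epsilon> > 0\<close>] by blast
  have hF: "h \<in> \<F>" using h K by auto
  have ae': "AE x in m. h x - u x = h x - w x" using ae by eventually_elim simp
  have "(\<integral>x. \<bar>h x - u x\<bar> powr p \<partial>m) = (\<integral>x. \<bar>h x - w x\<bar> powr p \<partial>m)"
    using ae' \<F>_measurable[OF hF] \<F>_measurable[OF u] \<F>_measurable[OF w]
    by (intro integral_cong_AE) (auto simp: borel_measurable_m)
  then have "?N (\<lambda>x. h x - u x) = ?N (\<lambda>x. h x - w x)"
    using energy_cong[OF \<F>_diff[OF hF u] \<F>_diff[OF hF w] ae'] unfolding energy_norm_def Lp_norm_def by simp
  then show ?thesis using h that by simp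
qed

section \<open>Cutoff functions, spheres and reverse doubling\<close>

text \<open>A member of \<open>\<F>\<close> within \<open>1 / 3\<close> of \<open>h\<close> has
  values below \<open>1 / 3\<close> where \<open>h \<le> 0\<close> and above \<open>2 / 3\<close>
  where \<open>h \<ge> 1\<close>; the profile \<open>T\<close> maps these to 0 and 1. As
  \<open>T\<close> has slope 3, contraction is applied to \<open>1 / 3 * T\<close> and linearity
  restores the factor. The energy is not controlled.\<close>

lemma Cc_cutoff:
  assumes h: "h \<in> Cc"
  obtains \<phi> where "\<phi> \<in> \<F> \<inter> Cc" "\<And>x. 0 \<le> \<phi> x" "\<And>x. \<phi> x \<le> 1"
    "\<And>x. 1 \<le> h x \<Longrightarrow> \<phi> x = 1" "\<And>x. h x \<le> 0 \<Longrightarrow> \<phi> x = 0"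
proof -
  obtain v where v: "v \<in> \<F> \<inter> Cc" and hv: "\<And>x. \<bar>h x - v x\<bar> < 1 / 3"
    using dense_in_Cc[OF h, of "1 / 3"] by auto
  define T where "T = (\<lambda>t::real. max 0 (min (3 * t - 1) 1))"
  have lip: "1-lipschitz_on UNIV (\<lambda>t. 1 / 3 * T t)"
    by (rule lipschitz_onI) (auto simp: T_def dist_real_def max_def min_def abs_if diff_divide_distrib)
  have "(\<lambda>x. 1 / 3 * T (v x)) \<in> \<F>"
    using energy_root_contraction(1)[OF _ lip] v by (simp add: T_def)
  then have "(\<lambda>x. 3 * (1 / 3 * T (v x))) \<in> \<F>" by (rule \<F>_scale)
  moreover have "(\<lambda>x. T (v x)) \<in> Cc"
  proof (rule Cc_compose[of v T])
    show "continuous_on UNIV T" unfolding T_def by (intro continuous_intros)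
  qed (use v in \<open>auto simp: T_def\<close>)
  ultimately have "(\<lambda>x. T (v x)) \<in> \<F> \<inter> Cc" by simp
  then show ?thesis
  proof (rule that)
    show "T (v x) = 1" if "1 \<le> h x" for x
    proof -
      have "1 \<le> 3 * v x - 1" using abs_less_iff[THEN iffD1, OF hv[of x]] that by simp
      then show ?thesis by (simp add: T_def)
    qed
    show "T (v x) = 0" if "h x \<le> 0" for x
    proof -
      have "3 * v x - 1 \<le> 0" using abs_less_iff[THEN iffD1, OF hv[of x]] that by simp
      then show ?thesis by (simp add: T_def)
    qed
  qed (auto simp: T_def)
qed

lemma Cc_ballI:
  assumes "continuous_on UNIV (u :: 'a \<Rightarrow> real)" "\<And>y. y \<notin> ball x R \<Longrightarrow> u y = 0"
  shows "u \<in> Cc"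
proof -
  have "{y. u y \<noteq> 0} \<subseteq> cball x R" using assms(2) by force
  then have "closure {y. u y \<noteq> 0} \<subseteq> cball x R" by (intro closure_minimal) auto
  then show ?thesis using assms(1) unfolding Cc_def by (auto intro: compact_closed_subset[of "cball x R"])
qed

lemma ball_cutoff:
  assumes "s < t"
  obtains \<phi> where "\<phi> \<in> \<F> \<inter> Cc" "\<And>y. 0 \<le> \<phi> y" "\<And>y. \<phi> y \<le> 1"
    "\<And>y. y \<in> ball x s \<Longrightarrow> \<phi> y = 1" "\<And>y. y \<notin> ball x t \<Longrightarrow> \<phi> y = 0"
proof -
  define h where "h = (\<lambda>y. max 0 ((t - dist x y) / (t - s)))"
  have "h \<in> Cc"
    unfolding h_def
    using assms by (intro Cc_ballI[of _ x t] continuous_intros) (auto simp: max_def field_simps)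
  from Cc_cutoff[OF this] obtain \<phi> where \<phi>: "\<phi> \<in> \<F> \<inter> Cc" "\<And>y. 0 \<le> \<phi> y" "\<And>y. \<phi> y \<le> 1"
    "\<And>y. 1 \<le> h y \<Longrightarrow> \<phi> y = 1" "\<And>y. h y \<le> 0 \<Longrightarrow> \<phi> y = 0" by blast
  show ?thesis
  proof (rule that[OF \<phi>(1-3)])
    show "\<phi> y = 1" if "y \<in> ball x s" for y
      using that assms by (intro \<phi>(4)) (auto simp: h_def le_max_iff_disj field_simps)
    show "\<phi> y = 0" if "y \<notin> ball x t" for y
      using that assms by (intro \<phi>(5)) (auto simp: h_def field_simps)
  qed
qed

text \<open>If a sphere is empty, the ball is open and compact, and its indicator function has zero energy by
  strong locality.\<close>

lemma sphere_nonempty: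
  fixes x :: 'a
  assumes "0 < r" "ball x r \<noteq> UNIV"
  obtains y where "dist x y = r"
proof (rule ccontr)
  assume no: "\<not> thesis"
  have cball: "ball x r = cball x r" using that no by (force simp: le_less)
  have opn: "open (- ball x r)" unfolding cball by (simp flip: closed_def add: open_Compl)
  define h where "h = (\<lambda>y. if y \<in> ball x r then 1 else 0 :: real)"
  have "continuous_on (ball x r \<union> - ball x r) h"
    using opn
  proof (intro continuous_on_open_Un)
    show "continuous_on (ball x r) h"
      by (rule continuous_on_eq[OF continuous_on_const[of _ 1]]) (simp add: h_def)
    show "continuous_on (- ball x r) h"
      by (rule continuous_on_eq[OF continuous_on_const[of _ 0]]) (simp add: h_def)
  qed auto
  then have "h \<in> Cc" by (intro Cc_ballI[of _ x r]) (auto simp: h_def)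
  from Cc_cutoff[OF this] obtain \<phi> where \<phi>: "\<phi> \<in> \<F> \<inter> Cc"
    and one: "\<And>y. y \<in> ball x r \<Longrightarrow> \<phi> y = 1" and zero: "\<And>y. y \<notin> ball x r \<Longrightarrow> \<phi> y = 0"
    unfolding h_def by (metis order_refl)
  have 0: "(\<lambda>x. 0) \<in> \<F> \<inter> Cc" using \<F>_zero by simp
  have "emeasure (\<Gamma> \<phi>) (ball x r) = emeasure (\<Gamma> (\<lambda>x. 0)) (ball x r)"
    by (rule strongly_local[OF \<phi> 0, of "ball x r" 1]) (auto simp: one)
  moreover have "emeasure (\<Gamma> \<phi>) (- ball x r) = emeasure (\<Gamma> (\<lambda>x. 0)) (- ball x r)"
    by (rule strongly_local[OF \<phi> 0, of "- ball x r" 0]) (use opn in \<open>auto simp: zero\<close>)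
  moreover have "emeasure (\<Gamma> \<phi>) (ball x r \<union> - ball x r) \<le> emeasure (\<Gamma> \<phi>) (ball x r) + emeasure (\<Gamma> \<phi>) (- ball x r)"
    using \<phi> by (intro emeasure_subadditive) (auto simp: measure_sets)
  ultimately have "emeasure (\<Gamma> \<phi>) UNIV = 0"
    using 0 by (simp add: emeasure_\<Gamma> measure_\<Gamma>_zero)
  then have "\<E> \<phi> = 0" using \<phi> by (simp add: total_mass measure_def)
  then obtain c where c: "AE y in m. \<phi> y = c" using energy_kernel \<phi> by blast
  \<comment> \<open>An almost everywhere constant \<open>\<phi>\<close> leaves one of the two
    nonempty open sets null, against full support.\<close>
  have null: "emeasure m U = 0" if "open U" "\<And>y. y \<in> U \<Longrightarrow> \<phi> y \<noteq> c" for U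
  proof -
    have "AE y in m. y \<notin> U" using c by eventually_elim (use that in auto)
    then show ?thesis using that(1) by (subst (asm) AE_iff_measurable[OF _ refl]) auto
  qed
  have pos: "emeasure m U \<noteq> 0" if "open U" "U \<noteq> {}" for U
    using full_supp that unfolding full_support_def by force
  show False
  proof (cases "c = 1")
    case True
    then have "emeasure m (- ball x r) = 0" using opn zero by (intro null) auto
    then show False using pos[OF opn] assms(2) by auto
  next
    case False
    then have "emeasure m (ball x r) = 0" using one by (intro null) auto
    then show False using pos[of "ball x r"] assms(1) by auto
  qed
qed

text \<open>The ball of radius \<open>r / 2\<close> found in \<open>reverse_doubling\<close> carries
  at least the fraction \<open>1 / cD ^ 3\<close> of \<open>V y (2 * r)\<close>. Only half of it is
  used, so that \<open>\<theta>\<close> is positive even for \<open>cD = 1\<close> and can be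
  divided by.\<close>

definition \<theta> :: real where "\<theta> = 1 - 1 / (2 * cD ^ 3)"

lemma \<theta>: "0 < \<theta>" "\<theta> < 1"
proof -
  have "1 \<le> cD ^ 3" using cD by (rule one_le_power)
  moreover have pos: "0 < cD" using cD by simp
  ultimately have "1 / (2 * cD ^ 3) \<le> 1 / (2 * 1)" by (intro divide_left_mono) auto
  then show "0 < \<theta>" unfolding \<theta>_def by simp
  show "\<theta> < 1" unfolding \<theta>_def using pos by simp
qed

text \<open>A point \<open>z\<close> at distance \<open>3 / 2 * r\<close> exists because spheres are
  nonempty; \<open>ball z (r / 2)\<close> is disjoint from \<open>ball y r\<close>, lies in
  \<open>ball y (2 * r)\<close>, and has comparable volume.\<close>

lemma reverse_doubling:
  assumes "0 < r" "ball y (2 * r) \<noteq> UNIV"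
  shows "V y r \<le> \<theta> * V y (2 * r)"
proof -
  have "ball y (3 / 2 * r) \<subseteq> ball y (2 * r)" using assms(1) by (intro subset_ball) simp
  then have "ball y (3 / 2 * r) \<noteq> UNIV" using assms(2) by blast
  then obtain z where z: "dist y z = 3 / 2 * r" using sphere_nonempty[of "3 / 2 * r" y] assms(1) by auto
  have disj: "ball y r \<inter> ball z (r / 2) = {}" using z by (intro disjoint_ballI) simp
  have "V y r + V z (r / 2) = measure m (ball y r \<union> ball z (r / 2))"
    unfolding V_def using disj emeasure_ball_finite by (intro measure_Union[symmetric]) (auto simp: less_top)
  also have "\<dots> \<le> V y (2 * r)"
    unfolding V_def
  proof (rule measure_mono_fmeasurable)
    show "ball y r \<union> ball z (r / 2) \<subseteq> ball y (2 * r)"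
    proof
      fix w assume "w \<in> ball y r \<union> ball z (r / 2)"
      then show "w \<in> ball y (2 * r)" using z assms(1) dist_triangle[of y w z] by auto
    qed
  qed (use emeasure_ball_finite in \<open>auto simp: fmeasurable_def\<close>)
  finally have "V y r + V z (r / 2) \<le> V y (2 * r)" .
  moreover have "V y (2 * r) \<le> cD ^ 3 * V z (r / 2)"
    using z assms(1) by (intro V_compare) (auto simp: dist_commute)
  then have "V y (2 * r) / cD ^ 3 \<le> V z (r / 2)" using cD by (simp add: field_simps)
  moreover have "V y (2 * r) / (2 * cD ^ 3) \<le> V y (2 * r) / cD ^ 3"
    using cD by (intro divide_left_mono) auto
  ultimately show ?thesis by (simp add: \<theta>_def algebra_simps)
qed

lemma \<Psi>_pos: "0 < r \<Longrightarrow> 0 < \<Psi> r"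
  using scale unfolding scale_function_def bij_betw_def by (metis greaterThan_iff image_eqI)

lemma \<Psi>_mono: "0 < r \<Longrightarrow> r \<le> s \<Longrightarrow> \<Psi> r \<le> \<Psi> s"
  using scale unfolding scale_function_def strict_mono_on_def by (metis greaterThan_iff le_less less_le_trans)

lemma \<Psi>_mult:
  assumes "1 \<le> a"
  obtains C where "1 \<le> C" "\<And>r. 0 < r \<Longrightarrow> \<Psi> (a * r) \<le> C * \<Psi> r"
proof -
  obtain C b where C: "1 \<le> C" and *: "\<And>r R. 0 < r \<Longrightarrow> r \<le> R \<Longrightarrow> \<Psi> R / \<Psi> r \<le> C * (R / r) powr b" and "b > 0"
    using scale unfolding scale_function_def by metis
  have "\<Psi> (a * r) \<le> (C * a powr b) * \<Psi> r" if "0 < r" for r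
    using *[of r "a * r"] that assms \<Psi>_pos[OF that] by (simp add: field_simps)
  moreover have "1 \<le> C * a powr b"
    using C ge_one_powr_ge_zero[OF assms, of b] \<open>b > 0\<close> by (metis less_imp_le mult_mono' mult_1 zero_le_one)
  ultimately show ?thesis using that by blast
qed

subsection \<open>Upper bounds\<close>

text \<open>The weight \<open>\<Psi> r\<close> is constant in the integration variables and is
  divided out at the very end; until then weight 1 avoids carrying it along.\<close>

definition D :: "'a set \<Rightarrow> ('a \<Rightarrow> real) \<Rightarrow> real \<Rightarrow> ennreal" where
  "D S u r = difference_energy m p S u (\<lambda>x y. 1) r"

definition nbhd :: "'a set \<Rightarrow> real \<Rightarrow> 'a set" where "nbhd S r = (\<Union>x\<in>S. ball x r)"

lemma open_nbhd [simp]: "open (nbhd S r)"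
  unfolding nbhd_def by auto

lemma nbhd_mono: "r \<le> s \<Longrightarrow> nbhd S r \<subseteq> nbhd S s"
  unfolding nbhd_def by force

lemma ennreal_inverse_V: "0 < r \<Longrightarrow> 1 / emeasure m (ball y r) = ennreal (1 / V y r)"
  using V_pos[of r y] by (simp add: emeasure_ball divide_ennreal flip: ennreal_1)

text \<open>Two-point form of the Poincare inequality: \<open>u x\<close> and \<open>u y\<close> are
  both compared with the mean, at the cost of \<open>2 powr p\<close>, and integrating over the
  absent variable gives a factor \<open>V z R\<close> twice.\<close>

lemma oscillation_on_ball:
  assumes u: "u \<in> \<F>" and "0 < R"
  shows "(\<integral>\<^sup>+y\<in>ball z R. (\<integral>\<^sup>+x\<in>ball z R. ennreal (\<bar>u x - u y\<bar> powr p) \<partial>m) \<partial>m)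
    \<le> ennreal (2 * 2 powr p * C\<^sub>P * V z R * \<Psi> R) * emeasure (\<Gamma> u) (ball z (A\<^sub>P * R))"
proof -
  define c where "c = average m (ball z R) u"
  define B where "B = ball z R"
  define F where "F = (\<lambda>y. ennreal (\<bar>u y - c\<bar> powr p))"
  define I where "I = (\<integral>\<^sup>+y\<in>B. F y \<partial>m)"
  have [measurable]: "u \<in> borel_measurable borel" using \<F>_measurable[OF u] .
  have [measurable]: "B \<in> sets borel" by (simp add: B_def)
  have [measurable]: "F \<in> borel_measurable borel" unfolding F_def by measurable
  have B: "emeasure m B = ennreal (V z R)" by (simp add: B_def emeasure_ball)
  have pw: "ennreal (\<bar>u x - u y\<bar> powr p) \<le> ennreal (2 powr p) * (F x + F y)" for x y
    using abs_powr_diff_le[of p "u x" "u y" c] p unfolding F_def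
    by (simp flip: ennreal_plus ennreal_mult)
  have inner: "(\<integral>\<^sup>+x\<in>B. ennreal (\<bar>u x - u y\<bar> powr p) \<partial>m) \<le> ennreal (2 powr p) * (I + F y * ennreal (V z R))" for y
  proof -
    have "(\<integral>\<^sup>+x\<in>B. ennreal (\<bar>u x - u y\<bar> powr p) \<partial>m)
        \<le> (\<integral>\<^sup>+x. ennreal (2 powr p) * (F x * indicator B x + F y * indicator B x) \<partial>m)"
      using pw by (intro nn_integral_mono) (auto simp: indicator_def)
    also have "\<dots> = ennreal (2 powr p) * ((\<integral>\<^sup>+x. F x * indicator B x \<partial>m) + (\<integral>\<^sup>+x. F y * indicator B x \<partial>m))"
      by (simp add: nn_integral_cmult nn_integral_add)
    finally show ?thesis by (simp add: I_def nn_integral_cmult_indicator B)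
  qed
  have "(\<integral>\<^sup>+y\<in>B. (\<integral>\<^sup>+x\<in>B. ennreal (\<bar>u x - u y\<bar> powr p) \<partial>m) \<partial>m)
      \<le> (\<integral>\<^sup>+y. ennreal (2 powr p) * (I * indicator B y + ennreal (V z R) * (F y * indicator B y)) \<partial>m)"
    using inner by (intro nn_integral_mono) (auto simp: indicator_def mult.commute)
  also have "\<dots> = ennreal (2 powr p) * ((\<integral>\<^sup>+y. I * indicator B y \<partial>m) + (\<integral>\<^sup>+y. ennreal (V z R) * (F y * indicator B y) \<partial>m))"
    by (simp add: nn_integral_cmult nn_integral_add)
  also have "(\<integral>\<^sup>+y. I * indicator B y \<partial>m) = I * ennreal (V z R)"
    by (simp add: nn_integral_cmult_indicator B)
  also have "(\<integral>\<^sup>+y. ennreal (V z R) * (F y * indicator B y) \<partial>m) = ennreal (V z R) * I"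
    unfolding I_def by (rule nn_integral_cmult) measurable
  also have "ennreal (2 powr p) * (I * ennreal (V z R) + ennreal (V z R) * I) = ennreal (2 * 2 powr p * V z R) * I"
  proof -
    have "ennreal (2 * 2 powr p * V z R)
        = ennreal (2 powr p) * ennreal (V z R) + ennreal (2 powr p) * ennreal (V z R)"
      by (simp flip: ennreal_mult ennreal_plus)
    then show ?thesis by (simp only: distrib_left distrib_right ac_simps)
  qed
  also have "\<dots> \<le> ennreal (2 * 2 powr p * V z R) * (ennreal (C\<^sub>P * \<Psi> R) * emeasure (\<Gamma> u) (ball z (A\<^sub>P * R)))"
    unfolding I_def c_def F_def B_def by (intro mult_left_mono poincare[OF assms]) simp
  also have "\<dots> = ennreal (2 * 2 powr p * C\<^sub>P * V z R * \<Psi> R) * emeasure (\<Gamma> u) (ball z (A\<^sub>P * R))"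
  proof -
    have "ennreal (2 * 2 powr p * V z R) * ennreal (C\<^sub>P * \<Psi> R) = ennreal (2 * 2 powr p * C\<^sub>P * V z R * \<Psi> R)"
      using \<Psi>_pos[OF \<open>0 < R\<close>] C\<^sub>P by (subst ennreal_mult[symmetric]) (auto simp: ac_simps)
    then show ?thesis by (simp only: mult.assoc[symmetric])
  qed
  finally show ?thesis unfolding B_def .
qed

text \<open>Instead of choosing a covering, average over the centre \<open>z\<close> of a ball of radius \<open>2 r\<close> containing \<open>x\<close> and \<open>y\<close>;
  Tonelli's theorem replaces the bounded overlap.\<close>

lemma D_upper:
  obtains C \<kappa> where "1 \<le> C" "1 \<le> \<kappa>"
    "\<And>S u r. open S \<Longrightarrow> u \<in> \<F> \<Longrightarrow> 0 < r \<Longrightarrow>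
      D S u r \<le> ennreal (C * \<Psi> r) * emeasure (\<Gamma> u) (nbhd S (\<kappa> * r))"
proof -
  \<comment> \<open>This \<open>k\<close> makes volumes at the radii \<open>2 * r\<close> and
    \<open>2 * A\<^sub>P * r\<close> comparable for centres at distance below
    \<open>2 * A\<^sub>P * r\<close>.\<close>
  obtain k where "2 * A\<^sub>P < 2 ^ k" using real_arch_pow[of 2] by auto
  then have k: "2 * A\<^sub>P \<le> 2 ^ k" by simp
  obtain C\<^sub>2 where C\<^sub>2: "1 \<le> C\<^sub>2" "\<And>r. 0 < r \<Longrightarrow> \<Psi> (2 * r) \<le> C\<^sub>2 * \<Psi> r"
    using \<Psi>_mult[of 2] by auto
  \<comment> \<open>\<open>cD ^ 4\<close> arises in \<open>step1\<close> from replacing the centre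
    \<open>y\<close> by \<open>z\<close>, the bracket in \<open>step2\<close> from
    \<open>oscillation_on_ball\<close>, and \<open>cD ^ k\<close> in \<open>step3\<close> from
    replacing \<open>z\<close> by \<open>v\<close>.\<close>
  define C where "C = cD ^ 4 * (2 * 2 powr p * C\<^sub>P) * cD ^ k"
  have C: "0 \<le> C" using cD C\<^sub>P unfolding C_def by simp
  interpret sigma_finite_measure m by (rule sigma_finite)
  interpret mm: pair_sigma_finite m m by unfold_locales
  have main: "D S u r \<le> ennreal (C * \<Psi> (2 * r)) * emeasure (\<Gamma> u) (nbhd S (3 * A\<^sub>P * r))"
    if S: "open S" and u: "u \<in> \<F>" and r: "0 < r" for S u r
  proof -
    have [measurable]: "u \<in> borel_measurable borel" using \<F>_measurable[OF u] .
    have [measurable]: "S \<in> sets borel" "nbhd S r \<in> sets borel" using S by auto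
    have [measurable_cong]: "sets (\<Gamma> u) = sets borel" using measure_sets[OF u] .
    interpret \<Gamma>: finite_measure "\<Gamma> u" by (rule measure_finite[OF u])
    interpret mG: pair_sigma_finite m "\<Gamma> u" by unfold_locales
    define f where "f = (\<lambda>x y. ennreal (\<bar>u x - u y\<bar> powr p))"
    have [measurable]: "case_prod f \<in> borel_measurable (borel \<Otimes>\<^sub>M borel)" unfolding f_def by measurable
    define G where "G = (\<lambda>y. \<integral>\<^sup>+x. f x y * (of_bool (x \<in> S) * of_bool (dist y x < r)) \<partial>m)"
    have [measurable]: "G \<in> borel_measurable borel" unfolding G_def by measurable
    define w where "w = (\<lambda>z. ennreal (cD ^ 4 / (V z (2 * r))\<^sup>2))"
    have [measurable]: "w \<in> borel_measurable borel" unfolding w_def by measurable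
    define B where "B = 2 * 2 powr p * C\<^sub>P * \<Psi> (2 * r)"
    have B: "0 \<le> B" unfolding B_def using C\<^sub>P \<Psi>_pos[of "2 * r"] r by simp
    have DG: "D S u r = (\<integral>\<^sup>+y. ennreal (1 / V y r) * G y * of_bool (y \<in> S) \<partial>m)"
      unfolding D_def difference_energy_def G_def f_def ennreal_inverse_V[OF r]
      by (intro nn_integral_cong arg_cong2[where f = "(*)"]) (auto simp: indicator_def)
    \<comment> \<open>\<open>1 / V y r\<close> is the integral of the constant
      \<open>1 / (V y r)\<^sup>2\<close> over \<open>ball y r\<close>; \<open>w z\<close> dominates
      this constant and depends on \<open>z\<close> alone, which allows the order of integration to
      be exchanged.\<close>
    have step1: "ennreal (1 / V y r) * G y * of_bool (y \<in> S)
        \<le> (\<integral>\<^sup>+z. w z * of_bool (dist z y < r) * (G y * of_bool (y \<in> S)) \<partial>m)" for y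
    proof -
      have "ennreal (1 / V y r) = ennreal (1 / (V y r)\<^sup>2) * ennreal (V y r)"
        using V_pos[OF r, of y] by (simp add: power2_eq_square flip: ennreal_mult)
      also have "\<dots> = (\<integral>\<^sup>+z. ennreal (1 / (V y r)\<^sup>2) * indicator (ball y r) z \<partial>m)"
        by (subst nn_integral_cmult_indicator) (auto simp: emeasure_ball)
      also have "\<dots> \<le> (\<integral>\<^sup>+z. w z * of_bool (dist z y < r) \<partial>m)"
      proof (rule nn_integral_mono)
        fix z
        show "ennreal (1 / (V y r)\<^sup>2) * indicator (ball y r) z \<le> w z * of_bool (dist z y < r)"
        proof (cases "dist z y < r")
          case True
          have "V z (2 * r) \<le> cD ^ 2 * V y r"
            using True r by (intro V_compare) (auto simp: dist_commute)
          then have "(V z (2 * r))\<^sup>2 \<le> (cD ^ 2 * V y r)\<^sup>2" by (intro power_mono) auto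
          then have "(V z (2 * r))\<^sup>2 \<le> cD ^ 4 * (V y r)\<^sup>2" by (simp add: power_mult_distrib)
          then have "1 / (V y r)\<^sup>2 \<le> cD ^ 4 / (V z (2 * r))\<^sup>2"
            using V_pos[OF r, of y] V_pos[of "2 * r" z] r by (simp add: field_simps)
          then show ?thesis using True unfolding w_def by (auto simp: dist_commute intro: ennreal_leI)
        qed (simp add: dist_commute)
      qed
      finally have "ennreal (1 / V y r) * (G y * of_bool (y \<in> S))
          \<le> (\<integral>\<^sup>+z. w z * of_bool (dist z y < r) \<partial>m) * (G y * of_bool (y \<in> S))"
        by (rule mult_right_mono) simp
      also have "\<dots> = (\<integral>\<^sup>+z. w z * of_bool (dist z y < r) * (G y * of_bool (y \<in> S)) \<partial>m)"
        by (rule nn_integral_multc[symmetric]) measurable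
      finally show ?thesis by (simp only: mult.assoc)
    qed
    have [measurable]: "ball z s \<in> sets borel" for z s by simp
    \<comment> \<open>For fixed \<open>z\<close>, the point \<open>y\<close> is within
      \<open>r\<close> of \<open>z\<close> and \<open>x\<close> within \<open>r\<close> of
      \<open>y\<close>, so both lie in \<open>ball z (2 * r)\<close>, where the Poincare inequality
      applies. The energy of the ball is written as an integral over \<open>v\<close> for the second
      exchange.\<close>
    have step2: "(\<integral>\<^sup>+y. w z * of_bool (dist z y < r) * (G y * of_bool (y \<in> S)) \<partial>m)
        \<le> ennreal (cD ^ 4 * B / V z (2 * r)) * of_bool (z \<in> nbhd S r) *
            (\<integral>\<^sup>+v. of_bool (dist z v < 2 * A\<^sub>P * r) \<partial>\<Gamma> u)" for z
    proof -
      have "w z * of_bool (dist z y < r) * (G y * of_bool (y \<in> S))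
          \<le> w z * of_bool (z \<in> nbhd S r) *
             ((\<integral>\<^sup>+x\<in>ball z (2 * r). ennreal (\<bar>u x - u y\<bar> powr p) \<partial>m) * indicator (ball z (2 * r)) y)" for y
      proof (cases "dist z y < r \<and> y \<in> S")
        case True
        then have z: "z \<in> nbhd S r" unfolding nbhd_def by (auto simp: dist_commute)
        have "G y \<le> (\<integral>\<^sup>+x\<in>ball z (2 * r). ennreal (\<bar>u x - u y\<bar> powr p) \<partial>m)"
          unfolding G_def f_def
        proof (rule nn_integral_mono)
          fix x
          have "dist z x < 2 * r" if "dist y x < r" using that True dist_triangle[of z x y] by simp
          then show "ennreal (\<bar>u x - u y\<bar> powr p) * (of_bool (x \<in> S) * of_bool (dist y x < r))
              \<le> ennreal (\<bar>u x - u y\<bar> powr p) * indicator (ball z (2 * r)) x"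
            by (auto simp: indicator_def)
        qed
        then show ?thesis using True z r by (auto intro!: mult_left_mono)
      qed auto
      then have "(\<integral>\<^sup>+y. w z * of_bool (dist z y < r) * (G y * of_bool (y \<in> S)) \<partial>m)
          \<le> (\<integral>\<^sup>+y. w z * of_bool (z \<in> nbhd S r) *
             ((\<integral>\<^sup>+x\<in>ball z (2 * r). ennreal (\<bar>u x - u y\<bar> powr p) \<partial>m) * indicator (ball z (2 * r)) y) \<partial>m)"
        by (intro nn_integral_mono)
      also have "\<dots> = w z * of_bool (z \<in> nbhd S r) *
             (\<integral>\<^sup>+y\<in>ball z (2 * r). (\<integral>\<^sup>+x\<in>ball z (2 * r). ennreal (\<bar>u x - u y\<bar> powr p) \<partial>m) \<partial>m)"
        by (intro nn_integral_cmult) measurable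
      also have "\<dots> \<le> w z * of_bool (z \<in> nbhd S r) * (ennreal (2 * 2 powr p * C\<^sub>P * V z (2 * r) * \<Psi> (2 * r))
             * emeasure (\<Gamma> u) (ball z (A\<^sub>P * (2 * r))))"
        using r by (intro mult_left_mono oscillation_on_ball[OF u]) auto
      also have "\<dots> = (w z * ennreal (B * V z (2 * r))) * of_bool (z \<in> nbhd S r)
             * emeasure (\<Gamma> u) (ball z (2 * A\<^sub>P * r))"
        by (simp add: B_def ac_simps)
      also have "w z * ennreal (B * V z (2 * r)) = ennreal (cD ^ 4 * B / V z (2 * r))"
        using V_pos[of "2 * r" z] r B unfolding w_def
        by (simp add: power2_eq_square flip: ennreal_mult)
      also have "emeasure (\<Gamma> u) (ball z (2 * A\<^sub>P * r)) = (\<integral>\<^sup>+v. indicator (ball z (2 * A\<^sub>P * r)) v \<partial>\<Gamma> u)"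
        by (simp add: measure_sets[OF u])
      also have "\<dots> = (\<integral>\<^sup>+v. of_bool (dist z v < 2 * A\<^sub>P * r) \<partial>\<Gamma> u)"
        by (intro nn_integral_cong) (auto simp: indicator_def)
      finally show ?thesis .
    qed
    \<comment> \<open>The points \<open>z\<close> that see a given \<open>v\<close> fill at most
      \<open>ball v (2 * A\<^sub>P * r)\<close>, whose volume cancels against
      \<open>V z (2 * r)\<close>. Such a \<open>v\<close> is within
      \<open>r + 2 * A\<^sub>P * r\<close> of \<open>S\<close>, hence within
      \<open>3 * A\<^sub>P * r\<close>.\<close>
    have step3: "(\<integral>\<^sup>+z. ennreal (cD ^ 4 * B / V z (2 * r)) * of_bool (z \<in> nbhd S r) *
          of_bool (dist z v < 2 * A\<^sub>P * r) \<partial>m) \<le> ennreal (C * \<Psi> (2 * r)) * indicator (nbhd S (3 * A\<^sub>P * r)) v" for v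
    proof -
      have r': "0 < 2 * A\<^sub>P * r" using A\<^sub>P r by simp
      have "(\<integral>\<^sup>+z. ennreal (cD ^ 4 * B / V z (2 * r)) * of_bool (z \<in> nbhd S r) * of_bool (dist z v < 2 * A\<^sub>P * r) \<partial>m)
          \<le> (\<integral>\<^sup>+z. ennreal (cD ^ 4 * B * cD ^ k / V v (2 * A\<^sub>P * r)) * indicator (nbhd S (3 * A\<^sub>P * r)) v
               * indicator (ball v (2 * A\<^sub>P * r)) z \<partial>m)"
      proof (rule nn_integral_mono)
        fix z
        show "ennreal (cD ^ 4 * B / V z (2 * r)) * of_bool (z \<in> nbhd S r) * of_bool (dist z v < 2 * A\<^sub>P * r)
          \<le> ennreal (cD ^ 4 * B * cD ^ k / V v (2 * A\<^sub>P * r)) * indicator (nbhd S (3 * A\<^sub>P * r)) v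
               * indicator (ball v (2 * A\<^sub>P * r)) z"
        proof (cases "z \<in> nbhd S r \<and> dist z v < 2 * A\<^sub>P * r")
          case True
          then obtain x where x: "x \<in> S" "dist x z < r" unfolding nbhd_def by auto
          have "r \<le> A\<^sub>P * r" using A\<^sub>P r by simp
          then have "dist x v < 3 * A\<^sub>P * r" using x True dist_triangle[of x v z] by simp
          then have v: "v \<in> nbhd S (3 * A\<^sub>P * r)" using x unfolding nbhd_def by auto
          have "2 * A\<^sub>P * (2 * r) \<le> 2 ^ k * (2 * r)" using k r by (intro mult_right_mono) auto
          then have "dist z v + 2 * A\<^sub>P * r \<le> 2 ^ k * (2 * r)" using True by linarith
          then have "V v (2 * A\<^sub>P * r) \<le> cD ^ k * V z (2 * r)"
            using r by (intro V_compare) auto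
          then have "1 / V z (2 * r) \<le> cD ^ k / V v (2 * A\<^sub>P * r)"
            using V_pos[of "2 * r" z] V_pos[OF r', of v] r by (simp add: field_simps)
          then have "cD ^ 4 * B * (1 / V z (2 * r)) \<le> cD ^ 4 * B * (cD ^ k / V v (2 * A\<^sub>P * r))"
            using B cD by (intro mult_left_mono) auto
          then show ?thesis using True v by (simp add: dist_commute ennreal_leI)
        qed auto
      qed
      also have "\<dots> = ennreal (cD ^ 4 * B * cD ^ k / V v (2 * A\<^sub>P * r)) * indicator (nbhd S (3 * A\<^sub>P * r)) v
               * ennreal (V v (2 * A\<^sub>P * r))"
        by (subst nn_integral_cmult_indicator) (auto simp: emeasure_ball)
      also have "\<dots> = (ennreal (cD ^ 4 * B * cD ^ k / V v (2 * A\<^sub>P * r)) * ennreal (V v (2 * A\<^sub>P * r)))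
               * indicator (nbhd S (3 * A\<^sub>P * r)) v"
        by (simp add: ac_simps)
      also have "ennreal (cD ^ 4 * B * cD ^ k / V v (2 * A\<^sub>P * r)) * ennreal (V v (2 * A\<^sub>P * r)) = ennreal (C * \<Psi> (2 * r))"
      proof -
        have "0 \<le> cD ^ 4 * B * cD ^ k / V v (2 * A\<^sub>P * r)" using B cD by (intro divide_nonneg_nonneg mult_nonneg_nonneg) auto
        then have "ennreal (cD ^ 4 * B * cD ^ k / V v (2 * A\<^sub>P * r)) * ennreal (V v (2 * A\<^sub>P * r))
            = ennreal (cD ^ 4 * B * cD ^ k / V v (2 * A\<^sub>P * r) * V v (2 * A\<^sub>P * r))"
          by (simp only: ennreal_mult V_nonneg)
        also have "\<dots> = ennreal (C * \<Psi> (2 * r))"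
          using V_pos[OF r', of v] unfolding C_def B_def by (simp add: ac_simps)
        finally show ?thesis .
      qed
      finally show ?thesis .
    qed
    have "D S u r \<le> (\<integral>\<^sup>+y. \<integral>\<^sup>+z. w z * of_bool (dist z y < r) * (G y * of_bool (y \<in> S)) \<partial>m \<partial>m)"
      unfolding DG by (intro nn_integral_mono step1)
    also have "\<dots> = (\<integral>\<^sup>+z. \<integral>\<^sup>+y. w z * of_bool (dist z y < r) * (G y * of_bool (y \<in> S)) \<partial>m \<partial>m)"
      by (rule mm.Fubini') measurable
    also have "\<dots> \<le> (\<integral>\<^sup>+z. ennreal (cD ^ 4 * B / V z (2 * r)) * of_bool (z \<in> nbhd S r) *
            (\<integral>\<^sup>+v. of_bool (dist z v < 2 * A\<^sub>P * r) \<partial>\<Gamma> u) \<partial>m)"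
      by (intro nn_integral_mono step2)
    also have "\<dots> = (\<integral>\<^sup>+z. \<integral>\<^sup>+v. ennreal (cD ^ 4 * B / V z (2 * r)) * of_bool (z \<in> nbhd S r) *
            of_bool (dist z v < 2 * A\<^sub>P * r) \<partial>\<Gamma> u \<partial>m)"
      by (intro nn_integral_cong nn_integral_cmult[symmetric]) measurable
    also have "\<dots> = (\<integral>\<^sup>+v. \<integral>\<^sup>+z. ennreal (cD ^ 4 * B / V z (2 * r)) * of_bool (z \<in> nbhd S r) *
            of_bool (dist z v < 2 * A\<^sub>P * r) \<partial>m \<partial>\<Gamma> u)"
      by (rule mG.Fubini'[symmetric]) measurable
    also have "\<dots> \<le> (\<integral>\<^sup>+v. ennreal (C * \<Psi> (2 * r)) * indicator (nbhd S (3 * A\<^sub>P * r)) v \<partial>\<Gamma> u)"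
      by (intro nn_integral_mono step3)
    also have "\<dots> = ennreal (C * \<Psi> (2 * r)) * emeasure (\<Gamma> u) (nbhd S (3 * A\<^sub>P * r))"
      by (rule nn_integral_cmult_indicator) (auto simp: measure_sets[OF u])
    finally show ?thesis .
  qed
  show ?thesis
  proof (rule that[of "max 1 (C * C\<^sub>2)" "3 * A\<^sub>P"])
    fix S :: "'a set" and u r assume S: "open S" and u: "u \<in> \<F>" and r: "(0::real) < r"
    have "C * \<Psi> (2 * r) \<le> max 1 (C * C\<^sub>2) * \<Psi> r"
    proof -
      have "C * \<Psi> (2 * r) \<le> C * (C\<^sub>2 * \<Psi> r)" using C C\<^sub>2(2)[OF r] by (rule mult_left_mono[rotated])
      also have "\<dots> \<le> max 1 (C * C\<^sub>2) * \<Psi> r"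
        using \<Psi>_pos[OF r] by (simp add: mult.assoc[symmetric] mult_right_mono)
      finally show ?thesis .
    qed
    then show "D S u r \<le> ennreal (max 1 (C * C\<^sub>2) * \<Psi> r) * emeasure (\<Gamma> u) (nbhd S (3 * A\<^sub>P * r))"
      using main[OF S u r] by (meson ennreal_leI mult_right_mono order_trans zero_le)
  qed (use A\<^sub>P in auto)
qed

section \<open>Dyadic summation for the weight that depends on the distance\<close>

text \<open>Iterated reverse doubling. It is available for doubled radii up to \<open>r / 4\<close>,
  so the first two halvings gain nothing; the factor \<open>\<theta>\<^sup>2\<close> pays for
  them.\<close>

lemma V_decay:
  assumes r: "0 < r" and ne: "ball y (r / 4) \<noteq> UNIV"
  shows "V y (r / 2 ^ k) * \<theta>\<^sup>2 \<le> \<theta> ^ k * V y r"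
proof -
  have mono: "V y (r / 2 ^ j) \<le> V y r" for j
    using r by (intro V_mono subset_ball) (simp add: divide_le_eq)
  show ?thesis
  proof (cases "k < 2")
    case True
    have "\<theta>\<^sup>2 \<le> \<theta> ^ k" using True \<theta> by (intro power_decreasing) auto
    then have "V y (r / 2 ^ k) * \<theta>\<^sup>2 \<le> V y r * \<theta> ^ k" using mono \<theta> by (intro mult_mono) auto
    then show ?thesis by (simp add: mult.commute)
  next
    case False
    have "V y (r / 2 ^ (j + 2)) \<le> \<theta> ^ j * V y r" for j
    proof (induction j)
      case (Suc j)
      have eq: "2 * (r / 2 ^ (Suc j + 2)) = r / 2 ^ (j + 2)" by simp
      have "ball y (r / 2 ^ (j + 2)) \<subseteq> ball y (r / 4)"
        using r by (intro subset_ball) (simp add: divide_le_eq)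
      then have "ball y (2 * (r / 2 ^ (Suc j + 2))) \<noteq> UNIV" using ne unfolding eq by blast
      then have "V y (r / 2 ^ (Suc j + 2)) \<le> \<theta> * V y (r / 2 ^ (j + 2))"
        using reverse_doubling[of "r / 2 ^ (Suc j + 2)" y] r unfolding eq by simp
      also have "\<dots> \<le> \<theta> * (\<theta> ^ j * V y r)" using Suc \<theta> by (intro mult_left_mono) auto
      finally show ?case by (simp add: mult.assoc)
    qed (use mono[of 2] in simp)
    moreover obtain j where j: "k = j + 2" using False by (metis add.commute le_Suc_ex not_less)
    ultimately have "V y (r / 2 ^ k) * \<theta>\<^sup>2 \<le> (\<theta> ^ j * V y r) * \<theta>\<^sup>2"
      by (intro mult_right_mono) auto
    also have "\<dots> = \<theta> ^ k * V y r" unfolding j by (simp only: power_add ac_simps)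
    finally show ?thesis .
  qed
qed

lemma annulus_scale:
  assumes "0 < d" "d < (r::real)"
  obtains k where "r / 2 ^ Suc k \<le> d" "d < r / 2 ^ k"
proof -
  obtain n where "r / d < 2 ^ n" using real_arch_pow[of 2 "r / d"] by auto
  then have n: "r / 2 ^ n \<le> d" using assms by (simp add: field_simps)
  define l where "l = (LEAST n. r / 2 ^ n \<le> d)"
  have l: "r / 2 ^ l \<le> d" unfolding l_def using n by (rule LeastI[where P = "\<lambda>n. r / 2 ^ n \<le> d"])
  then have "l \<noteq> 0" using assms by (intro notI) simp
  then obtain k where k: "l = Suc k" using not0_implies_Suc by blast
  have "\<not> r / 2 ^ k \<le> d" using not_less_Least[of k "\<lambda>n. r / 2 ^ n \<le> d"] k unfolding l_def by simp
  then show ?thesis using that[of k] l k by simp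
qed

text \<open>On the annulus between the radii \<open>\<rho> (Suc k)\<close> and
  \<open>\<rho> k\<close> the weight is at least \<open>\<Psi> (\<rho> (Suc k))\<close>, so
  \<open>D\<close> at scale \<open>\<rho> k\<close> controls it. Each scale alone contributes a
  bounded multiple of the energy; the series converges because the functional divides by the volume
  of the large ball, and \<open>V y (\<rho> k) / V y r\<close> decays geometrically.\<close>

lemma weighted_upper_aux:
  obtains C \<kappa> where "1 \<le> C" "1 \<le> \<kappa>"
    "\<And>S u r. open S \<Longrightarrow> u \<in> \<F> \<Longrightarrow> 0 < r \<Longrightarrow> (\<And>y :: 'a. ball y (r / 4) \<noteq> UNIV) \<Longrightarrow>
      difference_energy m p S u (\<lambda>x y. \<Psi> (dist x y)) r \<le> ennreal C * emeasure (\<Gamma> u) (nbhd S (\<kappa> * r))"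
proof -
  obtain C \<kappa> where C: "1 \<le> C" "1 \<le> \<kappa>" and upper: "\<And>S u r. open S \<Longrightarrow> u \<in> \<F> \<Longrightarrow> 0 < r \<Longrightarrow>
      D S u r \<le> ennreal (C * \<Psi> r) * emeasure (\<Gamma> u) (nbhd S (\<kappa> * r))" using D_upper by blast
  obtain C\<^sub>2 where C\<^sub>2: "1 \<le> C\<^sub>2" "\<And>r. 0 < r \<Longrightarrow> \<Psi> (2 * r) \<le> C\<^sub>2 * \<Psi> r"
    using \<Psi>_mult[of 2] by auto
  define K where "K = C\<^sub>2 * C / \<theta>\<^sup>2"
  have K: "0 \<le> K" unfolding K_def using C C\<^sub>2 by simp
  interpret sigma_finite_measure m by (rule sigma_finite)
  have main: "difference_energy m p S u (\<lambda>x y. \<Psi> (dist x y)) r \<le> ennreal (K / (1 - \<theta>)) * emeasure (\<Gamma> u) (nbhd S (\<kappa> * r))"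
    if S: "open S" and u: "u \<in> \<F>" and r: "0 < r" and ne: "\<And>y :: 'a. ball y (r / 4) \<noteq> UNIV" for S u r
  proof -
    have [measurable]: "u \<in> borel_measurable borel" using \<F>_measurable[OF u] .
    have [measurable]: "S \<in> sets borel" using S by auto
    define f where "f = (\<lambda>x y. ennreal (\<bar>u x - u y\<bar> powr p))"
    have [measurable]: "case_prod f \<in> borel_measurable (borel \<Otimes>\<^sub>M borel)" unfolding f_def by measurable
    define G where "G = (\<lambda>s y. \<integral>\<^sup>+x. f x y * (of_bool (x \<in> S) * of_bool (dist y x < s)) \<partial>m)"
    have [measurable]: "G s \<in> borel_measurable borel" for s unfolding G_def by measurable
    define \<rho> where "\<rho> = (\<lambda>k. r / 2 ^ k)"
    have \<rho>: "0 < \<rho> k" "\<rho> k = 2 * \<rho> (Suc k)" "\<rho> k \<le> r" for k using r unfolding \<rho>_def by (auto simp: divide_le_eq)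
    \<comment> \<open>The weight of scale \<open>k\<close> after the normalization is changed from
      \<open>V y r\<close> to \<open>V y (\<rho> k)\<close>; the powers of \<open>\<theta>\<close>
      are those of \<open>V_decay\<close>.\<close>
    define a where "a = (\<lambda>k. \<theta> ^ k / \<theta>\<^sup>2 / \<Psi> (\<rho> (Suc k)))"
    have a: "0 \<le> a k" for k unfolding a_def using \<theta> \<Psi>_pos[OF \<rho>(1)[of "Suc k"]] by simp
    have DG: "D S u s = (\<integral>\<^sup>+y. ennreal (1 / V y s) * G s y * of_bool (y \<in> S) \<partial>m)" if "0 < s" for s
      unfolding D_def difference_energy_def G_def f_def ennreal_inverse_V[OF that]
      by (intro nn_integral_cong arg_cong2[where f = "(*)"]) (auto simp: indicator_def)
    \<comment> \<open>One suitable term of the series suffices. On the diagonal the left side is 0,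
      since \<open>0 powr p = 0\<close>.\<close>
    have pw: "ennreal (\<bar>u x - u y\<bar> powr p / \<Psi> (dist x y)) * indicator (S \<inter> ball y r) x
        \<le> (\<Sum>k. ennreal (1 / \<Psi> (\<rho> (Suc k))) * (f x y * (of_bool (x \<in> S) * of_bool (dist y x < \<rho> k))))" for x y
    proof (cases "x \<in> S \<and> dist y x < r \<and> x \<noteq> y")
      case True
      then obtain k where k: "\<rho> (Suc k) \<le> dist y x" "dist y x < \<rho> k"
        using annulus_scale[of "dist y x" r] unfolding \<rho>_def by auto
      let ?h = "\<lambda>k. ennreal (1 / \<Psi> (\<rho> (Suc k))) * (f x y * (of_bool (x \<in> S) * of_bool (dist y x < \<rho> k)))"
      have "\<bar>u x - u y\<bar> powr p / \<Psi> (dist x y) \<le> \<bar>u x - u y\<bar> powr p / \<Psi> (\<rho> (Suc k))"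
        using \<Psi>_mono[OF \<rho>(1) k(1)] \<Psi>_pos[OF \<rho>(1)[of "Suc k"]] True \<Psi>_pos[of "dist x y"]
        by (intro divide_left_mono) (auto simp: dist_commute)
      then have "ennreal (\<bar>u x - u y\<bar> powr p / \<Psi> (dist x y)) * indicator (S \<inter> ball y r) x \<le> ?h k"
        using True k \<Psi>_pos[OF \<rho>(1)[of "Suc k"]] unfolding f_def
        by (auto simp flip: ennreal_mult intro!: ennreal_leI)
      also have "\<dots> = sum ?h {k}" by simp
      also have "\<dots> \<le> (\<Sum>k. ?h k)" by (intro sum_le_suminf) auto
      finally show ?thesis .
    qed (auto simp: indicator_def)
    have inner: "1 / emeasure m (ball y r) *
          (\<integral>\<^sup>+x\<in>S \<inter> ball y r. ennreal (\<bar>u x - u y\<bar> powr p / \<Psi> (dist x y)) \<partial>m) * indicator S y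
        \<le> (\<Sum>k. ennreal (a k) * (ennreal (1 / V y (\<rho> k)) * G (\<rho> k) y * of_bool (y \<in> S)))" for y
    proof -
      have "(\<integral>\<^sup>+x\<in>S \<inter> ball y r. ennreal (\<bar>u x - u y\<bar> powr p / \<Psi> (dist x y)) \<partial>m)
          \<le> (\<integral>\<^sup>+x. (\<Sum>k. ennreal (1 / \<Psi> (\<rho> (Suc k))) * (f x y * (of_bool (x \<in> S) * of_bool (dist y x < \<rho> k)))) \<partial>m)"
        by (intro nn_integral_mono pw)
      also have "\<dots> = (\<Sum>k. ennreal (1 / \<Psi> (\<rho> (Suc k))) * G (\<rho> k) y)"
        unfolding G_def
        by (subst nn_integral_suminf, measurable, intro suminf_cong nn_integral_cmult, measurable)
      finally have "ennreal (1 / V y r) *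
          (\<integral>\<^sup>+x\<in>S \<inter> ball y r. ennreal (\<bar>u x - u y\<bar> powr p / \<Psi> (dist x y)) \<partial>m)
          \<le> ennreal (1 / V y r) * (\<Sum>k. ennreal (1 / \<Psi> (\<rho> (Suc k))) * G (\<rho> k) y)"
        by (rule mult_left_mono) simp
      also have "\<dots> = (\<Sum>k. ennreal (1 / V y r) * (ennreal (1 / \<Psi> (\<rho> (Suc k))) * G (\<rho> k) y))"
        by simp
      also have "\<dots> \<le> (\<Sum>k. ennreal (a k) * (ennreal (1 / V y (\<rho> k)) * G (\<rho> k) y))"
      proof (rule suminf_le)
        fix k
        have "V y (\<rho> k) * \<theta>\<^sup>2 \<le> \<theta> ^ k * V y r" unfolding \<rho>_def by (rule V_decay[OF r ne])
        then have "1 / V y r \<le> \<theta> ^ k / \<theta>\<^sup>2 * (1 / V y (\<rho> k))"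
          using V_pos[OF r, of y] V_pos[OF \<rho>(1), of y k] \<theta> by (simp add: field_simps)
        then have "1 / V y r * (1 / \<Psi> (\<rho> (Suc k))) \<le> \<theta> ^ k / \<theta>\<^sup>2 * (1 / V y (\<rho> k)) * (1 / \<Psi> (\<rho> (Suc k)))"
          using \<Psi>_pos[OF \<rho>(1)[of "Suc k"]] by (intro mult_right_mono) auto
        also have "\<dots> = a k * (1 / V y (\<rho> k))" unfolding a_def by simp
        finally have "ennreal (1 / V y r * (1 / \<Psi> (\<rho> (Suc k)))) * G (\<rho> k) y \<le> ennreal (a k * (1 / V y (\<rho> k))) * G (\<rho> k) y"
          by (intro mult_right_mono ennreal_leI) auto
        then show "ennreal (1 / V y r) * (ennreal (1 / \<Psi> (\<rho> (Suc k))) * G (\<rho> k) y)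
            \<le> ennreal (a k) * (ennreal (1 / V y (\<rho> k)) * G (\<rho> k) y)"
          using a[of k] \<Psi>_pos[OF \<rho>(1)[of "Suc k"]] V_nonneg[of y r] V_nonneg[of y "\<rho> k"]
          by (simp only: ennreal_mult divide_nonneg_nonneg zero_le_one less_imp_le mult.assoc)
      qed auto
      finally show ?thesis
        by (cases "y \<in> S") (simp_all add: ennreal_inverse_V[OF r])
    qed
    \<comment> \<open>The factor \<open>\<Psi> (\<rho> k)\<close> of the upper bound cancels against
      the denominator of \<open>a k\<close> up to the doubling constant of \<open>\<Psi>\<close>,
      leaving a geometric term.\<close>
    have bound: "ennreal (a k) * D S u (\<rho> k) \<le> ennreal (K * \<theta> ^ k) * emeasure (\<Gamma> u) (nbhd S (\<kappa> * r))" for k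
    proof -
      have "a k * (C * \<Psi> (\<rho> k)) \<le> a k * (C * (C\<^sub>2 * \<Psi> (\<rho> (Suc k))))"
        using C\<^sub>2(2)[OF \<rho>(1)[of "Suc k"]] \<rho>(2)[of k] C a by (intro mult_left_mono) auto
      also have "\<dots> = K * \<theta> ^ k" unfolding a_def K_def using \<Psi>_pos[OF \<rho>(1)[of "Suc k"]] by simp
      finally have le: "a k * (C * \<Psi> (\<rho> k)) \<le> K * \<theta> ^ k" .
      have "\<kappa> * \<rho> k \<le> \<kappa> * r" using C(2) \<rho>(3) by (intro mult_left_mono) auto
      then have "emeasure (\<Gamma> u) (nbhd S (\<kappa> * \<rho> k)) \<le> emeasure (\<Gamma> u) (nbhd S (\<kappa> * r))"
        by (intro emeasure_mono nbhd_mono) (auto simp: measure_sets[OF u])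
      then have "D S u (\<rho> k) \<le> ennreal (C * \<Psi> (\<rho> k)) * emeasure (\<Gamma> u) (nbhd S (\<kappa> * r))"
        using upper[OF S u \<rho>(1)[of k]] by (meson mult_left_mono order_trans zero_le)
      then have "ennreal (a k) * D S u (\<rho> k) \<le> ennreal (a k) * (ennreal (C * \<Psi> (\<rho> k)) * emeasure (\<Gamma> u) (nbhd S (\<kappa> * r)))"
        by (rule mult_left_mono) simp
      also have "\<dots> = ennreal (a k * (C * \<Psi> (\<rho> k))) * emeasure (\<Gamma> u) (nbhd S (\<kappa> * r))"
        using a[of k] C \<Psi>_pos[OF \<rho>(1)[of k]] by (subst ennreal_mult) (auto simp: mult.assoc)
      also have "\<dots> \<le> ennreal (K * \<theta> ^ k) * emeasure (\<Gamma> u) (nbhd S (\<kappa> * r))"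
        using le by (intro mult_right_mono ennreal_leI) auto
      finally show ?thesis .
    qed
    have "difference_energy m p S u (\<lambda>x y. \<Psi> (dist x y)) r
        \<le> (\<integral>\<^sup>+y. (\<Sum>k. ennreal (a k) * (ennreal (1 / V y (\<rho> k)) * G (\<rho> k) y * of_bool (y \<in> S))) \<partial>m)"
      unfolding difference_energy_def by (intro nn_integral_mono inner)
    also have "\<dots> = (\<Sum>k. ennreal (a k) * D S u (\<rho> k))"
      unfolding DG[OF \<rho>(1)]
      by (subst nn_integral_suminf, measurable, intro suminf_cong nn_integral_cmult, measurable)
    also have "\<dots> \<le> (\<Sum>k. ennreal (K * \<theta> ^ k) * emeasure (\<Gamma> u) (nbhd S (\<kappa> * r)))"
      by (intro suminf_le bound) auto
    also have "\<dots> = (\<Sum>k. ennreal (K * \<theta> ^ k)) * emeasure (\<Gamma> u) (nbhd S (\<kappa> * r))"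
      by simp
    also have "(\<Sum>k. ennreal (K * \<theta> ^ k)) = ennreal (K / (1 - \<theta>))"
    proof (rule suminf_ennreal_eq)
      show "(\<lambda>k. K * \<theta> ^ k) sums (K / (1 - \<theta>))"
        using sums_mult[OF geometric_sums[of \<theta>], of K] \<theta> by simp
    qed (use K \<theta> in auto)
    finally show ?thesis .
  qed
  show ?thesis
  proof (rule that[of "max 1 (K / (1 - \<theta>))" \<kappa>])
    fix S :: "'a set" and u r assume *: "open S" "u \<in> \<F>" "(0::real) < r" "\<And>y :: 'a. ball y (r / 4) \<noteq> UNIV"
    have "ennreal (K / (1 - \<theta>)) * emeasure (\<Gamma> u) (nbhd S (\<kappa> * r))
        \<le> ennreal (max 1 (K / (1 - \<theta>))) * emeasure (\<Gamma> u) (nbhd S (\<kappa> * r))"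
      by (intro mult_right_mono ennreal_leI) auto
    then show "difference_energy m p S u (\<lambda>x y. \<Psi> (dist x y)) r
        \<le> ennreal (max 1 (K / (1 - \<theta>))) * emeasure (\<Gamma> u) (nbhd S (\<kappa> * r))"
      using main[OF *] by (rule order_trans[rotated])
  qed (use C in auto)
qed

text \<open>Once a ball exhausts the space, enlarging its radius has no effect; hence large radii reduce to radii
  \<open>r\<close> with \<open>ball y (r / 4) \<noteq> UNIV\<close>.\<close>

lemma weighted_upper:
  obtains C \<kappa> r\<^sub>0 where "1 \<le> C" "1 \<le> \<kappa>" "0 < r\<^sub>0"
    "\<And>S u r. open S \<Longrightarrow> u \<in> \<F> \<Longrightarrow> 0 < r \<Longrightarrow> r < r\<^sub>0 \<Longrightarrow>
      difference_energy m p S u (\<lambda>x y. \<Psi> (dist x y)) r \<le> ennreal C * emeasure (\<Gamma> u) (nbhd S (\<kappa> * r))"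
    "\<And>u r. u \<in> \<F> \<Longrightarrow> 0 < r \<Longrightarrow>
      difference_energy m p UNIV u (\<lambda>x y. \<Psi> (dist x y)) r \<le> ennreal C * ennreal (\<E> u)"
proof -
  obtain C \<kappa> where C: "1 \<le> C" "1 \<le> \<kappa>"
    and upper: "\<And>S u r. open S \<Longrightarrow> u \<in> \<F> \<Longrightarrow> 0 < r \<Longrightarrow> (\<And>y :: 'a. ball y (r / 4) \<noteq> UNIV) \<Longrightarrow>
      difference_energy m p S u (\<lambda>x y. \<Psi> (dist x y)) r \<le> ennreal C * emeasure (\<Gamma> u) (nbhd S (\<kappa> * r))"
    using weighted_upper_aux by blast
  obtain a b :: 'a where ab: "a \<noteq> b" using two_points by blast
  \<comment> \<open>If such a ball were the whole space, all distances would be below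
    \<open>r / 2\<close>; so the distance of two fixed points serves as
    \<open>r\<^sub>0\<close>.\<close>
  have ne: "ball y (r / 4) \<noteq> UNIV" if "r \<le> dist a b" for y :: 'a and r
  proof
    assume eq: "ball y (r / 4) = UNIV"
    have "dist y a < r / 4" "dist y b < r / 4" using eq by (metis UNIV_I mem_ball)+
    then show False using dist_triangle3[of a b y] that zero_le_dist[of a b] by linarith
  qed
  have large: "difference_energy m p UNIV u (\<lambda>x y. \<Psi> (dist x y)) r \<le> ennreal C * ennreal (\<E> u)"
    if u: "u \<in> \<F>" and r: "0 < r" for u r
  proof -
    have *: "difference_energy m p UNIV u (\<lambda>x y. \<Psi> (dist x y)) s \<le> ennreal C * ennreal (\<E> u)"
      if "0 < s" "\<And>y :: 'a. ball y (s / 4) \<noteq> UNIV" for s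
    proof -
      have "emeasure (\<Gamma> u) (nbhd UNIV (\<kappa> * s)) \<le> ennreal (\<E> u)"
        using measure_\<Gamma>_le[OF u, of "nbhd UNIV (\<kappa> * s)"] by (simp add: emeasure_\<Gamma>[OF u] ennreal_leI)
      then have "ennreal C * emeasure (\<Gamma> u) (nbhd UNIV (\<kappa> * s)) \<le> ennreal C * ennreal (\<E> u)"
        by (rule mult_left_mono) simp
      then show ?thesis using upper[OF open_UNIV u that] by (rule order_trans[rotated])
    qed
    let ?P = "\<lambda>n. \<forall>y :: 'a. ball y (r / 2 ^ n / 4) \<noteq> UNIV"
    obtain n where "r / dist a b < 2 ^ n" using real_arch_pow[of 2] by auto
    then have "r / 2 ^ n \<le> dist a b" using ab by (simp add: field_simps)
    then have Pn: "?P n" using ne by blast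
    define l where "l = (LEAST n. ?P n)"
    have l: "?P l" unfolding l_def using Pn by (rule LeastI[where P = ?P])
    show ?thesis
    proof (cases l)
      case 0
      then show ?thesis using l r by (intro *) auto
    next
      case (Suc k)
      then have "\<not> ?P k" using not_less_Least[of k ?P] unfolding l_def by simp
      then obtain y\<^sub>0 :: 'a where y\<^sub>0: "ball y\<^sub>0 (r / 2 ^ k / 4) = UNIV" by blast
      \<comment> \<open>By minimality of \<open>l\<close> some ball of radius
        \<open>r / 2 ^ k / 4\<close> is the whole space. Thus all distances are below
        \<open>r / 2 ^ l\<close>, and every ball of at least this radius is the whole space; the
        functionals at \<open>r\<close> and \<open>r / 2 ^ l\<close> coincide because the weight
        does not involve the radius.\<close>
      have full: "ball y s = UNIV" if "r / 2 ^ l \<le> s" for y :: 'a and s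
      proof -
        have "dist y z < s" for z
        proof -
          have "dist y\<^sub>0 y < r / 2 ^ k / 4" "dist y\<^sub>0 z < r / 2 ^ k / 4" using y\<^sub>0 by (metis UNIV_I mem_ball)+
          moreover have "r / 2 ^ k / 4 + r / 2 ^ k / 4 = r / 2 ^ l" using Suc by simp
          ultimately show ?thesis using dist_triangle3[of y z y\<^sub>0] that by linarith
        qed
        then show ?thesis by auto
      qed
      have "r / 2 ^ l \<le> r" using r by (simp add: divide_le_eq)
      then have "difference_energy m p UNIV u (\<lambda>x y. \<Psi> (dist x y)) r
          = difference_energy m p UNIV u (\<lambda>x y. \<Psi> (dist x y)) (r / 2 ^ l)"
        unfolding difference_energy_def by (simp add: full)
      then show ?thesis using *[of "r / 2 ^ l"] l r by simp
    qed
  qed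
  show ?thesis
    by (rule that[OF C, of "dist a b"]) (use ab upper ne large in auto)
qed

subsection \<open>Continuous cutoff functions\<close>

text \<open>The factor 2 leaves room above an infimum that may not be attained; the strict
  inequality is the tolerance that Mazur's lemma consumes later. Truncation to values between 0 and
  1 keeps the boundary values and does not raise the energy.\<close>

lemma capacity_potential:
  assumes "0 < R" "ennreal R < ediam (UNIV :: 'a set) / ennreal A\<^sub>2"
  obtains u where "u \<in> \<F>" "\<E> u < 2 * C\<^sub>c * V x R / \<Psi> R"
    "AE y in m. 0 \<le> u y \<and> u y \<le> 1 \<and> (y \<in> ball x R \<longrightarrow> u y = 1) \<and> (y \<notin> ball x (A\<^sub>1 * R) \<longrightarrow> u y = 0)"
proof -
  note pos = V_pos[OF assms(1), of x] \<Psi>_pos[OF assms(1)]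
  have "ennreal C\<^sub>c * emeasure m (ball x R) / ennreal (\<Psi> R) = ennreal (C\<^sub>c * V x R / \<Psi> R)"
    using pos C\<^sub>c by (simp add: emeasure_ball divide_ennreal flip: ennreal_mult)
  also have "\<dots> < ennreal (2 * C\<^sub>c * V x R / \<Psi> R)"
    using pos C\<^sub>c by (intro ennreal_lessI divide_strict_right_mono) auto
  finally have "(INF u\<in>{u \<in> \<F>. (AE y in m. y \<in> ball x R \<longrightarrow> u y = 1) \<and>
      (AE y in m. y \<notin> ball x (A\<^sub>1 * R) \<longrightarrow> u y = 0)}. ennreal (\<E> u)) < ennreal (2 * C\<^sub>c * V x R / \<Psi> R)"
    using capacity[OF assms] by (rule le_less_trans[rotated])
  then obtain u where u: "u \<in> \<F>" "AE y in m. y \<in> ball x R \<longrightarrow> u y = 1"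
    "AE y in m. y \<notin> ball x (A\<^sub>1 * R) \<longrightarrow> u y = 0" "ennreal (\<E> u) < ennreal (2 * C\<^sub>c * V x R / \<Psi> R)"
    unfolding INF_less_iff by blast
  note clamp = contraction[OF u(1) lipschitz_clamp]
  show ?thesis
  proof (rule that)
    show "(\<lambda>y. max 0 (min (u y) 1)) \<in> \<F>" using clamp by simp
    have "\<E> u < 2 * C\<^sub>c * V x R / \<Psi> R"
      using u(4) pos C\<^sub>c by (simp add: ennreal_less_iff energy_nonneg[OF u(1)])
    then show "\<E> (\<lambda>y. max 0 (min (u y) 1)) < 2 * C\<^sub>c * V x R / \<Psi> R" using clamp by simp
    show "AE y in m. 0 \<le> max 0 (min (u y) 1) \<and> max 0 (min (u y) 1) \<le> 1 \<and>
        (y \<in> ball x R \<longrightarrow> max 0 (min (u y) 1) = 1) \<and> (y \<notin> ball x (A\<^sub>1 * R) \<longrightarrow> max 0 (min (u y) 1) = 0)"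
      using u(2,3) by eventually_elim auto
  qed
qed

text \<open>The potential \<open>u\<close> need not be continuous.  Approximations \<open>v\<^sub>n \<in> \<F> \<inter> Cc\<close> of \<open>u\<close> are squeezed between continuous
  cutoffs \<open>\<phi>\<^sub>1 \<le> u \<le> \<phi>\<^sub>2\<close> of uncontrolled but fixed energy; Mazur's lemma recovers the energy of \<open>u\<close>.\<close>

lemma capacity_cutoff_aux:
  assumes \<rho>: "0 < \<rho>" and small: "ennreal (2 * \<rho>) < ediam (UNIV :: 'a set) / ennreal A\<^sub>2"
  obtains \<phi> where "\<phi> \<in> \<F> \<inter> Cc" "\<And>y. 0 \<le> \<phi> y" "\<And>y. \<phi> y \<le> 1" "\<And>y. y \<in> ball x \<rho> \<Longrightarrow> \<phi> y = 1"
    "\<And>y. y \<notin> ball x (4 * A\<^sub>1 * \<rho>) \<Longrightarrow> \<phi> y = 0" "\<E> \<phi> \<le> 2 * C\<^sub>c * V x (2 * \<rho>) / \<Psi> (2 * \<rho>)"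
proof -
  define b where "b = 2 * C\<^sub>c * V x (2 * \<rho>) / \<Psi> (2 * \<rho>)"
  define K where "K = {\<phi> \<in> \<F> \<inter> Cc. (\<forall>y. 0 \<le> \<phi> y \<and> \<phi> y \<le> 1) \<and> (\<forall>y\<in>ball x \<rho>. \<phi> y = 1) \<and>
    (\<forall>y. y \<notin> ball x (4 * A\<^sub>1 * \<rho>) \<longrightarrow> \<phi> y = 0)}"
  obtain u where u: "u \<in> \<F>" "\<E> u < b" and uae: "AE y in m. 0 \<le> u y \<and> u y \<le> 1 \<and>
      (y \<in> ball x (2 * \<rho>) \<longrightarrow> u y = 1) \<and> (y \<notin> ball x (A\<^sub>1 * (2 * \<rho>)) \<longrightarrow> u y = 0)"
    using capacity_potential[of "2 * \<rho>" x] \<rho> small unfolding b_def by auto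
  have lt: "\<rho> < 2 * \<rho>" "2 * A\<^sub>1 * \<rho> < 4 * A\<^sub>1 * \<rho>" "2 * \<rho> \<le> 2 * A\<^sub>1 * \<rho>" using \<rho> A\<^sub>1 by auto
  \<comment> \<open>The radii are chosen so that \<open>\<phi>\<^sub>1\<close> vanishes off the ball
    where \<open>u = 1\<close>, and \<open>\<phi>\<^sub>2\<close> is 1 wherever \<open>u\<close> may
    be nonzero. This gives the order between the three functions almost everywhere.\<close>
  obtain \<phi>\<^sub>1 where \<phi>\<^sub>1: "\<phi>\<^sub>1 \<in> \<F> \<inter> Cc" "\<And>y. 0 \<le> \<phi>\<^sub>1 y" "\<And>y. \<phi>\<^sub>1 y \<le> 1"
    "\<And>y. y \<in> ball x \<rho> \<Longrightarrow> \<phi>\<^sub>1 y = 1" "\<And>y. y \<notin> ball x (2 * \<rho>) \<Longrightarrow> \<phi>\<^sub>1 y = 0"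
    using ball_cutoff[OF lt(1), of x] by blast
  obtain \<phi>\<^sub>2 where \<phi>\<^sub>2: "\<phi>\<^sub>2 \<in> \<F> \<inter> Cc" "\<And>y. 0 \<le> \<phi>\<^sub>2 y" "\<And>y. \<phi>\<^sub>2 y \<le> 1"
    "\<And>y. y \<in> ball x (2 * A\<^sub>1 * \<rho>) \<Longrightarrow> \<phi>\<^sub>2 y = 1" "\<And>y. y \<notin> ball x (4 * A\<^sub>1 * \<rho>) \<Longrightarrow> \<phi>\<^sub>2 y = 0"
    using ball_cutoff[OF lt(2), of x] by blast
  have "\<exists>v\<in>\<F> \<inter> Cc. energy_norm m p \<E> (\<lambda>y. u y - v y) < 1 / real (Suc n)" for n
    by (rule dense_in_domain[OF u(1)]) simp
  then obtain v where v: "\<And>n. v n \<in> \<F> \<inter> Cc" and vn: "\<And>n. energy_norm m p \<E> (\<lambda>y. u y - v n y) < 1 / real (Suc n)"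
    by metis
  define c where "c = (\<lambda>n y. max 0 (min (v n y) 1))"
  have min1: "continuous_on UNIV (\<lambda>t::real. min t 1)" by (intro continuous_intros)
  have c: "c n \<in> \<F> \<inter> Cc" "energy_root (c n) \<le> energy_root (v n)" for n
    using energy_root_contraction[OF _ lipschitz_clamp, of "v n"] v[of n]
      Cc_max[OF Cc_zero Cc_compose[OF _ min1], of "v n"]
    unfolding c_def by auto
  \<comment> \<open>Squeezing forces the exact values 1 near \<open>x\<close> and 0 far away, which
    approximation in norm alone cannot provide, and preserves continuity.\<close>
  define f where "f = (\<lambda>n y. max (min (c n y) (\<phi>\<^sub>2 y)) (\<phi>\<^sub>1 y))"
  have min: "(\<lambda>y. min (c n y) (\<phi>\<^sub>2 y)) \<in> \<F>" "energy_root (\<lambda>y. min (c n y) (\<phi>\<^sub>2 y)) \<le> 2 * energy_root (c n) + energy_root \<phi>\<^sub>2" for n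
    using energy_root_min[of "c n" \<phi>\<^sub>2] c(1) \<phi>\<^sub>2(1) by auto
  have fK: "f n \<in> K" for n
  proof -
    have "f n \<in> \<F>" unfolding f_def using \<phi>\<^sub>1(1) by (intro energy_root_max(1) min) auto
    moreover have "f n \<in> Cc" unfolding f_def using \<phi>\<^sub>1(1) \<phi>\<^sub>2(1) c(1) by (intro Cc_max Cc_min) auto
    moreover have "0 \<le> f n y" "f n y \<le> 1" for y
      unfolding f_def using \<phi>\<^sub>1(2,3) \<phi>\<^sub>2(3) by (auto simp: le_max_iff_disj min_le_iff_disj)
    moreover have "f n y = 1" if "y \<in> ball x \<rho>" for y
      using \<phi>\<^sub>1(4)[OF that] \<phi>\<^sub>2(3)[of y] unfolding f_def by (auto simp: max_def min_def)
    moreover have "f n y = 0" if "y \<notin> ball x (4 * A\<^sub>1 * \<rho>)" for y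
    proof -
      have "2 * \<rho> \<le> 4 * A\<^sub>1 * \<rho>" using lt by linarith
      then have "y \<notin> ball x (2 * \<rho>)" using that by (meson subset_ball subsetD)
      then show ?thesis using \<phi>\<^sub>1(5) \<phi>\<^sub>2(5)[OF that] unfolding f_def c_def by auto
    qed
    ultimately show ?thesis unfolding K_def by auto
  qed
  have fe: "energy_root (f n) \<le> 2 * (energy_root u + 1) + energy_root \<phi>\<^sub>2 + 2 * energy_root \<phi>\<^sub>1" for n
  proof -
    have "energy_root (\<lambda>y. u y - (u y - v n y)) \<le> energy_root u + energy_root (\<lambda>y. u y - v n y)"
      using v by (intro seminorm_on_diff[OF seminorm_energy_root linear_subspace] \<F>_diff u) auto
    moreover have "energy_root (\<lambda>y. u y - v n y) \<le> energy_norm m p \<E> (\<lambda>y. u y - v n y)"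
      unfolding energy_norm_def energy_root_def Lp_norm_def by simp
    moreover have "1 / real (Suc n) \<le> 1" by simp
    moreover have "energy_root (\<lambda>y. u y - (u y - v n y)) = energy_root (v n)" by simp
    ultimately have "energy_root (v n) \<le> energy_root u + 1" using vn[of n] by linarith
    moreover have "energy_root (f n) \<le> energy_root (\<lambda>y. min (c n y) (\<phi>\<^sub>2 y)) + 2 * energy_root \<phi>\<^sub>1"
      unfolding f_def using \<phi>\<^sub>1(1) by (intro energy_root_max(2) min) auto
    then have "energy_root (f n) \<le> 2 * energy_root (c n) + energy_root \<phi>\<^sub>2 + 2 * energy_root \<phi>\<^sub>1"
      using add_right_mono[OF min(2)[of n]] by (rule order_trans)
    moreover have "2 * energy_root (c n) \<le> 2 * energy_root (v n)" using c(2)[of n] by (rule mult_left_mono) simp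
    ultimately show ?thesis by simp
  qed
  have fF: "f n \<in> \<F>" for n using fK unfolding K_def by auto
  have "Lp_norm m p (\<lambda>y. f n y - u y) \<le> 1 / real (Suc n)" for n
  proof -
    \<comment> \<open>Each truncation that leads from \<open>v n\<close> to \<open>f n\<close> is
      1-Lipschitz in the value and fixes \<open>u y\<close>, so \<open>f n\<close> is no farther
      from \<open>u\<close> than \<open>v n\<close> is.\<close>
    have "AE y in m. \<bar>f n y - u y\<bar> \<le> \<bar>u y - v n y\<bar>"
      using uae
    proof eventually_elim
      case (elim y)
      show ?case
      proof (cases "y \<in> ball x (2 * A\<^sub>1 * \<rho>)")
        case True
        then have f: "f n y = max (c n y) (\<phi>\<^sub>1 y)" unfolding f_def c_def by (simp add: \<phi>\<^sub>2(4))
        show ?thesis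
        proof (cases "y \<in> ball x (2 * \<rho>)")
          case True
          then show ?thesis using elim \<phi>\<^sub>1(2,3)[of y] unfolding f c_def by linarith
        next
          case False
          then show ?thesis using elim \<phi>\<^sub>1(5)[OF False] unfolding f c_def by linarith
        qed
      next
        case False
        then have "u y = 0" "\<phi>\<^sub>1 y = 0" using elim \<phi>\<^sub>1(5)[of y] lt(3) by (auto simp: mult.assoc)
        then show ?thesis using \<phi>\<^sub>2(2,3)[of y] unfolding f_def c_def by linarith
      qed
    qed
    moreover have "(\<lambda>y. u y - v n y) \<in> Lp_functions m p"
      using in_Lp \<F>_diff[OF u(1)] v[of n] by auto
    ultimately have "Lp_norm m p (\<lambda>y. f n y - u y) \<le> Lp_norm m p (\<lambda>y. u y - v n y)"
      using p \<F>_measurable[OF \<F>_diff[OF fF u(1)]] by (intro Lp_norm_mono) (auto simp: borel_measurable_m)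
    also have "\<dots> \<le> energy_norm m p \<E> (\<lambda>y. u y - v n y)" unfolding energy_norm_def by simp
    finally show ?thesis using vn[of n] by simp
  qed
  moreover have "0 \<le> Lp_norm m p (\<lambda>y. f n y - u y)" for n unfolding Lp_norm_def by simp
  ultimately have lim: "(\<lambda>n. Lp_norm m p (\<lambda>y. f n y - u y)) \<longlonglongrightarrow> 0"
    by (intro tendsto_sandwich[OF _ _ tendsto_const LIMSEQ_Suc[OF lim_inverse_n']] always_eventually allI) auto
  have K: "K \<subseteq> \<F>" unfolding K_def by auto
  have conv: "convex_functions K"
    unfolding convex_functions_def
  proof (intro ballI allI impI)
    fix g h and s t :: real assume gh: "g \<in> K" "h \<in> K" and st: "0 \<le> s" "0 \<le> t" "s + t = 1"
    have "(\<lambda>x. s * g x + t * h x) \<in> Cc"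
      using gh unfolding K_def by (intro Cc_add Cc_compose[where h = "\<lambda>a. _ * a"]) (auto intro!: continuous_intros)
    moreover have "s * g y + t * h y \<le> 1" for y
      using gh st convex_bound_le[of "g y" 1 "h y" s t] unfolding K_def by simp
    ultimately show "(\<lambda>x. s * g x + t * h x) \<in> K"
      using gh st unfolding K_def by (auto intro!: \<F>_add \<F>_scale)
  qed
  \<comment> \<open>The energies of the \<open>f n\<close> are merely bounded; a convex combination
    close to \<open>u\<close> in energy stays below \<open>b\<close> because
    \<open>\<E> u < b\<close> is strict.\<close>
  have "energy_root u < b powr (1 / p)"
    unfolding energy_root_def using u p energy_nonneg by (intro powr_less_mono2) auto
  then have "0 < b powr (1 / p) - energy_root u" by simp
  from energy_mazur[OF fF fe u(1) lim K conv _ this] fK obtain \<phi>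
    where \<phi>: "\<phi> \<in> K" "energy_norm m p \<E> (\<lambda>y. \<phi> y - u y) < b powr (1 / p) - energy_root u" by auto
  have \<phi>F: "\<phi> \<in> \<F>" using \<phi>(1) K by auto
  have "energy_root (\<lambda>y. (\<phi> y - u y) + u y) \<le> energy_root (\<lambda>y. \<phi> y - u y) + energy_root u"
    by (intro seminorm_on_add[OF seminorm_energy_root] \<F>_diff \<phi>F u)
  moreover have "energy_root (\<lambda>y. \<phi> y - u y) \<le> energy_norm m p \<E> (\<lambda>y. \<phi> y - u y)"
    unfolding energy_norm_def energy_root_def Lp_norm_def by simp
  ultimately have "energy_root \<phi> \<le> b powr (1 / p)" using \<phi>(2) by simp
  then have "energy_root \<phi> powr p \<le> (b powr (1 / p)) powr p"
    using p by (intro powr_mono2) (auto simp: energy_root_def)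
  moreover have "0 \<le> b" using u energy_nonneg[OF u(1)] by simp
  ultimately have "\<E> \<phi> \<le> b" using p by (simp add: energy_eq[OF \<phi>F] powr_powr)
  then show ?thesis using \<phi>(1) that unfolding K_def b_def by auto
qed

text \<open>\<open>ediam\<close> may be infinite; the distance of two fixed points is a positive
  real below it, so one range of radii is admissible at every centre. The energy bound is brought
  from scale \<open>2 * \<rho>\<close> back to \<open>\<rho>\<close> by doubling.\<close>

lemma capacity_cutoff:
  obtains C L \<rho>\<^sub>0 where "0 < C" "1 \<le> L" "0 < \<rho>\<^sub>0"
    "\<And>x \<rho>. 0 < \<rho> \<Longrightarrow> \<rho> < \<rho>\<^sub>0 \<Longrightarrow> \<exists>\<phi>\<in>\<F> \<inter> Cc. (\<forall>y. 0 \<le> \<phi> y) \<and> (\<forall>y\<in>ball x \<rho>. \<phi> y = 1) \<and>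
      (\<forall>y. y \<notin> ball x (L * \<rho>) \<longrightarrow> \<phi> y = 0) \<and> \<E> \<phi> \<le> C * V x \<rho> / \<Psi> \<rho>"
proof -
  obtain a b :: 'a where ab: "a \<noteq> b" using two_points by blast
  show ?thesis
  proof (rule that[of "2 * C\<^sub>c * cD" "4 * A\<^sub>1" "dist a b / (2 * A\<^sub>2)"])
    fix x \<rho> assume \<rho>: "0 < \<rho>" "\<rho> < dist a b / (2 * A\<^sub>2)"
    have "2 * \<rho> < dist a b / A\<^sub>2" using \<rho> A\<^sub>2 by (simp add: field_simps)
    then have "ennreal (2 * \<rho>) < ennreal (dist a b / A\<^sub>2)" using \<rho> by (intro ennreal_lessI) auto
    also have "\<dots> = ennreal (dist a b) / ennreal A\<^sub>2" using A\<^sub>2 by (simp add: divide_ennreal)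
    also have "ennreal (dist a b) \<le> ediam (UNIV :: 'a set)"
      unfolding ediam_def by (intro SUP_upper2[of a] SUP_upper2[of b]) auto
    finally have "ennreal (2 * \<rho>) < ediam (UNIV :: 'a set) / ennreal A\<^sub>2"
      by (simp add: divide_right_mono_ennreal)
    then show "\<exists>\<phi>\<in>\<F> \<inter> Cc. (\<forall>y. 0 \<le> \<phi> y) \<and> (\<forall>y\<in>ball x \<rho>. \<phi> y = 1) \<and>
        (\<forall>y. y \<notin> ball x (4 * A\<^sub>1 * \<rho>) \<longrightarrow> \<phi> y = 0) \<and> \<E> \<phi> \<le> 2 * C\<^sub>c * cD * V x \<rho> / \<Psi> \<rho>"
    proof (rule capacity_cutoff_aux[OF \<rho>(1), where x = x])
      fix \<phi> assume \<phi>: "\<phi> \<in> \<F> \<inter> Cc" "\<And>y. 0 \<le> \<phi> y"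
        "\<And>y. y \<in> ball x \<rho> \<Longrightarrow> \<phi> y = 1" "\<And>y. y \<notin> ball x (4 * A\<^sub>1 * \<rho>) \<Longrightarrow> \<phi> y = 0"
        and E: "\<E> \<phi> \<le> 2 * C\<^sub>c * V x (2 * \<rho>) / \<Psi> (2 * \<rho>)"
      have "2 * C\<^sub>c * V x (2 * \<rho>) / \<Psi> (2 * \<rho>) \<le> 2 * C\<^sub>c * (cD * V x \<rho>) / \<Psi> \<rho>"
      proof (rule frac_le)
        show "2 * C\<^sub>c * V x (2 * \<rho>) \<le> 2 * C\<^sub>c * (cD * V x \<rho>)"
          using V_double[OF \<rho>(1)] C\<^sub>c by (intro mult_left_mono) auto
      qed (use \<Psi>_mono[of \<rho> "2 * \<rho>"] \<Psi>_pos[OF \<rho>(1)] \<rho>(1) C\<^sub>c cD in auto)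
      then have "\<E> \<phi> \<le> 2 * C\<^sub>c * cD * V x \<rho> / \<Psi> \<rho>" using E by (simp add: mult.assoc)
      then show ?thesis using \<phi> by blast
    qed
  qed (use ab C\<^sub>c cD A\<^sub>1 A\<^sub>2 in auto)
qed

subsection \<open>Lower bounds\<close>

text \<open>The functions \<open>\<psi> i\<close> are the increments of the truncated partial sums \<open>min (\<Sum>j<i. \<phi> j) 1\<close>.  Where \<open>\<phi> i\<close> does not vanish
  only the boundedly many neighbours of \<open>i\<close> contribute, which controls the energy without any product rule.\<close>

lemma partition_of_unity:
  fixes x :: "nat \<Rightarrow> 'a" and \<phi> :: "nat \<Rightarrow> 'a \<Rightarrow> real"
  assumes \<rho>: "0 < \<rho>" and L: "1 \<le> L" and k: "8 * L + 5 \<le> 2 ^ k"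
    and inj: "inj_on x {..<N}" and sep: "separated \<rho> (x ` {..<N})"
    and \<phi>: "\<And>i. i < N \<Longrightarrow> \<phi> i \<in> \<F> \<inter> Cc" "\<And>i y. i < N \<Longrightarrow> 0 \<le> \<phi> i y"
      "\<And>i y. i < N \<Longrightarrow> y \<in> ball (x i) \<rho> \<Longrightarrow> \<phi> i y = 1"
      "\<And>i y. i < N \<Longrightarrow> y \<notin> ball (x i) (L * \<rho>) \<Longrightarrow> \<phi> i y = 0"
      "\<And>i. i < N \<Longrightarrow> \<E> (\<phi> i) \<le> c * V (x i) \<rho>" and c: "0 \<le> c"
  obtains \<psi> where "\<And>i. i < N \<Longrightarrow> \<psi> i \<in> \<F> \<inter> Cc" "\<And>i y. i < N \<Longrightarrow> 0 \<le> \<psi> i y"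
    "\<And>i y. i < N \<Longrightarrow> y \<notin> ball (x i) (L * \<rho>) \<Longrightarrow> \<psi> i y = 0"
    "\<And>j y. j < N \<Longrightarrow> y \<in> ball (x j) \<rho> \<Longrightarrow> (\<Sum>i<N. \<psi> i y) = 1"
    "\<And>i j. i < N \<Longrightarrow> j < N \<Longrightarrow> dist (x j) (x i) < 2 * L * \<rho> \<Longrightarrow>
       energy_root (\<psi> i) \<le> 2 * cD ^ k * (c * cD ^ k * V (x j) \<rho>) powr (1 / p)"
proof -
  have L\<rho>: "\<rho> \<le> L * \<rho>" "8 * (L * \<rho>) + 5 * \<rho> \<le> 2 ^ k * \<rho>"
    using L \<rho> mult_right_mono[OF k, of \<rho>] by (auto simp: algebra_simps)
  define S where "S = (\<lambda>i y. \<Sum>j<i. \<phi> j y)"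
  define \<psi> where "\<psi> = (\<lambda>i y. min (S (Suc i) y) 1 - min (S i y) 1)"
  have S: "S i \<in> \<F>" "S i \<in> Cc" if "i \<le> N" for i
    unfolding S_def using \<phi>(1) that by (auto intro!: \<F>_sum Cc_sum)
  have min1: "continuous_on UNIV (\<lambda>t::real. min t 1)" by (intro continuous_intros)
  have T: "(\<lambda>y. min (S i y) 1) \<in> \<F>" "(\<lambda>y. min (S i y) 1) \<in> Cc" if "i \<le> N" for i
    using energy_root_contraction(1)[OF S(1)[OF that] lipschitz_min1] Cc_compose[OF S(2)[OF that] min1] by auto
  have supp: "\<psi> i y = 0" if "i < N" "\<phi> i y = 0" for i y
    unfolding \<psi>_def S_def using that by simp
  show ?thesis
  proof (rule that[of \<psi>])
    show "\<psi> i \<in> \<F> \<inter> Cc" if "i < N" for i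
      unfolding \<psi>_def using that T[of "Suc i"] T[of i] by (auto intro: \<F>_diff Cc_diff)
    show "0 \<le> \<psi> i y" if "i < N" for i y
      unfolding \<psi>_def S_def using \<phi>(2)[OF that, of y] by (simp add: min_def)
    show "\<psi> i y = 0" if "i < N" "y \<notin> ball (x i) (L * \<rho>)" for i y
      using supp[OF that(1)] \<phi>(4)[OF that] by simp
    show "(\<Sum>i<N. \<psi> i y) = 1" if "j < N" "y \<in> ball (x j) \<rho>" for j y
    proof -
      have "(\<Sum>i<N. \<psi> i y) = min (S N y) 1 - min (S 0 y) 1"
        unfolding \<psi>_def by (rule sum_lessThan_telescope)
      moreover have "\<phi> j y \<le> S N y" unfolding S_def using \<phi>(2) that(1) by (intro member_le_sum) auto
      moreover have "\<phi> j y = 1" using \<phi>(3)[OF that] .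
      ultimately show ?thesis by (simp add: S_def)
    qed
    \<comment> \<open>The bound refers to the volume at a nearby \<open>x j\<close>, because later
      all terms near one \<open>x j\<close> are added up.\<close>
    show "energy_root (\<psi> i) \<le> 2 * cD ^ k * (c * cD ^ k * V (x j) \<rho>) powr (1 / p)"
      if i: "i < N" and j: "j < N" and ij: "dist (x j) (x i) < 2 * L * \<rho>" for i j
    proof -
      define nb where "nb = {l \<in> {..<N}. dist (x i) (x l) < 2 * L * \<rho>}"
      have nb: "finite nb" "real (card nb) \<le> cD ^ k"
        using separated_index_card[OF inj sep \<rho>, of "2 * L * \<rho>" k "x i"] L\<rho> \<rho>
        unfolding nb_def by (auto simp: mult.assoc)
      define A where "A = (\<lambda>y. \<Sum>l\<in>nb \<inter> {..<Suc i}. \<phi> l y)"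
      define B where "B = (\<lambda>y. \<Sum>l\<in>nb \<inter> {..<i}. \<phi> l y)"
      have "\<psi> i y = min (A y) 1 - min (B y) 1" for y
      proof (cases "\<phi> i y = 0")
        case True
        have "i \<in> nb" unfolding nb_def using i \<rho> L by simp
        then have "nb \<inter> {..<Suc i} = insert i (nb \<inter> {..<i})" by auto
        then have "A y = B y" unfolding A_def B_def using nb True by simp
        then show ?thesis using supp[OF i True] by simp
      next
        case False
        then have y: "dist (x i) y < L * \<rho>" using \<phi>(4)[OF i, of y] by auto
        have zero: "\<phi> l y = 0" if "l < N" "l \<notin> nb" for l
        proof (rule ccontr)
          assume "\<phi> l y \<noteq> 0"
          then have "dist (x l) y < L * \<rho>" using \<phi>(4)[OF that(1), of y] by auto
          then have "dist (x i) (x l) < 2 * L * \<rho>" using y dist_triangle2[of "x i" "x l" y] by simp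
          then show False using that unfolding nb_def by simp
        qed
        have "S (Suc i) y = A y" "S i y = B y"
          unfolding S_def A_def B_def using i zero by (intro sum.mono_neutral_right; force)+
        then show ?thesis unfolding \<psi>_def by simp
      qed
      then have \<psi>: "\<psi> i = (\<lambda>y. min (A y) 1 - min (B y) 1)" by auto
      define b where "b = (c * cD ^ k * V (x j) \<rho>) powr (1 / p)"
      have b: "energy_root (\<phi> l) \<le> b" if "l \<in> nb" for l
      proof -
        have l: "l < N" "dist (x i) (x l) < 2 * L * \<rho>" using that unfolding nb_def by auto
        then have "dist (x j) (x l) < 4 * L * \<rho>" using ij dist_triangle[of "x j" "x l" "x i"] by simp
        then have "dist (x j) (x l) + \<rho> \<le> 2 ^ k * \<rho>" using L\<rho> \<rho> by linarith
        then have "V (x l) \<rho> \<le> cD ^ k * V (x j) \<rho>" using \<rho> by (intro V_compare)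
        then have "c * V (x l) \<rho> \<le> c * (cD ^ k * V (x j) \<rho>)" using c by (rule mult_left_mono)
        then have "\<E> (\<phi> l) \<le> c * cD ^ k * V (x j) \<rho>" using \<phi>(5)[OF l(1)] by (simp add: mult.assoc)
        then show ?thesis unfolding energy_root_def b_def
          using energy_nonneg \<phi>(1)[OF l(1)] p by (intro powr_mono2) auto
      qed
      have AB: "A \<in> \<F>" "B \<in> \<F>" "energy_root A \<le> cD ^ k * b" "energy_root B \<le> cD ^ k * b"
      proof -
        have *: "(\<lambda>y. \<Sum>l\<in>nb'. \<phi> l y) \<in> \<F>" "energy_root (\<lambda>y. \<Sum>l\<in>nb'. \<phi> l y) \<le> cD ^ k * b" if "nb' \<subseteq> nb" for nb'
        proof -
          have F: "\<phi> l \<in> \<F>" if "l \<in> nb'" for l using \<phi>(1)[of l] that \<open>nb' \<subseteq> nb\<close> unfolding nb_def by auto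
          then show "(\<lambda>y. \<Sum>l\<in>nb'. \<phi> l y) \<in> \<F>" by (intro \<F>_sum)
          have "energy_root (\<lambda>y. \<Sum>l\<in>nb'. \<phi> l y) \<le> (\<Sum>l\<in>nb'. energy_root (\<phi> l))"
            using F by (intro seminorm_on_sum[OF seminorm_energy_root linear_subspace])
          also have "\<dots> \<le> real (card nb') * b" using b that by (intro sum_bounded_above) auto
          also have "\<dots> \<le> cD ^ k * b"
          proof (rule mult_right_mono)
            show "real (card nb') \<le> cD ^ k" using nb card_mono[OF nb(1) that] by linarith
          qed (simp add: b_def)
          finally show "energy_root (\<lambda>y. \<Sum>l\<in>nb'. \<phi> l y) \<le> cD ^ k * b" .
        qed
        show "A \<in> \<F>" "B \<in> \<F>" "energy_root A \<le> cD ^ k * b" "energy_root B \<le> cD ^ k * b"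
          unfolding A_def B_def by (intro *; simp)+
      qed
      note TA = energy_root_contraction[OF AB(1) lipschitz_min1] and TB = energy_root_contraction[OF AB(2) lipschitz_min1]
      have "energy_root (\<psi> i) \<le> energy_root (\<lambda>y. min (A y) 1) + energy_root (\<lambda>y. min (B y) 1)"
        unfolding \<psi> using TA TB by (intro seminorm_on_diff[OF seminorm_energy_root linear_subspace]) auto
      also have "energy_root (\<lambda>y. min (A y) 1) \<le> cD ^ k * b" using TA(2) AB(3) by simp
      also have "energy_root (\<lambda>y. min (B y) 1) \<le> cD ^ k * b" using TB(2) AB(4) by simp
      finally show ?thesis unfolding b_def by simp
    qed
  qed
qed

section \<open>Discretization at a fixed scale\<close>

lemma D_indicator:
  "D S v r = (\<integral>\<^sup>+y. 1 / emeasure m (ball y r) * (\<integral>\<^sup>+x\<in>S \<inter> ball y r. ennreal (\<bar>v x - v y\<bar> powr p) \<partial>m) * indicator S y \<partial>m)"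
  unfolding D_def difference_energy_def by simp

text \<open>Both values are compared with \<open>v y\<close>, integrated over a ball that lies in
  both large balls; a jump between two sample points is thus paid by the oscillations about these
  points.\<close>

lemma jump_le_oscillation:
  assumes [measurable]: "v \<in> borel_measurable borel"
    and s: "0 < s" and sub: "ball x s \<subseteq> ball z r" "ball x s \<subseteq> ball z' r"
  shows "ennreal (\<bar>v z - v z'\<bar> powr p * V x s) \<le> ennreal (2 powr p) *
    ((\<integral>\<^sup>+y\<in>ball z r. ennreal (\<bar>v y - v z\<bar> powr p) \<partial>m) + (\<integral>\<^sup>+y\<in>ball z' r. ennreal (\<bar>v y - v z'\<bar> powr p) \<partial>m))"
proof -
  have [measurable]: "ball a t \<in> sets borel" for a :: 'a and t by simp
  have "ennreal (\<bar>v z - v z'\<bar> powr p * V x s) = (\<integral>\<^sup>+y. ennreal (\<bar>v z - v z'\<bar> powr p) * indicator (ball x s) y \<partial>m)"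
    by (subst nn_integral_cmult_indicator) (auto simp: emeasure_ball ennreal_mult)
  also have "\<dots> \<le> (\<integral>\<^sup>+y. ennreal (2 powr p) * (ennreal (\<bar>v y - v z\<bar> powr p) * indicator (ball z r) y
      + ennreal (\<bar>v y - v z'\<bar> powr p) * indicator (ball z' r) y) \<partial>m)"
  proof (rule nn_integral_mono)
    fix y
    show "ennreal (\<bar>v z - v z'\<bar> powr p) * indicator (ball x s) y
      \<le> ennreal (2 powr p) * (ennreal (\<bar>v y - v z\<bar> powr p) * indicator (ball z r) y
      + ennreal (\<bar>v y - v z'\<bar> powr p) * indicator (ball z' r) y)"
    proof (cases "y \<in> ball x s")
      case True
      then have "y \<in> ball z r" "y \<in> ball z' r" using sub by blast+
      moreover have "\<bar>v z - v z'\<bar> powr p \<le> 2 powr p * (\<bar>v y - v z\<bar> powr p + \<bar>v y - v z'\<bar> powr p)"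
        using abs_powr_diff_le[of p "v z" "v z'" "v y"] p by (simp add: abs_minus_commute)
      ultimately show ?thesis using True by (simp add: ennreal_leI flip: ennreal_plus ennreal_mult)
    qed simp
  qed
  also have "\<dots> = ennreal (2 powr p) *
    ((\<integral>\<^sup>+y\<in>ball z r. ennreal (\<bar>v y - v z\<bar> powr p) \<partial>m) + (\<integral>\<^sup>+y\<in>ball z' r. ennreal (\<bar>v y - v z'\<bar> powr p) \<partial>m))"
    by (simp add: nn_integral_cmult nn_integral_add)
  finally show ?thesis .
qed

text \<open>\<open>w\<close> is the sum of \<open>v (z i) * \<psi> i\<close> with sample points
  \<open>z i\<close> near the net points, chosen so that the oscillation \<open>G (z i)\<close> is
  at most its mean. Closeness and support will give convergence in the Lebesgue space. The last
  clause bounds the energy on \<open>K\<close> by differences of \<open>v\<close> in a neighbourhood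
  of \<open>K\<close> only.\<close>

lemma discretization:
  obtains C \<Lambda> \<rho>\<^sub>0 where "0 < C" "1 \<le> \<Lambda>" "0 < \<rho>\<^sub>0"
    "\<And>\<rho> v. 0 < \<rho> \<Longrightarrow> \<rho> < \<rho>\<^sub>0 \<Longrightarrow> v \<in> \<F> \<inter> Cc \<Longrightarrow> \<exists>w\<in>\<F> \<inter> Cc.
      (\<forall>\<epsilon>\<ge>0. (\<forall>x y. dist x y < \<Lambda> * \<rho> \<longrightarrow> \<bar>v x - v y\<bar> \<le> \<epsilon>) \<longrightarrow> (\<forall>x. \<bar>w x - v x\<bar> \<le> \<epsilon>)) \<and>
      (\<forall>a R. (\<forall>x. x \<notin> ball a R \<longrightarrow> v x = 0) \<longrightarrow> (\<forall>x. x \<notin> ball a (R + \<Lambda> * \<rho>) \<longrightarrow> w x = 0)) \<and>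
      (\<forall>S K. open S \<longrightarrow> K \<in> sets borel \<longrightarrow> (\<forall>x\<in>K. ball x (2 * \<Lambda> * \<rho>) \<subseteq> S) \<longrightarrow>
         emeasure (\<Gamma> w) K \<le> ennreal (C / \<Psi> \<rho>) * D S v (\<Lambda> * \<rho>))"
proof -
  obtain C\<^sub>1 L \<rho>\<^sub>0 where C\<^sub>1: "0 < C\<^sub>1" "1 \<le> L" "0 < \<rho>\<^sub>0" and cutoff: "\<And>x \<rho>. 0 < \<rho> \<Longrightarrow> \<rho> < \<rho>\<^sub>0 \<Longrightarrow>
      \<exists>\<phi>\<in>\<F> \<inter> Cc. (\<forall>y. 0 \<le> \<phi> y) \<and> (\<forall>y\<in>ball x \<rho>. \<phi> y = 1) \<and>
        (\<forall>y. y \<notin> ball x (L * \<rho>) \<longrightarrow> \<phi> y = 0) \<and> \<E> \<phi> \<le> C\<^sub>1 * V x \<rho> / \<Psi> \<rho>"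
    using capacity_cutoff by blast
  \<comment> \<open>The largest demand comes from \<open>overlap\<close>: counting net points within
    \<open>2 * L * \<rho> + \<rho>\<close> takes \<open>4 * (2 * L + 1) + 1\<close>, which is
    \<open>8 * L + 5\<close>.\<close>
  obtain k where "8 * L + 5 < 2 ^ k" using real_arch_pow[of 2] by auto
  then have k: "8 * L + 5 \<le> 2 ^ k" by simp
  define M where "M = cD ^ k"
  have M: "1 \<le> M" unfolding M_def using cD by (rule one_le_power)
  \<comment> \<open>Large enough that the ball of radius \<open>\<Lambda> * \<rho>\<close> about a
    sample point contains \<open>ball (x j) \<rho>\<close> for every neighbouring net point
    \<open>x j\<close>; the distances needed are below \<open>(2 * L + 2) * \<rho>\<close>.\<close>
  define \<Lambda> where "\<Lambda> = 2 * L + 4"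
  \<comment> \<open>In order: the power of a sum of at most \<open>M\<close> terms; the energies of
    the \<open>\<psi> i\<close>; the passage from a jump to two oscillations, each costing
    \<open>M\<close> in \<open>mean\<close>; the number of neighbours; the overlap.\<close>
  define C where "C = M powr p * (2 * M) powr p * M * C\<^sub>1 * (2 powr p * 2 * M * M * M)"
  have C: "0 < C" unfolding C_def using M C\<^sub>1 by simp
  show ?thesis
  proof (rule that[OF C _ C\<^sub>1(3)])
    show "1 \<le> \<Lambda>" unfolding \<Lambda>_def using C\<^sub>1 by simp
  next
    fix \<rho> v assume \<rho>: "0 < \<rho>" "\<rho> < \<rho>\<^sub>0" and v: "v \<in> \<F> \<inter> Cc"
    have [measurable]: "v \<in> borel_measurable borel" using v \<F>_measurable by auto
    have [measurable]: "ball a t \<in> sets borel" for a :: 'a and t by simp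
    define r where "r = \<Lambda> * \<rho>"
    have r: "0 < r" "r = 2 * (L * \<rho>) + 4 * \<rho>"
      unfolding r_def \<Lambda>_def using C\<^sub>1 \<rho> by (simp, simp add: algebra_simps)
    have L\<rho>: "\<rho> \<le> L * \<rho>" "8 * (L * \<rho>) + 5 * \<rho> \<le> 2 ^ k * \<rho>"
      using C\<^sub>1 \<rho> mult_right_mono[OF k, of \<rho>] by (auto simp: algebra_simps)
    fix a0 :: 'a
    obtain R0 where R0: "R0 > 0" "\<And>x. x \<notin> ball a0 R0 \<Longrightarrow> v x = 0" using Cc_bounded_support[of v a0] v by auto
    \<comment> \<open>A finite net suffices: beyond this ball both \<open>v\<close> and
      \<open>w\<close> vanish.\<close>
    obtain P where P: "finite P" "separated \<rho> P" "ball a0 (R0 + r) \<subseteq> (\<Union>y\<in>P. ball y \<rho>)"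
      using separated_net[OF \<rho>(1), of a0 "R0 + r"] by metis
    define N where "N = card P"
    obtain x where x: "bij_betw x {..<N} P"
      using ex_bij_betw_nat_finite[OF P(1)] unfolding N_def atLeast0LessThan by blast
    have inj: "inj_on x {..<N}" and sep: "separated \<rho> (x ` {..<N})"
      using x P(2) unfolding bij_betw_def by auto
    have cover: "\<exists>i<N. y \<in> ball (x i) \<rho>" if "y \<in> ball a0 (R0 + r)" for y
      using P(3) that x unfolding bij_betw_def by (force simp: subset_iff)
    have "\<exists>\<phi>. \<forall>i. \<phi> i \<in> \<F> \<inter> Cc \<and> (\<forall>y. 0 \<le> \<phi> i y) \<and> (\<forall>y\<in>ball (x i) \<rho>. \<phi> i y = 1) \<and>
        (\<forall>y. y \<notin> ball (x i) (L * \<rho>) \<longrightarrow> \<phi> i y = 0) \<and> \<E> (\<phi> i) \<le> C\<^sub>1 * V (x i) \<rho> / \<Psi> \<rho>"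
      by (intro choice allI) (use cutoff[OF \<rho>] in blast)
    then obtain \<phi> where \<phi>: "\<And>i. \<phi> i \<in> \<F> \<inter> Cc" "\<And>i y. 0 \<le> \<phi> i y" "\<And>i y. y \<in> ball (x i) \<rho> \<Longrightarrow> \<phi> i y = 1"
      "\<And>i y. y \<notin> ball (x i) (L * \<rho>) \<Longrightarrow> \<phi> i y = 0" "\<And>i. \<E> (\<phi> i) \<le> C\<^sub>1 * V (x i) \<rho> / \<Psi> \<rho>" by blast
    define c where "c = C\<^sub>1 / \<Psi> \<rho>"
    have c: "0 \<le> c" unfolding c_def using C\<^sub>1 \<Psi>_pos[OF \<rho>(1)] by simp
    have \<phi>c: "\<E> (\<phi> i) \<le> c * V (x i) \<rho>" for i using \<phi>(5)[of i] unfolding c_def by simp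
    have "\<exists>\<psi>. (\<forall>i<N. \<psi> i \<in> \<F> \<inter> Cc) \<and> (\<forall>i<N. \<forall>y. 0 \<le> \<psi> i y) \<and>
        (\<forall>i<N. \<forall>y. y \<notin> ball (x i) (L * \<rho>) \<longrightarrow> \<psi> i y = 0) \<and>
        (\<forall>j<N. \<forall>y\<in>ball (x j) \<rho>. (\<Sum>i<N. \<psi> i y) = 1) \<and>
        (\<forall>i<N. \<forall>j<N. dist (x j) (x i) < 2 * L * \<rho> \<longrightarrow>
           energy_root (\<psi> i) \<le> 2 * M * (c * M * V (x j) \<rho>) powr (1 / p))"
      unfolding M_def
    proof (rule partition_of_unity[where x = x and N = N and \<phi> = \<phi> and c = c, OF \<rho>(1) C\<^sub>1(2) k inj sep _ _ _ _ _ c],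
        goal_cases)
      case (6 \<psi>)
      then show ?case by (intro exI[of _ \<psi>] conjI allI impI ballI)
    qed (rule \<phi>(1) \<phi>(2) \<phi>(3) \<phi>(4) \<phi>c; assumption)+
    then obtain \<psi> where \<psi>': "\<forall>i<N. \<psi> i \<in> \<F> \<inter> Cc" "\<forall>i<N. \<forall>y. 0 \<le> \<psi> i y"
      "\<forall>i<N. \<forall>y. y \<notin> ball (x i) (L * \<rho>) \<longrightarrow> \<psi> i y = 0"
      "\<forall>j<N. \<forall>y\<in>ball (x j) \<rho>. (\<Sum>i<N. \<psi> i y) = 1"
      "\<forall>i<N. \<forall>j<N. dist (x j) (x i) < 2 * L * \<rho> \<longrightarrow>
         energy_root (\<psi> i) \<le> 2 * M * (c * M * V (x j) \<rho>) powr (1 / p)"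
      by (elim exE conjE)
    note \<psi> = \<psi>'(1,2)[rule_format] and \<psi>0 = \<psi>'(3)[rule_format] and \<psi>1 = \<psi>'(4)[rule_format]
      and \<psi>e = \<psi>'(5)[rule_format]
    define G where "G = (\<lambda>z. \<integral>\<^sup>+y\<in>ball z r. ennreal (\<bar>v y - v z\<bar> powr p) \<partial>m)"
    interpret sigma_finite_measure m by (rule sigma_finite)
    have Gm [measurable]: "G \<in> borel_measurable borel"
    proof -
      have "G = (\<lambda>z. \<integral>\<^sup>+y. ennreal (\<bar>v y - v z\<bar> powr p) * of_bool (dist z y < r) \<partial>m)"
        unfolding G_def by (intro ext nn_integral_cong) (auto simp: indicator_def)
      also have "\<dots> \<in> borel_measurable borel" by measurable
      finally show ?thesis .
    qed
    have "\<exists>z. z \<in> ball (x i) \<rho> \<and> G z * ennreal (V (x i) \<rho>) \<le> (\<integral>\<^sup>+y\<in>ball (x i) \<rho>. G y \<partial>m)" for i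
      by (rule exists_le_mean[OF Gm \<rho>(1), of "x i"]) (intro exI conjI)
    then have "\<exists>z. \<forall>i. z i \<in> ball (x i) \<rho> \<and> G (z i) * ennreal (V (x i) \<rho>) \<le> (\<integral>\<^sup>+y\<in>ball (x i) \<rho>. G y \<partial>m)"
      by (intro choice allI)
    then obtain z where z: "\<And>i. z i \<in> ball (x i) \<rho>"
      and zG: "\<And>i. G (z i) * ennreal (V (x i) \<rho>) \<le> (\<integral>\<^sup>+y\<in>ball (x i) \<rho>. G y \<partial>m)" by blast
    define w where "w = (\<lambda>y. \<Sum>i<N. v (z i) * \<psi> i y)"
    have Cc_cmult: "(\<lambda>y. t * f y) \<in> Cc" if "f \<in> Cc" for t and f :: "'a \<Rightarrow> real"
      by (rule Cc_compose[OF that, of "\<lambda>s. t * s"]) (auto intro!: continuous_intros)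
    have w: "w \<in> \<F> \<inter> Cc"
      unfolding w_def using \<psi>(1) by (auto intro!: \<F>_sum Cc_sum \<F>_scale Cc_cmult)
    have near: "dist (x i) y < L * \<rho>" if "i < N" "\<psi> i y \<noteq> 0" for i y using \<psi>0[OF that(1), of y] that(2) by auto
    have zx: "dist (x i) (z i) < \<rho>" for i using z[of i] by simp
    have support: "w y = 0" if "\<And>y. y \<notin> ball a R \<Longrightarrow> v y = 0" "y \<notin> ball a (R + (L * \<rho> + \<rho>))" for a R y
    proof -
      have "v (z i) * \<psi> i y = 0" if "i < N" for i
      proof (rule ccontr)
        assume "v (z i) * \<psi> i y \<noteq> 0"
        then have "dist a (z i) < R" "dist (x i) y < L * \<rho>"
          using \<open>\<And>y. y \<notin> ball a R \<Longrightarrow> v y = 0\<close>[of "z i"] near[OF that, of y] by auto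
        then have "dist a y < R + (L * \<rho> + \<rho>)"
          using zx[of i] dist_triangle[of a y "z i"] dist_triangle3[of "z i" y "x i"] by linarith
        then show False using \<open>y \<notin> ball a (R + (L * \<rho> + \<rho>))\<close> by simp
      qed
      then show ?thesis unfolding w_def by (intro sum.neutral ballI) (simp only: lessThan_iff)
    qed
    \<comment> \<open>In the covered ball the \<open>\<psi> i\<close> sum to 1, so
      \<open>w y - v y\<close> is a weighted mean of differences \<open>v (z i) - v y\<close> over
      short distances; elsewhere both functions vanish.\<close>
    have close: "\<bar>w y - v y\<bar> \<le> \<epsilon>" if \<epsilon>: "\<epsilon> \<ge> 0" and osc: "\<And>x y. dist x y < \<Lambda> * \<rho> \<Longrightarrow> \<bar>v x - v y\<bar> \<le> \<epsilon>" for \<epsilon> y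
    proof (cases "y \<in> ball a0 (R0 + r)")
      case True
      then obtain j where j: "j < N" "y \<in> ball (x j) \<rho>" using cover by blast
      have "w y - v y = (\<Sum>i<N. (v (z i) - v y) * \<psi> i y)"
        unfolding w_def using \<psi>1[OF j] by (simp add: left_diff_distrib sum_subtractf flip: sum_distrib_left)
      also have "\<bar>\<dots>\<bar> \<le> (\<Sum>i<N. \<bar>(v (z i) - v y) * \<psi> i y\<bar>)" by (rule sum_abs)
      also have "\<dots> \<le> (\<Sum>i<N. \<epsilon> * \<psi> i y)"
      proof (rule sum_mono)
        fix i assume "i \<in> {..<N}"
        then have i: "i < N" by simp
        show "\<bar>(v (z i) - v y) * \<psi> i y\<bar> \<le> \<epsilon> * \<psi> i y"
        proof (cases "\<psi> i y = 0")
          case False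
          have "dist (z i) y < \<Lambda> * \<rho>"
            using zx[of i] near[OF i False] dist_triangle3[of "z i" y "x i"] r L\<rho> \<rho> unfolding r_def by linarith
          then show ?thesis using osc[of "z i" y] \<psi>(2)[OF i, of y] by (simp add: abs_mult mult_right_mono)
        qed simp
      qed
      also have "\<dots> = \<epsilon>" using \<psi>1[OF j] by (simp flip: sum_distrib_left)
      finally show ?thesis .
    next
      case False
      then have "y \<notin> ball a0 R0" "y \<notin> ball a0 (R0 + (L * \<rho> + \<rho>))" using r L\<rho> \<rho> unfolding mem_ball by linarith+
      then show ?thesis using support[of a0 R0 y] R0(2) \<epsilon> by simp
    qed
    have energy: "emeasure (\<Gamma> w) K \<le> ennreal (C / \<Psi> \<rho>) * D S v r"
      if S: "open S" and K: "K \<in> sets borel" and KS: "\<And>x. x \<in> K \<Longrightarrow> ball x (2 * \<Lambda> * \<rho>) \<subseteq> S" for S K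
    proof -
      have [measurable]: "S \<in> sets borel" using S by simp
      define F where "F = (\<lambda>y. 1 / emeasure m (ball y r) *
        (\<integral>\<^sup>+x\<in>S \<inter> ball y r. ennreal (\<bar>v x - v y\<bar> powr p) \<partial>m) * indicator S y)"
      have Fm [measurable]: "F \<in> borel_measurable borel"
      proof -
        have "F = (\<lambda>y. ennreal (1 / V y r) *
          (\<integral>\<^sup>+x. ennreal (\<bar>v x - v y\<bar> powr p) * (of_bool (x \<in> S) * of_bool (dist y x < r)) \<partial>m) * indicator S y)"
          unfolding F_def ennreal_inverse_V[OF r(1)]
          by (intro ext arg_cong2[where f = "(*)"] nn_integral_cong refl) (auto simp: indicator_def)
        also have "\<dots> \<in> borel_measurable borel" by measurable
        finally show ?thesis .
      qed
      have DF: "D S v r = (\<integral>\<^sup>+y. F y \<partial>m)" unfolding D_indicator F_def ..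
      \<comment> \<open>The share of \<open>D S v r\<close> that belongs to the surroundings of
        \<open>x j\<close>. Only the indices in \<open>J\<close>, whose balls meet \<open>K\<close>,
        are used.\<close>
      define U where "U = (\<lambda>j. \<integral>\<^sup>+y. F y * indicator (ball (x j) (2 * L * \<rho> + \<rho>)) y \<partial>m)"
      define J where "J = {j. j < N \<and> ball (x j) \<rho> \<inter> K \<noteq> {}}"
      define H where "H = M powr p * (2 * M) powr p * M * c"
      have H: "0 \<le> H" unfolding H_def using M c by simp
      \<comment> \<open>Since \<open>ball (x j) \<rho>\<close> meets \<open>K\<close>, all balls of
        radius \<open>r\<close> involved lie in \<open>S\<close>. There the restriction to
        \<open>S\<close> in \<open>F\<close> has no effect and \<open>G y = V y r * F y\<close>, so
        the mean of \<open>G\<close> is bounded by \<open>U j\<close>.\<close>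
      have mean: "G (z i) \<le> ennreal M * U j" if j: "j \<in> J" and i: "i < N" "dist (x j) (x i) < 2 * L * \<rho>" for i j
      proof -
        obtain q where q: "q \<in> K" "dist (x j) q < \<rho>" using j unfolding J_def by auto
        have GF: "G y * indicator (ball (x i) \<rho>) y
            \<le> ennreal (M * V (x i) \<rho>) * (F y * indicator (ball (x j) (2 * L * \<rho> + \<rho>)) y)" for y
        proof (cases "dist (x i) y < \<rho>")
          case True
          have jy: "dist (x j) y < 2 * L * \<rho> + \<rho>" using i True dist_triangle[of "x j" y "x i"] by simp
          then have "dist q y < r"
            using q dist_triangle3[of q y "x j"] r \<rho> by simp
          moreover have "dist q t < 2 * \<Lambda> * \<rho>" if "dist y t < r" for t
            using that \<open>dist q y < r\<close> dist_triangle[of q t y] unfolding r_def by linarith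
          ultimately have "ball y r \<subseteq> ball q (2 * \<Lambda> * \<rho>)" by auto
          then have yS: "ball y r \<subseteq> S" using KS[OF q(1)] by blast
          then have "S \<inter> ball y r = ball y r" "y \<in> S" using r(1) by auto
          then have "F y = ennreal (1 / V y r) * G y" unfolding F_def G_def ennreal_inverse_V[OF r(1)] by simp
          then have "G y = ennreal (V y r) * F y"
            using V_pos[OF r(1), of y] by (simp add: mult.assoc[symmetric] flip: ennreal_mult)
          also have "\<dots> \<le> ennreal (M * V (x i) \<rho>) * F y"
          proof (intro mult_right_mono ennreal_leI)
            have "dist (x i) y + r \<le> 2 ^ k * \<rho>" using True r L\<rho> \<rho> by linarith
            then show "V y r \<le> M * V (x i) \<rho>" unfolding M_def using \<rho> by (intro V_compare)
          qed simp
          finally show ?thesis using True jy by simp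
        qed simp
        have "G (z i) * ennreal (V (x i) \<rho>) \<le> (\<integral>\<^sup>+y. ennreal (M * V (x i) \<rho>) * (F y * indicator (ball (x j) (2 * L * \<rho> + \<rho>)) y) \<partial>m)"
          using zG[of i] nn_integral_mono[OF GF, of m] by (rule order_trans)
        also have "\<dots> = ennreal (M * V (x i) \<rho>) * U j" unfolding U_def by (rule nn_integral_cmult) measurable
        finally have le: "G (z i) * ennreal (V (x i) \<rho>) \<le> ennreal (M * V (x i) \<rho>) * U j" .
        have V1: "ennreal (V (x i) \<rho>) * ennreal (1 / V (x i) \<rho>) = 1"
          using V_pos[OF \<rho>(1), of "x i"] by (simp flip: ennreal_mult)
        have "G (z i) = G (z i) * ennreal (V (x i) \<rho>) * ennreal (1 / V (x i) \<rho>)"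
          by (simp only: mult.assoc V1 mult_1_right)
        also have "\<dots> \<le> ennreal (M * V (x i) \<rho>) * U j * ennreal (1 / V (x i) \<rho>)"
          by (rule mult_right_mono[OF le]) simp
        also have "\<dots> = ennreal M * U j * (ennreal (V (x i) \<rho>) * ennreal (1 / V (x i) \<rho>))"
          using M by (simp add: ennreal_mult ac_simps)
        finally show ?thesis unfolding V1 by simp
      qed
      have local: "emeasure (\<Gamma> w) (K \<inter> ball (x j) \<rho>) \<le> ennreal (H * (2 powr p * 2 * M * M)) * U j" if j: "j \<in> J" for j
      proof -
        have jN: "j < N" using j unfolding J_def by simp
        define nb where "nb = {i \<in> {..<N}. dist (x j) (x i) < 2 * L * \<rho>}"
        have nb: "finite nb" "real (card nb) \<le> M"
          using separated_index_card[OF inj sep \<rho>(1), of "2 * L * \<rho>" k "x j"] L\<rho> \<rho>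
          unfolding nb_def M_def by (auto simp: mult.assoc)
        have nbN: "i < N" "dist (x j) (x i) < 2 * L * \<rho>" if "i \<in> nb" for i using that unfolding nb_def by auto
        define d where "d = (\<lambda>i. v (z i) - v (z j))"
        \<comment> \<open>On \<open>ball (x j) \<rho>\<close> the partition sums to 1 and only
          neighbours of \<open>j\<close> are active, so \<open>w - h\<close> is the constant
          \<open>v (z j)\<close> there and strong locality replaces \<open>w\<close> by
          \<open>h\<close>. Its total energy is small because its coefficients are jumps of
          \<open>v\<close>.\<close>
        define h where "h = (\<lambda>y. \<Sum>i\<in>nb. d i * \<psi> i y)"
        have hF: "h \<in> \<F> \<inter> Cc"
          unfolding h_def using \<psi>(1) nbN by (auto intro!: \<F>_sum Cc_sum \<F>_scale Cc_cmult)
        have "w y - h y = v (z j)" if y: "y \<in> ball (x j) \<rho>" for y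
        proof -
          have "\<psi> i y = 0" if "i < N" "i \<notin> nb" for i
          proof (rule ccontr)
            assume "\<psi> i y \<noteq> 0"
            then have "dist (x i) y < L * \<rho>" by (rule near[OF that(1)])
            then have "dist (x j) (x i) < 2 * L * \<rho>"
              using y dist_triangle2[of "x j" "x i" y] L\<rho> by simp
            then show False using that unfolding nb_def by simp
          qed
          then have "h y = (\<Sum>i<N. d i * \<psi> i y)"
            unfolding h_def by (intro sum.mono_neutral_left) (auto simp: nb_def)
          then have "w y - h y = (\<Sum>i<N. v (z j) * \<psi> i y)"
            unfolding w_def d_def by (simp add: algebra_simps flip: sum_subtractf)
          then show ?thesis using \<psi>1[OF jN y] by (simp flip: sum_distrib_left)
        qed
        then have "emeasure (\<Gamma> w) (K \<inter> ball (x j) \<rho>) = emeasure (\<Gamma> h) (K \<inter> ball (x j) \<rho>)"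
          using K by (intro strongly_local[OF w hF, of "ball (x j) \<rho>" "v (z j)"]) auto
        also have "\<dots> \<le> ennreal (\<E> h)"
          using hF K measure_\<Gamma>_le[of h "K \<inter> ball (x j) \<rho>"] by (auto simp: emeasure_\<Gamma> intro: ennreal_leI)
        also have "ennreal (\<E> h) \<le> ennreal (H * (\<Sum>i\<in>nb. \<bar>d i\<bar> powr p * V (x j) \<rho>))"
        proof (rule ennreal_leI)
          define b where "b = (c * M * V (x j) \<rho>) powr (1 / p)"
          have "energy_root h \<le> (\<Sum>i\<in>nb. energy_root (\<lambda>y. d i * \<psi> i y))"
            unfolding h_def using \<psi>(1) nbN
            by (intro seminorm_on_sum[OF seminorm_energy_root linear_subspace] \<F>_scale) auto
          also have "\<dots> = (\<Sum>i\<in>nb. \<bar>d i\<bar> * energy_root (\<psi> i))"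
            using \<psi>(1) nbN by (intro sum.cong refl seminorm_on_scale[OF seminorm_energy_root]) auto
          also have "\<dots> \<le> (\<Sum>i\<in>nb. \<bar>d i\<bar> * (2 * M * b))"
            unfolding b_def using nbN jN by (intro sum_mono mult_left_mono \<psi>e) auto
          also have "\<dots> = (\<Sum>i\<in>nb. \<bar>d i\<bar>) * (2 * M * b)" by (rule sum_distrib_right[symmetric])
          finally have "energy_root h powr p \<le> ((\<Sum>i\<in>nb. \<bar>d i\<bar>) * (2 * M * b)) powr p"
            using p by (intro powr_mono2) (auto simp: energy_root_def)
          also have "\<dots> = (\<Sum>i\<in>nb. \<bar>d i\<bar>) powr p * ((2 * M) powr p * b powr p)"
            using M by (simp add: powr_mult sum_nonneg b_def)
          also have "b powr p = c * M * V (x j) \<rho>"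
            unfolding b_def using p c M by (simp add: powr_powr)
          also have "(\<Sum>i\<in>nb. \<bar>d i\<bar>) powr p \<le> real (card nb) powr p * (\<Sum>i\<in>nb. \<bar>d i\<bar> powr p)"
            using p by (intro sum_powr_le) auto
          also have "\<dots> \<le> M powr p * (\<Sum>i\<in>nb. \<bar>d i\<bar> powr p)"
            using nb p by (intro mult_right_mono powr_mono2 sum_nonneg) auto
          finally have "energy_root h powr p \<le> M powr p * (\<Sum>i\<in>nb. \<bar>d i\<bar> powr p) * ((2 * M) powr p * (c * M * V (x j) \<rho>))"
            using c M by (simp add: mult_right_mono)
          also have "\<dots> = H * (\<Sum>i\<in>nb. \<bar>d i\<bar> powr p * V (x j) \<rho>)"
            unfolding H_def by (simp add: sum_distrib_right[symmetric])
          finally show "\<E> h \<le> H * (\<Sum>i\<in>nb. \<bar>d i\<bar> powr p * V (x j) \<rho>)" using hF by (simp add: energy_eq)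
        qed
        also have "ennreal (H * (\<Sum>i\<in>nb. \<bar>d i\<bar> powr p * V (x j) \<rho>))
            = ennreal H * (\<Sum>i\<in>nb. ennreal (\<bar>d i\<bar> powr p * V (x j) \<rho>))"
          by (subst sum_ennreal, simp, rule ennreal_mult[OF H]) (simp add: sum_nonneg)
        also have "\<dots> \<le> ennreal H * (\<Sum>i\<in>nb. ennreal (2 powr p * 2 * M) * U j)"
        proof (intro mult_left_mono sum_mono)
          fix i assume i: "i \<in> nb"
          have sub: "ball (x j) \<rho> \<subseteq> ball (z l) r" if "dist (x j) (x l) < 2 * L * \<rho>" for l
          proof
            fix y assume "y \<in> ball (x j) \<rho>"
            then have "dist (z l) y < r"
              using zx[of l] that dist_triangle[of "z l" y "x l"] dist_triangle[of "x l" y "x j"] r(2) \<rho>(1)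
              by (simp add: dist_commute)
            then show "y \<in> ball (z l) r" by simp
          qed
          have jj: "dist (x j) (x j) < 2 * L * \<rho>" using L\<rho> \<rho> by simp
          have "ennreal (\<bar>d i\<bar> powr p * V (x j) \<rho>) \<le> ennreal (2 powr p) * (G (z i) + G (z j))"
            unfolding d_def G_def
            by (intro jump_le_oscillation \<rho>(1) sub nbN(2)[OF i] jj) measurable
          also have "\<dots> \<le> ennreal (2 powr p) * (ennreal M * U j + ennreal M * U j)"
            by (intro mult_left_mono add_mono mean j nbN[OF i] jN jj) simp
          also have "\<dots> = ennreal (2 powr p * 2 * M) * U j"
          proof -
            have "ennreal (2 powr p * 2 * M) = ennreal (2 powr p) * (ennreal M + ennreal M)"
              using M by (simp flip: ennreal_plus ennreal_mult)
            then show ?thesis by (simp only: distrib_left distrib_right mult.assoc)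
          qed
          finally show "ennreal (\<bar>d i\<bar> powr p * V (x j) \<rho>) \<le> ennreal (2 powr p * 2 * M) * U j" .
        qed simp
        also have "\<dots> = ennreal H * (ennreal (real (card nb)) * (ennreal (2 powr p * 2 * M) * U j))"
          by (simp add: ennreal_of_nat_eq_real_of_nat)
        also have "\<dots> \<le> ennreal H * (ennreal M * (ennreal (2 powr p * 2 * M) * U j))"
          using nb by (intro mult_left_mono mult_right_mono ennreal_leI) auto
        also have "\<dots> = ennreal (H * (2 powr p * 2 * M * M)) * U j"
          using H M by (simp add: ennreal_mult ac_simps)
        finally show ?thesis .
      qed
      \<comment> \<open>A point lies in at most \<open>M\<close> of the enlarged balls.\<close>
      have overlap: "(\<Sum>j\<in>J. U j) \<le> ennreal M * D S v r"
      proof -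
        have "(\<Sum>j\<in>J. U j) = (\<integral>\<^sup>+y. (\<Sum>j\<in>J. F y * indicator (ball (x j) (2 * L * \<rho> + \<rho>)) y) \<partial>m)"
          unfolding U_def by (rule nn_integral_sum[symmetric]) measurable
        also have "\<dots> \<le> (\<integral>\<^sup>+y. ennreal M * F y \<partial>m)"
        proof (rule nn_integral_mono)
          fix y
          let ?A = "{i \<in> {..<N}. dist y (x i) < 2 * L * \<rho> + \<rho>}"
          have A: "finite ?A" "real (card ?A) \<le> M"
            using separated_index_card[OF inj sep \<rho>(1), of "2 * L * \<rho> + \<rho>" k y] L\<rho> \<rho>
            unfolding M_def by (auto simp: algebra_simps)
          have "(\<Sum>j\<in>J. F y * indicator (ball (x j) (2 * L * \<rho> + \<rho>)) y)
              \<le> (\<Sum>j<N. F y * indicator (ball (x j) (2 * L * \<rho> + \<rho>)) y)"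
            by (intro sum_mono2) (auto simp: J_def)
          also have "\<dots> = (\<Sum>j\<in>?A. F y)"
            by (intro sum.mono_neutral_cong_right) (auto simp: indicator_def dist_commute)
          also have "\<dots> = ennreal (real (card ?A)) * F y" by (simp add: ennreal_of_nat_eq_real_of_nat)
          also have "\<dots> \<le> ennreal M * F y" using A by (intro mult_right_mono ennreal_leI) auto
          finally show "(\<Sum>j\<in>J. F y * indicator (ball (x j) (2 * L * \<rho> + \<rho>)) y) \<le> ennreal M * F y" .
        qed
        also have "\<dots> = ennreal M * D S v r" unfolding DF by (rule nn_integral_cmult) measurable
        finally show ?thesis .
      qed
      \<comment> \<open>The part of \<open>K\<close> not covered by the net lies in the open set
        \<open>Z\<close>, where \<open>w = 0\<close>; by locality it carries no energy.\<close>
      define Z where "Z = - cball a0 (R0 + (L * \<rho> + \<rho>))"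
      have "open Z" unfolding Z_def by (simp add: open_Compl)
      have "emeasure (\<Gamma> w) (K \<inter> Z) = emeasure (\<Gamma> (\<lambda>x. 0)) (K \<inter> Z)"
      proof (rule strongly_local[OF w _ \<open>open Z\<close>, of _ 0])
        show "w y - 0 = 0" if "y \<in> Z" for y
          using that support[of a0 R0 y, OF R0(2)] unfolding Z_def by simp
      qed (use K \<F>_zero \<open>open Z\<close> in auto)
      also have "\<dots> = 0" using K \<open>open Z\<close> by (simp add: emeasure_\<Gamma>[OF \<F>_zero] measure_\<Gamma>_zero)
      finally have KZ: "emeasure (\<Gamma> w) (K \<inter> Z) = 0" .
      have setsw: "sets (\<Gamma> w) = sets borel" using w by (intro measure_sets) auto
      have finJ: "finite J" unfolding J_def by simp
      have "K \<subseteq> (\<Union>j\<in>J. K \<inter> ball (x j) \<rho>) \<union> (K \<inter> Z)"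
      proof
        fix y assume y: "y \<in> K"
        show "y \<in> (\<Union>j\<in>J. K \<inter> ball (x j) \<rho>) \<union> (K \<inter> Z)"
        proof (cases "y \<in> ball a0 (R0 + r)")
          case True
          then obtain j where "j < N" "y \<in> ball (x j) \<rho>" using cover by blast
          then show ?thesis using y unfolding J_def by blast
        next
          case False
          then have "y \<in> Z" unfolding Z_def Compl_iff mem_ball mem_cball using r L\<rho> \<rho> by linarith
          then show ?thesis using y by blast
        qed
      qed
      then have "emeasure (\<Gamma> w) K \<le> emeasure (\<Gamma> w) ((\<Union>j\<in>J. K \<inter> ball (x j) \<rho>) \<union> (K \<inter> Z))"
        using K \<open>open Z\<close> finJ by (intro emeasure_mono) (auto simp: setsw)
      also have "\<dots> \<le> emeasure (\<Gamma> w) (\<Union>j\<in>J. K \<inter> ball (x j) \<rho>) + emeasure (\<Gamma> w) (K \<inter> Z)"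
        using K \<open>open Z\<close> finJ by (intro emeasure_subadditive) (auto simp: setsw)
      also have "\<dots> \<le> (\<Sum>j\<in>J. emeasure (\<Gamma> w) (K \<inter> ball (x j) \<rho>))"
        unfolding KZ add_0_right using K finJ by (intro emeasure_subadditive_finite) (auto simp: setsw)
      also have "\<dots> \<le> (\<Sum>j\<in>J. ennreal (H * (2 powr p * 2 * M * M)) * U j)" by (intro sum_mono local)
      also have "\<dots> = ennreal (H * (2 powr p * 2 * M * M)) * (\<Sum>j\<in>J. U j)" by (rule sum_distrib_left[symmetric])
      also have "\<dots> \<le> ennreal (H * (2 powr p * 2 * M * M)) * (ennreal M * D S v r)"
        by (intro mult_left_mono overlap) simp
      also have "\<dots> = ennreal (H * (2 powr p * 2 * M * M) * M) * D S v r"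
      proof -
        have "ennreal (H * (2 powr p * 2 * M * M) * M) = ennreal (H * (2 powr p * 2 * M * M)) * ennreal M"
          using H M by (intro ennreal_mult) auto
        then show ?thesis by (simp only: mult.assoc)
      qed
      also have "H * (2 powr p * 2 * M * M) * M = C / \<Psi> \<rho>" unfolding H_def C_def c_def by simp
      finally show ?thesis .
    qed
    have "ball a R \<subseteq> ball a (R + \<Lambda> * \<rho>)" "ball a (R + (L * \<rho> + \<rho>)) \<subseteq> ball a (R + \<Lambda> * \<rho>)" for a :: 'a and R
      using r L\<rho> \<rho> unfolding r_def by (intro subset_ball; linarith)+
    then have support': "\<forall>a R. (\<forall>x. x \<notin> ball a R \<longrightarrow> v x = 0) \<longrightarrow> (\<forall>x. x \<notin> ball a (R + \<Lambda> * \<rho>) \<longrightarrow> w x = 0)"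
      using support by (metis subsetD)
    show "\<exists>w\<in>\<F> \<inter> Cc.
      (\<forall>\<epsilon>\<ge>0. (\<forall>x y. dist x y < \<Lambda> * \<rho> \<longrightarrow> \<bar>v x - v y\<bar> \<le> \<epsilon>) \<longrightarrow> (\<forall>x. \<bar>w x - v x\<bar> \<le> \<epsilon>)) \<and>
      (\<forall>a R. (\<forall>x. x \<notin> ball a R \<longrightarrow> v x = 0) \<longrightarrow> (\<forall>x. x \<notin> ball a (R + \<Lambda> * \<rho>) \<longrightarrow> w x = 0)) \<and>
      (\<forall>S K. open S \<longrightarrow> K \<in> sets borel \<longrightarrow> (\<forall>x\<in>K. ball x (2 * \<Lambda> * \<rho>) \<subseteq> S) \<longrightarrow>
         emeasure (\<Gamma> w) K \<le> ennreal (C / \<Psi> \<rho>) * D S v (\<Lambda> * \<rho>))"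
      using w close support' energy unfolding r_def by (intro bexI[of _ w] conjI allI impI) auto
  qed
qed

section \<open>The lower bound for continuous functions\<close>

lemma Cc_uniformly_continuous:
  assumes v: "(v :: 'a \<Rightarrow> real) \<in> Cc" and \<epsilon>: "0 < \<epsilon>"
  obtains \<delta> where "0 < \<delta>" "\<And>x y. dist x y < \<delta> \<Longrightarrow> \<bar>v x - v y\<bar> \<le> \<epsilon>"
proof -
  fix a :: 'a
  obtain R where R: "\<And>x. x \<notin> ball a R \<Longrightarrow> v x = 0" using Cc_bounded_support[OF v] by metis
  have "uniformly_continuous_on (cball a (R + 1)) v"
    using v unfolding Cc_def by (intro compact_uniformly_continuous) (auto intro: continuous_on_subset)
  then obtain \<delta> where \<delta>: "\<delta> > 0" "\<And>x y. x \<in> cball a (R + 1) \<Longrightarrow> y \<in> cball a (R + 1) \<Longrightarrow> dist y x < \<delta> \<Longrightarrow> dist (v y) (v x) < \<epsilon>"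
    using \<epsilon> unfolding uniformly_continuous_on_def by metis
  show ?thesis
  proof (rule that[of "min \<delta> 1"])
    fix x y :: 'a assume xy: "dist x y < min \<delta> 1"
    show "\<bar>v x - v y\<bar> \<le> \<epsilon>"
    proof (cases "x \<in> cball a (R + 1) \<and> y \<in> cball a (R + 1)")
      case True
      then show ?thesis using \<delta>(2)[of y x] xy by (simp add: dist_real_def less_imp_le)
    next
      case False
      then have "\<not> dist a x < R \<and> \<not> dist a y < R"
        using xy dist_triangle[of a x y] dist_triangle[of a y x] by (auto simp: dist_commute not_le not_less)
      then show ?thesis using R[of x] R[of y] \<epsilon> by simp
    qed
  qed (use \<delta> in simp)
qed

text \<open>A lower limit is encoded by \<open>frequently\<close>: it yields one sequence of radii
  along which the discretizations satisfy the bound on \<open>K\<close>. They converge to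
  \<open>v\<close> in the Lebesgue space with bounded energy, so convex combinations converge in
  energy and keep the bound. The distance \<open>s\<close> from \<open>K\<close> to the complement
  of \<open>S\<close> absorbs the enlargement in \<open>discretization\<close>.\<close>

lemma lower_bound_Cc:
  obtains C where "0 < C"
    "\<And>v S K s b. v \<in> \<F> \<inter> Cc \<Longrightarrow> open S \<Longrightarrow> K \<in> sets borel \<Longrightarrow> 0 < s \<Longrightarrow> \<forall>x\<in>K. ball x s \<subseteq> S \<Longrightarrow>
       0 \<le> b \<Longrightarrow> frequently (\<lambda>r. D S v r \<le> ennreal (b * \<Psi> r)) (at_right 0) \<Longrightarrow> measure (\<Gamma> v) K \<le> C * b"
proof -
  obtain C\<^sub>1 \<Lambda> \<rho>\<^sub>0 where C\<^sub>1: "0 < C\<^sub>1" and \<Lambda>: "1 \<le> \<Lambda>" and \<rho>\<^sub>0: "0 < \<rho>\<^sub>0"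
    and disc: "\<And>\<rho> v. 0 < \<rho> \<Longrightarrow> \<rho> < \<rho>\<^sub>0 \<Longrightarrow> v \<in> \<F> \<inter> Cc \<Longrightarrow> \<exists>w\<in>\<F> \<inter> Cc.
      (\<forall>\<epsilon>\<ge>0. (\<forall>x y. dist x y < \<Lambda> * \<rho> \<longrightarrow> \<bar>v x - v y\<bar> \<le> \<epsilon>) \<longrightarrow> (\<forall>x. \<bar>w x - v x\<bar> \<le> \<epsilon>)) \<and>
      (\<forall>a R. (\<forall>x. x \<notin> ball a R \<longrightarrow> v x = 0) \<longrightarrow> (\<forall>x. x \<notin> ball a (R + \<Lambda> * \<rho>) \<longrightarrow> w x = 0)) \<and>
      (\<forall>S K. open S \<longrightarrow> K \<in> sets borel \<longrightarrow> (\<forall>x\<in>K. ball x (2 * \<Lambda> * \<rho>) \<subseteq> S) \<longrightarrow>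
         emeasure (\<Gamma> w) K \<le> ennreal (C\<^sub>1 / \<Psi> \<rho>) * D S v (\<Lambda> * \<rho>))"
    by (rule discretization) (rule that)
  obtain C\<^sub>u \<kappa> where C\<^sub>u: "1 \<le> C\<^sub>u" and upper: "\<And>S u r. open S \<Longrightarrow> u \<in> \<F> \<Longrightarrow> 0 < r \<Longrightarrow>
      D S u r \<le> ennreal (C\<^sub>u * \<Psi> r) * emeasure (\<Gamma> u) (nbhd S (\<kappa> * r))"
    by (rule D_upper) (rule that)
  obtain C\<^sub>2 where C\<^sub>2: "1 \<le> C\<^sub>2" "\<And>r. 0 < r \<Longrightarrow> \<Psi> (\<Lambda> * r) \<le> C\<^sub>2 * \<Psi> r" using \<Psi>_mult[OF \<Lambda>] by metis
  have main: "measure (\<Gamma> v) K \<le> C\<^sub>1 * C\<^sub>2 * b"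
    if v: "v \<in> \<F> \<inter> Cc" and S: "open S" and K: "K \<in> sets borel" and s: "0 < s" and KS: "\<forall>x\<in>K. ball x s \<subseteq> S"
      and b: "0 \<le> b" and freq: "frequently (\<lambda>r. D S v r \<le> ennreal (b * \<Psi> r)) (at_right 0)" for v S K s b
  proof -
    have "\<exists>r>0. r < t \<and> D S v r \<le> ennreal (b * \<Psi> r)" if "t > 0" for t
      using freq that unfolding frequently_def eventually_at_right_field by blast
    \<comment> \<open>\<open>s / 2\<close> keeps the balls of radius \<open>2 * r n\<close> about
      points of \<open>K\<close> inside \<open>S\<close>, and
      \<open>\<Lambda> * \<rho>\<^sub>0\<close> keeps \<open>\<rho> n\<close> in the admissible
      range.\<close>
    moreover have "min (1 / real (Suc n)) (min (s / 2) (\<Lambda> * \<rho>\<^sub>0)) > 0" for n using s \<Lambda> \<rho>\<^sub>0 by simp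
    ultimately have "\<exists>r>0. r < min (1 / real (Suc n)) (min (s / 2) (\<Lambda> * \<rho>\<^sub>0)) \<and> D S v r \<le> ennreal (b * \<Psi> r)" for n
      by blast
    then obtain r where r: "\<And>n. 0 < r n" "\<And>n. r n < min (1 / real (Suc n)) (min (s / 2) (\<Lambda> * \<rho>\<^sub>0))"
      and rD: "\<And>n. D S v (r n) \<le> ennreal (b * \<Psi> (r n))" by metis
    define \<rho> where "\<rho> = (\<lambda>n. r n / \<Lambda>)"
    have \<rho>: "0 < \<rho> n" "\<rho> n < \<rho>\<^sub>0" "\<Lambda> * \<rho> n = r n" for n
      using r(1)[of n] r(2)[of n] \<Lambda> unfolding \<rho>_def by (auto simp: field_simps)
    define P where "P = (\<lambda>n w. w \<in> \<F> \<inter> Cc \<and>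
      (\<forall>\<epsilon>\<ge>0. (\<forall>x y. dist x y < r n \<longrightarrow> \<bar>v x - v y\<bar> \<le> \<epsilon>) \<longrightarrow> (\<forall>x. \<bar>w x - v x\<bar> \<le> \<epsilon>)) \<and>
      (\<forall>a R. (\<forall>x. x \<notin> ball a R \<longrightarrow> v x = 0) \<longrightarrow> (\<forall>x. x \<notin> ball a (R + r n) \<longrightarrow> w x = 0)) \<and>
      (\<forall>S K. open S \<longrightarrow> K \<in> sets borel \<longrightarrow> (\<forall>x\<in>K. ball x (2 * r n) \<subseteq> S) \<longrightarrow>
         emeasure (\<Gamma> w) K \<le> ennreal (C\<^sub>1 / \<Psi> (\<rho> n)) * D S v (r n)))"
    have "\<exists>w. P n w" for n
      using disc[OF \<rho>(1)[of n] \<rho>(2)[of n] v] unfolding mult.assoc \<rho>(3) Bex_def P_def .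
    then obtain w where "\<And>n. P n (w n)" by metis
    note Pw = this[unfolded P_def, THEN conjunct1] this[unfolded P_def, THEN conjunct2, THEN conjunct1, rule_format]
      this[unfolded P_def, THEN conjunct2, THEN conjunct2, THEN conjunct1, rule_format]
      this[unfolded P_def, THEN conjunct2, THEN conjunct2, THEN conjunct2, rule_format]
    have w: "w n \<in> \<F> \<inter> Cc" for n by (rule Pw(1))
    have close: "\<bar>w n x - v x\<bar> \<le> \<epsilon>" if "\<epsilon> \<ge> 0" "\<forall>x y. dist x y < r n \<longrightarrow> \<bar>v x - v y\<bar> \<le> \<epsilon>" for n \<epsilon> x
      using that by (intro Pw(2)) auto
    have supp: "w n x = 0" if "\<forall>x. x \<notin> ball a R \<longrightarrow> v x = 0" "x \<notin> ball a (R + r n)" for n a R x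
      using that by (intro Pw(3)[of a R]) auto
    have energy: "emeasure (\<Gamma> (w n)) K \<le> ennreal (C\<^sub>1 / \<Psi> (\<rho> n)) * D S v (r n)"
      if "open S" "K \<in> sets borel" "\<forall>x\<in>K. ball x (2 * r n) \<subseteq> S" for n S K
      using that by (intro Pw(4)) auto
    have wF: "w n \<in> \<F>" for n using w by auto
    have vF: "v \<in> \<F>" using v by auto
    \<comment> \<open>\<open>r n\<close> and \<open>\<rho> n\<close> have the fixed ratio
      \<open>\<Lambda>\<close>, so the values of \<open>\<Psi>\<close> cancel up to
      \<open>C\<^sub>2\<close>.\<close>
    have meas: "measure (\<Gamma> (w n)) K' \<le> C\<^sub>1 * C\<^sub>2 * t"
      if "emeasure (\<Gamma> (w n)) K' \<le> ennreal (C\<^sub>1 / \<Psi> (\<rho> n)) * ennreal (t * \<Psi> (r n))" "0 \<le> t" for n K' t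
    proof -
      have "C\<^sub>1 / \<Psi> (\<rho> n) * (t * \<Psi> (r n)) \<le> C\<^sub>1 / \<Psi> (\<rho> n) * (t * (C\<^sub>2 * \<Psi> (\<rho> n)))"
        using C\<^sub>2(2)[OF \<rho>(1)[of n]] C\<^sub>1 \<Psi>_pos[OF \<rho>(1)[of n]] that(2) unfolding \<rho>(3)
        by (intro mult_left_mono) auto
      also have "\<dots> = C\<^sub>1 * C\<^sub>2 * t" using \<Psi>_pos[OF \<rho>(1)[of n]] by simp
      finally have "ennreal (C\<^sub>1 / \<Psi> (\<rho> n) * (t * \<Psi> (r n))) \<le> ennreal (C\<^sub>1 * C\<^sub>2 * t)" by (rule ennreal_leI)
      moreover have "ennreal (C\<^sub>1 / \<Psi> (\<rho> n) * (t * \<Psi> (r n))) = ennreal (C\<^sub>1 / \<Psi> (\<rho> n)) * ennreal (t * \<Psi> (r n))"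
        using C\<^sub>1 \<Psi>_pos[OF \<rho>(1)[of n]] \<Psi>_pos[OF r(1)[of n]] that(2) by (intro ennreal_mult) auto
      ultimately have "ennreal (measure (\<Gamma> (w n)) K') \<le> ennreal (C\<^sub>1 * C\<^sub>2 * t)"
        using that(1) by (simp add: emeasure_\<Gamma>[OF wF])
      then show ?thesis using C\<^sub>1 C\<^sub>2 that(2) by simp
    qed
    have wK: "measure (\<Gamma> (w n)) K \<le> C\<^sub>1 * C\<^sub>2 * b" for n
    proof (rule meas[OF _ b])
      have "ball x (2 * r n) \<subseteq> S" if "x \<in> K" for x
      proof -
        have "ball x (2 * r n) \<subseteq> ball x s" using r(2)[of n] by (intro subset_ball) simp
        then show ?thesis using KS that by blast
      qed
      then have "emeasure (\<Gamma> (w n)) K \<le> ennreal (C\<^sub>1 / \<Psi> (\<rho> n)) * D S v (r n)"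
        using energy[OF S K] by blast
      also have "\<dots> \<le> ennreal (C\<^sub>1 / \<Psi> (\<rho> n)) * ennreal (b * \<Psi> (r n))" by (intro mult_left_mono rD) simp
      finally show "emeasure (\<Gamma> (w n)) K \<le> ennreal (C\<^sub>1 / \<Psi> (\<rho> n)) * ennreal (b * \<Psi> (r n))" .
    qed
    \<comment> \<open>The bound on total energies that Mazur's lemma requires: the same estimate
      with the whole space in place of \<open>K\<close> and \<open>S\<close>, combined with the
      upper bound for \<open>v\<close>.\<close>
    have wE: "energy_root (w n) \<le> (C\<^sub>1 * C\<^sub>2 * (C\<^sub>u * \<E> v)) powr (1 / p)" for n
    proof -
      have "emeasure (\<Gamma> (w n)) UNIV \<le> ennreal (C\<^sub>1 / \<Psi> (\<rho> n)) * D UNIV v (r n)"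
        by (rule energy) auto
      also have "D UNIV v (r n) \<le> ennreal (C\<^sub>u * \<Psi> (r n)) * emeasure (\<Gamma> v) (nbhd UNIV (\<kappa> * r n))"
        by (rule upper[OF open_UNIV vF r(1)])
      also have "\<dots> \<le> ennreal (C\<^sub>u * \<Psi> (r n)) * ennreal (\<E> v)"
        using measure_\<Gamma>_le[OF vF, of "nbhd UNIV (\<kappa> * r n)"] by (intro mult_left_mono) (auto simp: emeasure_\<Gamma>[OF vF] intro: ennreal_leI)
      also have "\<dots> = ennreal (C\<^sub>u * \<E> v * \<Psi> (r n))"
        using C\<^sub>u \<Psi>_pos[OF r(1)[of n]] energy_nonneg[OF vF] by (subst ennreal_mult[symmetric]) (auto simp: ac_simps)
      finally have "emeasure (\<Gamma> (w n)) UNIV \<le> ennreal (C\<^sub>1 / \<Psi> (\<rho> n)) * ennreal (C\<^sub>u * \<E> v * \<Psi> (r n))"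
        by (simp add: mult_left_mono)
      then have "\<E> (w n) \<le> C\<^sub>1 * C\<^sub>2 * (C\<^sub>u * \<E> v)"
        using meas[of n UNIV] C\<^sub>u energy_nonneg[OF vF] by (simp add: total_mass[OF wF])
      then show ?thesis unfolding energy_root_def using energy_nonneg[OF wF] p by (intro powr_mono2) auto
    qed
    have lim: "(\<lambda>n. Lp_norm m p (\<lambda>x. w n x - v x)) \<longlonglongrightarrow> 0"
    proof -
      fix a :: 'a
      obtain R where R: "\<And>x. x \<notin> ball a R \<Longrightarrow> v x = 0" using Cc_bounded_support[of v a] v by auto
      define W where "W = V a (R + 1) powr (1 / p)"
      have W: "0 \<le> W" unfolding W_def by simp
      \<comment> \<open>As \<open>r n \<le> 1\<close>, all differences \<open>w n - v\<close> vanish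
        off one fixed ball, so uniform closeness yields convergence in the Lebesgue space.\<close>
      have bound: "Lp_norm m p (\<lambda>x. w n x - v x) \<le> \<epsilon> * W" if "\<epsilon> \<ge> 0" "\<forall>x y. dist x y < r n \<longrightarrow> \<bar>v x - v y\<bar> \<le> \<epsilon>" for n \<epsilon>
      proof -
        have r1: "r n \<le> 1"
        proof -
          have "1 / real (Suc n) \<le> 1" by simp
          then show ?thesis using r(2)[of n] by linarith
        qed
        have pw: "\<bar>w n x - v x\<bar> powr p \<le> \<epsilon> powr p * indicator (ball a (R + 1)) x" for x
        proof (cases "x \<in> ball a (R + 1)")
          case True
          then show ?thesis using close[OF that, of x] p by (auto intro: powr_mono2)
        next
          case False
          then have "x \<notin> ball a R" "x \<notin> ball a (R + r n)" using r1 by auto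
          then show ?thesis using supp[of a R x n] R by auto
        qed
        have "(\<integral>x. \<bar>w n x - v x\<bar> powr p \<partial>m) \<le> (\<integral>x. \<epsilon> powr p * indicator (ball a (R + 1)) x \<partial>m)"
        proof (rule integral_mono[OF _ _ pw])
          show "integrable m (\<lambda>x. \<bar>w n x - v x\<bar> powr p)"
            using in_Lp \<F>_diff[OF wF vF] unfolding Lp_functions_def by auto
          show "integrable m (\<lambda>x. \<epsilon> powr p * indicator (ball a (R + 1)) x)"
            using emeasure_ball_finite by (intro integrable_mult_right integrable_real_indicator) auto
        qed
        also have "\<dots> = \<epsilon> powr p * V a (R + 1)" by (simp add: V_def)
        finally have "Lp_norm m p (\<lambda>x. w n x - v x) \<le> (\<epsilon> powr p * V a (R + 1)) powr (1 / p)"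
          unfolding Lp_norm_def using p by (intro powr_mono2) auto
        also have "\<dots> = \<epsilon> * W" unfolding W_def using p that(1) by (simp add: powr_mult powr_powr)
        finally show ?thesis .
      qed
      show ?thesis
      proof (rule order_tendstoI)
        fix t :: real assume "t < 0"
        moreover have "0 \<le> Lp_norm m p (\<lambda>x. w n x - v x)" for n unfolding Lp_norm_def by simp
        ultimately show "eventually (\<lambda>n. t < Lp_norm m p (\<lambda>x. w n x - v x)) sequentially"
          by (intro always_eventually allI) (rule less_le_trans)
      next
        fix t :: real assume t: "0 < t"
        define \<epsilon> where "\<epsilon> = t / 2 / (W + 1)"
        have \<epsilon>: "\<epsilon> > 0" unfolding \<epsilon>_def using t W by simp
        obtain \<delta> where \<delta>: "0 < \<delta>" "\<And>x y. dist x y < \<delta> \<Longrightarrow> \<bar>v x - v y\<bar> \<le> \<epsilon>"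
          using Cc_uniformly_continuous[of v, OF _ \<epsilon>] v by auto
        obtain N where N: "1 / real (Suc N) < \<delta>" using \<delta>(1) by (rule nat_approx_posE)
        have "Lp_norm m p (\<lambda>x. w n x - v x) < t" if "n \<ge> N" for n
        proof -
          have "1 / real (Suc n) \<le> 1 / real (Suc N)" using that by (intro divide_left_mono) auto
          then have "r n < \<delta>" using r(2)[of n] N by linarith
          then have "Lp_norm m p (\<lambda>x. w n x - v x) \<le> \<epsilon> * W" using \<delta>(2) \<epsilon> by (intro bound) auto
          also have "\<dots> \<le> \<epsilon> * (W + 1)" using \<epsilon> by (intro mult_left_mono) auto
          also have "\<dots> = t / 2"
          proof -
            have "W + 1 \<noteq> 0" using W by simp
            from nonzero_eq_divide_eq[OF this, THEN iffD1, OF \<epsilon>_def] show ?thesis .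
          qed
          finally show ?thesis using t by simp
        qed
        then show "eventually (\<lambda>n. Lp_norm m p (\<lambda>x. w n x - v x) < t) sequentially"
          unfolding eventually_sequentially by blast
      qed
    qed
    define B where "B = (C\<^sub>1 * C\<^sub>2 * b) powr (1 / p)"
    \<comment> \<open>A sublevel set of a seminorm, hence convex. \<open>measure_root K\<close> is
      continuous for the energy norm, being dominated by \<open>energy_root\<close>, so the bound
      passes to \<open>v\<close>.\<close>
    define Q where "Q = {h \<in> \<F>. measure_root K h \<le> B}"
    note sg = seminorm_measure_root[OF K]
    have convQ: "convex_functions Q"
      unfolding convex_functions_def
    proof (intro ballI allI impI)
      fix f h and s t :: real assume fh: "f \<in> Q" "h \<in> Q" and st: "0 \<le> s" "0 \<le> t" "s + t = 1"
      have F: "f \<in> \<F>" "h \<in> \<F>" using fh unfolding Q_def by auto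
      have "measure_root K (\<lambda>x. s * f x + t * h x) \<le> measure_root K (\<lambda>x. s * f x) + measure_root K (\<lambda>x. t * h x)"
        by (intro seminorm_on_add[OF sg] \<F>_scale F)
      also have "\<dots> = s * measure_root K f + t * measure_root K h"
        using st by (simp add: seminorm_on_scale[OF sg F(1), of s] seminorm_on_scale[OF sg F(2), of t])
      also have "\<dots> \<le> B" using fh st unfolding Q_def by (intro convex_bound_le) auto
      finally show "(\<lambda>x. s * f x + t * h x) \<in> Q" unfolding Q_def using F by (auto intro: \<F>_add \<F>_scale)
    qed
    have "w n \<in> Q" for n
      unfolding Q_def B_def measure_root_def using wF wK[of n] p by (auto intro!: powr_mono2)
    then have ev: "eventually (\<lambda>n. w n \<in> Q) sequentially" by simp
    have "measure_root K v \<le> B + \<epsilon>" if "\<epsilon> > 0" for \<epsilon>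
    proof -
      have "Q \<subseteq> \<F>" unfolding Q_def by auto
      from energy_mazur[OF wF wE vF lim this convQ ev that]
      obtain h where h: "h \<in> Q" "energy_norm m p \<E> (\<lambda>x. h x - v x) < \<epsilon>" .
      then have hF: "h \<in> \<F>" and hB: "measure_root K h \<le> B" unfolding Q_def by auto
      have "measure_root K (\<lambda>x. h x - (h x - v x)) \<le> measure_root K h + measure_root K (\<lambda>x. h x - v x)"
        by (intro seminorm_on_diff[OF sg linear_subspace] \<F>_diff hF vF)
      moreover have "measure_root K (\<lambda>x. h x - v x) \<le> energy_root (\<lambda>x. h x - v x)"
        by (intro measure_root_le \<F>_diff hF vF K)
      moreover have "energy_root (\<lambda>x. h x - v x) \<le> energy_norm m p \<E> (\<lambda>x. h x - v x)"
        unfolding energy_norm_def energy_root_def Lp_norm_def by simp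
      ultimately show ?thesis using hB h(2) by simp
    qed
    then have "measure_root K v \<le> B" by (rule field_le_epsilon)
    then have "measure_root K v powr p \<le> B powr p" using p by (intro powr_mono2) (auto simp: measure_root_def)
    then show ?thesis unfolding energy_measure_eq B_def using p C\<^sub>1 C\<^sub>2 b by (simp add: powr_powr)
  qed
  show ?thesis by (rule that[of "C\<^sub>1 * C\<^sub>2"]) (use C\<^sub>1 C\<^sub>2 main in auto)
qed

section \<open>Extension of the lower bound to the whole domain\<close>

text \<open>Meant for a continuous approximation \<open>v\<close> of \<open>u\<close>; the term with
  the difference is then controlled by the upper bound.\<close>

lemma D_add_le:
  assumes u: "u \<in> \<F>" and v: "v \<in> \<F>" and S: "open S" and r: "0 < r"
  shows "D S v r \<le> ennreal (2 powr p) * (D S u r + D S (\<lambda>x. u x - v x) r)"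
proof -
  interpret sigma_finite_measure m by (rule sigma_finite)
  have [measurable]: "u \<in> borel_measurable borel" "v \<in> borel_measurable borel" using \<F>_measurable u v by auto
  have [measurable]: "S \<in> sets borel" using S by simp
  define f where "f = (\<lambda>v y. \<integral>\<^sup>+x. ennreal (\<bar>v x - v y\<bar> powr p) * (of_bool (x \<in> S) * of_bool (dist y x < r)) \<partial>m)"
  have fm [measurable]: "f w \<in> borel_measurable borel" if [measurable]: "w \<in> borel_measurable borel" for w
    unfolding f_def by measurable
  have DG: "D S w r = (\<integral>\<^sup>+y. ennreal (1 / V y r) * f w y * of_bool (y \<in> S) \<partial>m)" for w
    unfolding D_indicator f_def ennreal_inverse_V[OF r]
    by (intro nn_integral_cong arg_cong2[where f = "(*)"]) (auto simp: indicator_def)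
  have "f v y \<le> ennreal (2 powr p) * (f u y + f (\<lambda>x. u x - v x) y)" for y
  proof -
    have pw: "ennreal (\<bar>v x - v y\<bar> powr p) \<le> ennreal (2 powr p) * (ennreal (\<bar>u x - u y\<bar> powr p) + ennreal (\<bar>u x - v x - (u y - v y)\<bar> powr p))" for x
    proof -
      have "v x - v y = (u x - u y) - (u x - v x - (u y - v y))" by simp
      then have "\<bar>v x - v y\<bar> powr p \<le> 2 powr p * (\<bar>u x - u y\<bar> powr p + \<bar>u x - v x - (u y - v y)\<bar> powr p)"
        using abs_powr_add_le[of p "u x - u y" "- (u x - v x - (u y - v y))"] p by (simp only: abs_minus_cancel diff_conv_add_uminus[symmetric])
      then show ?thesis by (simp add: ennreal_leI flip: ennreal_plus ennreal_mult)
    qed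
    have "f v y \<le> (\<integral>\<^sup>+x. ennreal (2 powr p) * (ennreal (\<bar>u x - u y\<bar> powr p) * (of_bool (x \<in> S) * of_bool (dist y x < r))
        + ennreal (\<bar>u x - v x - (u y - v y)\<bar> powr p) * (of_bool (x \<in> S) * of_bool (dist y x < r))) \<partial>m)"
      unfolding f_def using pw by (intro nn_integral_mono) auto
    also have "\<dots> = ennreal (2 powr p) * (f u y + f (\<lambda>x. u x - v x) y)"
      unfolding f_def by (subst nn_integral_cmult, measurable, subst nn_integral_add, measurable)
    finally show ?thesis .
  qed
  then have "ennreal (1 / V y r) * f v y * of_bool (y \<in> S)
      \<le> ennreal (1 / V y r) * (ennreal (2 powr p) * (f u y + f (\<lambda>x. u x - v x) y)) * of_bool (y \<in> S)" for y
    by (intro mult_right_mono mult_left_mono) auto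
  then have "D S v r \<le> (\<integral>\<^sup>+y. ennreal (1 / V y r) * (ennreal (2 powr p) * (f u y + f (\<lambda>x. u x - v x) y)) * of_bool (y \<in> S) \<partial>m)"
    unfolding DG by (intro nn_integral_mono)
  also have "\<dots> = (\<integral>\<^sup>+y. ennreal (2 powr p) * (ennreal (1 / V y r) * f u y * of_bool (y \<in> S)
      + ennreal (1 / V y r) * f (\<lambda>x. u x - v x) y * of_bool (y \<in> S)) \<partial>m)"
    by (intro nn_integral_cong) (simp add: distrib_left distrib_right ac_simps)
  also have "\<dots> = ennreal (2 powr p) * (D S u r + D S (\<lambda>x. u x - v x) r)"
    unfolding DG by (subst nn_integral_cmult, measurable, subst nn_integral_add, measurable)
  finally show ?thesis .
qed

text \<open>The bound on \<open>D S v\<close> passes to a continuous approximation \<open>v'\<close>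
  with an error that \<open>D_upper\<close> makes small, \<open>lower_bound_Cc\<close> applies to
  \<open>v'\<close>, and the seminorm inequality returns to \<open>v\<close>. Each of the two
  transfers costs a factor \<open>2 powr p\<close>.\<close>

lemma lower_bound_measure:
  obtains C where "0 < C"
    "\<And>v S b. v \<in> \<F> \<Longrightarrow> open S \<Longrightarrow> 0 \<le> b \<Longrightarrow>
       frequently (\<lambda>r. D S v r \<le> ennreal (b * \<Psi> r)) (at_right 0) \<Longrightarrow> measure (\<Gamma> v) S \<le> C * b"
proof -
  obtain C where C: "0 < C" and lower: "\<And>v S K s b. v \<in> \<F> \<inter> Cc \<Longrightarrow> open S \<Longrightarrow> K \<in> sets borel \<Longrightarrow> 0 < s \<Longrightarrow>
       \<forall>x\<in>K. ball x s \<subseteq> S \<Longrightarrow> 0 \<le> b \<Longrightarrow>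
       frequently (\<lambda>r. D S v r \<le> ennreal (b * \<Psi> r)) (at_right 0) \<Longrightarrow> measure (\<Gamma> v) K \<le> C * b"
    by (rule lower_bound_Cc) (rule that)
  obtain C\<^sub>u \<kappa> where C\<^sub>u: "1 \<le> C\<^sub>u" and upper: "\<And>S u r. open S \<Longrightarrow> u \<in> \<F> \<Longrightarrow> 0 < r \<Longrightarrow>
      D S u r \<le> ennreal (C\<^sub>u * \<Psi> r) * emeasure (\<Gamma> u) (nbhd S (\<kappa> * r))"
    by (rule D_upper) (rule that)
  define q where "q = 2 powr p"
  have q: "0 < q" unfolding q_def by simp
  have main: "measure (\<Gamma> v) K \<le> q * C * q * b"
    if v: "v \<in> \<F>" and S: "open S" and K: "K \<in> sets borel" and s: "0 < s" and KS: "\<forall>x\<in>K. ball x s \<subseteq> S"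
      and b: "0 \<le> b" and freq: "frequently (\<lambda>r. D S v r \<le> ennreal (b * \<Psi> r)) (at_right 0)" for v S K s b
  proof (rule field_le_epsilon)
    fix \<eta> :: real assume \<eta>: "\<eta> > 0"
    \<comment> \<open>The total coefficient with which the error \<open>\<eta> / Q\<close>, a bound
      for the energy of \<open>v - v'\<close>, enters the chain of estimates.\<close>
    define Q where "Q = q * (C * q * C\<^sub>u + 1)"
    have Q: "Q > 0" unfolding Q_def using q C C\<^sub>u by (simp add: add_pos_pos)
    define \<delta> where "\<delta> = (\<eta> / Q) powr (1 / p)"
    have \<delta>: "\<delta> > 0" "\<delta> powr p = \<eta> / Q" unfolding \<delta>_def using \<eta> Q p by (auto simp: powr_powr)
    obtain v' where v': "v' \<in> \<F> \<inter> Cc" "energy_norm m p \<E> (\<lambda>x. v x - v' x) < \<delta>"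
      using dense_in_domain[OF v \<delta>(1)] by blast
    have v'F: "v' \<in> \<F>" using v' by auto
    note d = \<F>_diff[OF v v'F]
    have ed: "energy_root (\<lambda>x. v x - v' x) \<le> \<delta>"
    proof -
      have "energy_root (\<lambda>x. v x - v' x) \<le> energy_norm m p \<E> (\<lambda>x. v x - v' x)"
        unfolding energy_norm_def energy_root_def Lp_norm_def by simp
      then show ?thesis using v'(2) by simp
    qed
    then have Ed: "\<E> (\<lambda>x. v x - v' x) \<le> \<eta> / Q"
      unfolding energy_eq[OF d] \<delta>(2)[symmetric] using p by (intro powr_mono2) (auto simp: energy_root_def)
    have "frequently (\<lambda>r. D S v' r \<le> ennreal (q * (b + C\<^sub>u * (\<eta> / Q)) * \<Psi> r)) (at_right 0)"
    proof (rule frequently_mp[OF _ freq], unfold eventually_at_right_field, intro exI[of _ 1] conjI allI impI)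
      fix r :: real assume r: "0 < r" "D S v r \<le> ennreal (b * \<Psi> r)"
      have "D S (\<lambda>x. v x - v' x) r \<le> ennreal (C\<^sub>u * \<Psi> r) * emeasure (\<Gamma> (\<lambda>x. v x - v' x)) (nbhd S (\<kappa> * r))"
        by (rule upper[OF S d r(1)])
      also have "\<dots> \<le> ennreal (C\<^sub>u * \<Psi> r) * ennreal (\<eta> / Q)"
        using measure_\<Gamma>_le[OF d, of "nbhd S (\<kappa> * r)"] Ed
        by (intro mult_left_mono) (auto simp: emeasure_\<Gamma>[OF d] intro: ennreal_leI)
      finally have "ennreal q * (D S v r + D S (\<lambda>x. v x - v' x) r) \<le> ennreal q * (ennreal (b * \<Psi> r) + ennreal (C\<^sub>u * \<Psi> r) * ennreal (\<eta> / Q))"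
        using r(2) by (intro mult_left_mono add_mono) auto
      moreover have "D S v' r \<le> ennreal q * (D S v r + D S (\<lambda>x. v x - v' x) r)"
        unfolding q_def by (rule D_add_le[OF v v'F S r(1)])
      moreover have "ennreal q * (ennreal (b * \<Psi> r) + ennreal (C\<^sub>u * \<Psi> r) * ennreal (\<eta> / Q)) = ennreal (q * (b + C\<^sub>u * (\<eta> / Q)) * \<Psi> r)"
        using q b C\<^sub>u \<eta> Q \<Psi>_pos[OF r(1)] by (simp add: distrib_left distrib_right ac_simps flip: ennreal_mult ennreal_plus)
      ultimately show "D S v' r \<le> ennreal (q * (b + C\<^sub>u * (\<eta> / Q)) * \<Psi> r)" by simp
    qed simp
    then have m': "measure (\<Gamma> v') K \<le> C * (q * (b + C\<^sub>u * (\<eta> / Q)))"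
      using q b C\<^sub>u \<eta> Q by (intro lower[OF v'(1) S K s KS]) auto
    have "measure_root K (\<lambda>x. (v x - v' x) + v' x) \<le> measure_root K (\<lambda>x. v x - v' x) + measure_root K v'"
      by (intro seminorm_on_add[OF seminorm_measure_root[OF K]] d v'F)
    then have le: "measure_root K v \<le> measure_root K (\<lambda>x. v x - v' x) + measure_root K v'" by simp
    have nonneg: "0 \<le> measure_root K f" for f by (simp add: measure_root_def)
    have "measure (\<Gamma> v) K = \<bar>measure_root K v\<bar> powr p" by (simp add: energy_measure_eq nonneg)
    also have "\<dots> \<le> \<bar>measure_root K (\<lambda>x. v x - v' x) + measure_root K v'\<bar> powr p"
      using le p nonneg by (intro powr_mono2) auto
    also have "\<dots> \<le> q * (\<bar>measure_root K (\<lambda>x. v x - v' x)\<bar> powr p + \<bar>measure_root K v'\<bar> powr p)"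
      unfolding q_def using p by (intro abs_powr_add_le) simp
    also have "\<dots> = q * (measure (\<Gamma> (\<lambda>x. v x - v' x)) K + measure (\<Gamma> v') K)"
      by (simp add: energy_measure_eq nonneg)
    also have "\<dots> \<le> q * (\<eta> / Q + C * (q * (b + C\<^sub>u * (\<eta> / Q))))"
      using q m' order_trans[OF measure_\<Gamma>_le[OF d K] Ed] by (intro mult_left_mono add_mono) auto
    also have "\<dots> = q * C * q * b + Q * (\<eta> / Q)"
    proof -
      have "q * (h + C * (q * (b + C\<^sub>u * h))) = q * C * q * b + q * (C * q * C\<^sub>u + 1) * h" for h
        by (simp add: algebra_simps)
      from this[of "\<eta> / Q"] show ?thesis unfolding Q_def .
    qed
    also have "Q * (\<eta> / Q) = \<eta>" using Q by simp
    finally show "measure (\<Gamma> v) K \<le> q * C * q * b + \<eta>" .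
  qed
  show ?thesis
  proof (rule that[of "q * C * q"])
    fix v and S :: "'a set" and b assume v: "v \<in> \<F>" and S: "open S" and b: "(0::real) \<le> b"
      and freq: "frequently (\<lambda>r. D S v r \<le> ennreal (b * \<Psi> r)) (at_right 0)"
    \<comment> \<open>Points at distance at least \<open>1 / (n + 1)\<close> from the complement:
      closed sets that exhaust \<open>S\<close> and keep the margin that the bound for
      \<open>K\<close> requires.\<close>
    define K where "K = (\<lambda>n. {x. ball x (1 / real (Suc n)) \<subseteq> S})"
    have Keq: "K n = (\<Inter>y\<in>-S. {x. 1 / real (Suc n) \<le> dist x y})" for n
      unfolding K_def by (auto simp: not_less[symmetric])
    have Kc: "closed (K n)" for n
      unfolding Keq by (intro closed_INT ballI closed_Collect_le continuous_intros)
    have "incseq K"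
      unfolding K_def
    proof (rule incseq_SucI, rule subsetI, rule CollectI)
      fix n x assume "x \<in> {x. ball x (1 / real (Suc n)) \<subseteq> S}"
      moreover have "ball x (1 / real (Suc (Suc n))) \<subseteq> ball x (1 / real (Suc n))"
        by (intro subset_ball divide_left_mono) auto
      ultimately show "ball x (1 / real (Suc (Suc n))) \<subseteq> S" by blast
    qed
    moreover have "(\<Union>n. K n) = S"
    proof
      show "(\<Union>n. K n) \<subseteq> S"
      proof
        fix x assume "x \<in> (\<Union>n. K n)"
        then obtain n where "ball x (1 / real (Suc n)) \<subseteq> S" unfolding K_def by auto
        moreover have "x \<in> ball x (1 / real (Suc n))" by simp
        ultimately show "x \<in> S" by blast
      qed
      show "S \<subseteq> (\<Union>n. K n)"
      proof
        fix x assume "x \<in> S"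
        then obtain t where t: "t > 0" "ball x t \<subseteq> S" using S by (meson openE)
        obtain n where "1 / real (Suc n) < t" using t(1) by (rule nat_approx_posE)
        then have "ball x (1 / real (Suc n)) \<subseteq> ball x t" by (intro subset_ball) simp
        then show "x \<in> (\<Union>n. K n)" using t(2) unfolding K_def by blast
      qed
    qed
    moreover have "range K \<subseteq> sets (\<Gamma> v)" using Kc by (auto simp: measure_sets[OF v])
    ultimately have "(\<lambda>n. measure (\<Gamma> v) (K n)) \<longlonglongrightarrow> measure (\<Gamma> v) S"
      using finite_measure.finite_Lim_measure_incseq[OF measure_finite[OF v], of K] by simp
    moreover have "measure (\<Gamma> v) (K n) \<le> q * C * q * b" for n
      by (rule main[OF v S _ _ _ b freq, where s = "1 / real (Suc n)"]) (use Kc in \<open>auto simp: K_def\<close>)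
    ultimately show "measure (\<Gamma> v) S \<le> q * C * q * b" by (intro LIMSEQ_le_const2) auto
  qed (use q C in simp)
qed

lemma difference_energy_constant_weight:
  assumes u: "u \<in> \<F>" and S: "open S" and r: "0 < r" and c: "0 < c"
  shows "difference_energy m p S u (\<lambda>x y. c) r = ennreal (1 / c) * D S u r"
proof -
  interpret sigma_finite_measure m by (rule sigma_finite)
  have [measurable]: "u \<in> borel_measurable borel" using \<F>_measurable u by auto
  have [measurable]: "S \<in> sets borel" "ball y s \<in> sets borel" for y :: 'a and s using S by auto
  define G where "G = (\<lambda>y. \<integral>\<^sup>+x. ennreal (\<bar>u x - u y\<bar> powr p) * (of_bool (x \<in> S) * of_bool (dist y x < r)) \<partial>m)"
  have [measurable]: "G \<in> borel_measurable borel" unfolding G_def by measurable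
  have G: "(\<integral>\<^sup>+x\<in>S \<inter> ball y r. ennreal (\<bar>u x - u y\<bar> powr p) \<partial>m) = G y" for y
    unfolding G_def by (intro nn_integral_cong) (auto simp: indicator_def)
  have inner: "(\<integral>\<^sup>+x\<in>S \<inter> ball y r. ennreal (\<bar>u x - u y\<bar> powr p / c) \<partial>m) = ennreal (1 / c) * G y" for y
  proof -
    have "ennreal (a / c) = ennreal (1 / c) * ennreal a" if "0 \<le> a" for a
      using c that by (simp flip: ennreal_mult)
    from this[OF powr_ge_zero] have "(\<integral>\<^sup>+x\<in>S \<inter> ball y r. ennreal (\<bar>u x - u y\<bar> powr p / c) \<partial>m)
        = (\<integral>\<^sup>+x. ennreal (1 / c) * (ennreal (\<bar>u x - u y\<bar> powr p) * indicator (S \<inter> ball y r) x) \<partial>m)"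
      by (intro nn_integral_cong) (simp only: mult.assoc)
    also have "\<dots> = ennreal (1 / c) * (\<integral>\<^sup>+x\<in>S \<inter> ball y r. ennreal (\<bar>u x - u y\<bar> powr p) \<partial>m)"
      by (rule nn_integral_cmult) measurable
    finally show ?thesis by (simp only: G)
  qed
  have "difference_energy m p S u (\<lambda>x y. c) r = (\<integral>\<^sup>+y. ennreal (1 / c) * (ennreal (1 / V y r) * G y * indicator S y) \<partial>m)"
    unfolding difference_energy_def inner ennreal_inverse_V[OF r] by (intro nn_integral_cong) (simp add: ac_simps)
  also have "\<dots> = ennreal (1 / c) * (\<integral>\<^sup>+y. ennreal (1 / V y r) * G y * indicator S y \<partial>m)"
    by (rule nn_integral_cmult) measurable
  finally show ?thesis unfolding D_indicator G ennreal_inverse_V[OF r] .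
qed

text \<open>If the inequality failed, a real number \<open>b\<close> would lie strictly between the
  lower limit and \<open>measure (\<Gamma> v) S / C\<close>. The functional is then frequently below
  \<open>b\<close>, which contradicts the bound of \<open>lower_bound_measure\<close>.\<close>

lemma lower_bound:
  obtains C where "0 < C"
    "\<And>v S. v \<in> \<F> \<Longrightarrow> open S \<Longrightarrow>
       emeasure (\<Gamma> v) S \<le> ennreal C * Liminf (at_right 0) (\<lambda>r. difference_energy m p S v (\<lambda>x y. \<Psi> r) r)"
proof -
  obtain C where C: "0 < C" and lower: "\<And>v S b. v \<in> \<F> \<Longrightarrow> open S \<Longrightarrow> 0 \<le> b \<Longrightarrow>
       frequently (\<lambda>r. D S v r \<le> ennreal (b * \<Psi> r)) (at_right 0) \<Longrightarrow> measure (\<Gamma> v) S \<le> C * b"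
    by (rule lower_bound_measure) (rule that)
  show ?thesis
  proof (rule that[OF C])
    fix v and S :: "'a set" assume v: "v \<in> \<F>" and S: "open S"
    let ?q = "\<lambda>r. difference_energy m p S v (\<lambda>x y. \<Psi> r) r"
    let ?L = "Liminf (at_right 0) ?q"
    show "emeasure (\<Gamma> v) S \<le> ennreal C * ?L"
    proof (rule ccontr)
      assume not: "\<not> ?thesis"
      have "?L < ennreal (measure (\<Gamma> v) S / C)"
      proof (rule ccontr)
        assume "\<not> ?thesis"
        then have "ennreal C * ennreal (measure (\<Gamma> v) S / C) \<le> ennreal C * ?L" by (intro mult_left_mono) auto
        then show False using not C by (simp add: emeasure_\<Gamma>[OF v] flip: ennreal_mult)
      qed
      then obtain b' where b': "?L < b'" "b' < ennreal (measure (\<Gamma> v) S / C)" using dense by blast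
      then obtain b where b: "b' = ennreal b" "0 \<le> b" by (cases b') auto
      have "frequently (\<lambda>r. ?q r < ennreal b) (at_right 0)"
        using Liminf_bounded[of "ennreal b" ?q "at_right 0"] b'(1) unfolding b frequently_def
        by (auto simp: not_less not_le[symmetric])
      then have "frequently (\<lambda>r. D S v r \<le> ennreal (b * \<Psi> r)) (at_right 0)"
      proof (rule frequently_mp[rotated], unfold eventually_at_right_field, intro exI[of _ 1] conjI allI impI)
        fix r :: real assume r: "0 < r" "?q r < ennreal b"
        note pos = \<Psi>_pos[OF r(1)]
        have "D S v r = ennreal (\<Psi> r) * (ennreal (1 / \<Psi> r) * D S v r)"
          using pos by (simp add: mult.assoc[symmetric] flip: ennreal_mult)
        also have "\<dots> = ennreal (\<Psi> r) * ?q r"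
          by (simp add: difference_energy_constant_weight[OF v S r(1) pos])
        also have "\<dots> \<le> ennreal (\<Psi> r) * ennreal b" using r(2) by (intro mult_left_mono) auto
        also have "\<dots> = ennreal (b * \<Psi> r)" using pos b by (simp add: mult.commute flip: ennreal_mult)
        finally show "D S v r \<le> ennreal (b * \<Psi> r)" .
      qed simp
      then have "measure (\<Gamma> v) S \<le> C * b" by (rule lower[OF v S b(2)])
      then have "measure (\<Gamma> v) S / C \<le> b" using C by (simp add: field_simps)
      then show False using b'(2) b by (simp add: ennreal_less_iff)
    qed
  qed
qed

lemma difference_energy_weight_le:
  assumes "0 < r"
  shows "difference_energy m p S u (\<lambda>x y. \<Psi> r) r \<le> difference_energy m p S u (\<lambda>x y. \<Psi> (dist x y)) r"
  unfolding difference_energy_def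
proof (rule nn_integral_mono, rule mult_right_mono, rule mult_left_mono, rule nn_integral_mono)
  fix x y
  have "\<bar>u x - u y\<bar> powr p / \<Psi> r \<le> \<bar>u x - u y\<bar> powr p / \<Psi> (dist x y)" if "dist y x < r"
  proof (cases "x = y")
    case False
    then show ?thesis
      using \<Psi>_mono[of "dist x y" r] \<Psi>_pos[of "dist x y"] \<Psi>_pos[OF assms] that
      by (intro divide_left_mono) (auto simp: dist_commute)
  qed simp
  then show "ennreal (\<bar>u x - u y\<bar> powr p / \<Psi> r) * indicator (S \<inter> ball y r) x
      \<le> ennreal (\<bar>u x - u y\<bar> powr p / \<Psi> (dist x y)) * indicator (S \<inter> ball y r) x"
    by (auto simp: indicator_def intro: ennreal_leI)
qed auto

lemma Liminf_le_Limsup_weighted: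
  "Liminf (at_right 0) (\<lambda>r. difference_energy m p S u (\<lambda>x y. \<Psi> r) r)
     \<le> Limsup (at_right 0) (\<lambda>r. difference_energy m p S u (\<lambda>x y. \<Psi> (dist x y)) r)"
proof -
  have "Liminf (at_right 0) (\<lambda>r. difference_energy m p S u (\<lambda>x y. \<Psi> r) r)
      \<le> Liminf (at_right 0) (\<lambda>r. difference_energy m p S u (\<lambda>x y. \<Psi> (dist x y)) r)"
    by (rule Liminf_mono)
       (auto simp: eventually_at_right_field intro!: exI[of _ 1] difference_energy_weight_le)
  also have "\<dots> \<le> Limsup (at_right 0) (\<lambda>r. difference_energy m p S u (\<lambda>x y. \<Psi> (dist x y)) r)"
    by (rule Liminf_le_Limsup) simp
  finally show ?thesis .
qed

section \<open>Local energies and the extension property\<close>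

text \<open>\<open>F\<close> is an admissible local representative on every relatively compact open
  subset, and the sets \<open>A n\<close> exhaust \<open>\<Omega>\<close>; their closures are
  compact because closed balls are.\<close>

lemma local_energy_ge:
  assumes F: "F \<in> \<F>" and \<Omega>: "open \<Omega>" "\<Omega> \<noteq> UNIV" and ae: "AE x in m. x \<in> \<Omega> \<longrightarrow> u x = F x"
  shows "emeasure (\<Gamma> F) \<Omega> \<le> local_energy_measure m \<F> \<Gamma> \<Omega> u \<Omega>"
proof -
  fix a :: 'a
  define A where "A = (\<lambda>n. ball a (real n) \<inter> {x. 1 / real (Suc n) < infdist x (- \<Omega>)})"
  \<comment> \<open>\<open>infdist\<close> to the empty set is 0, which would make every
    \<open>A n\<close> empty.\<close>
  have ne: "- \<Omega> \<noteq> {}" and cl: "closed (- \<Omega>)" using \<Omega> by auto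
  have opn: "open (A n)" for n unfolding A_def by (intro open_Int open_Collect_less continuous_intros) auto
  have pos: "x \<in> \<Omega>" if "0 < infdist x (- \<Omega>)" for x using that in_closed_iff_infdist_zero[OF cl ne, of x] by auto
  have rel: "A n \<in> relcompact_open_subsets \<Omega>" for n
  proof -
    let ?C = "cball a (real n) \<inter> {x. 1 / real (Suc n) \<le> infdist x (- \<Omega>)}"
    have C: "closed ?C" by (intro closed_Int closed_Collect_le continuous_intros) auto
    have "A n \<subseteq> ?C" unfolding A_def by auto
    then have sub: "closure (A n) \<subseteq> ?C" using C by (rule closure_minimal)
    moreover have "?C \<subseteq> \<Omega>"
    proof
      fix x assume "x \<in> ?C"
      moreover have "0 < 1 / real (Suc n)" by simp
      ultimately show "x \<in> \<Omega>" by (intro pos) (simp only: Int_iff mem_Collect_eq, linarith)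
    qed
    moreover have "compact (closure (A n))"
    proof (rule compact_closed_subset[of "cball a (real n)"])
      show "closure (A n) \<subseteq> cball a (real n)" using sub by blast
    qed simp_all
    ultimately show ?thesis unfolding relcompact_open_subsets_def using opn by auto
  qed
  have A\<Omega>: "A n \<subseteq> \<Omega>" for n using rel[of n] closure_subset unfolding relcompact_open_subsets_def by blast
  have "incseq A"
    unfolding A_def
  proof (rule incseq_SucI, rule subsetI)
    fix n x assume x: "x \<in> ball a (real n) \<inter> {x. 1 / real (Suc n) < infdist x (- \<Omega>)}"
    have "1 / real (Suc (Suc n)) \<le> 1 / real (Suc n)" by (intro divide_left_mono) auto
    then show "x \<in> ball a (real (Suc n)) \<inter> {x. 1 / real (Suc (Suc n)) < infdist x (- \<Omega>)}"
      using x by auto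
  qed
  moreover have "(\<Union>n. A n) = \<Omega>"
  proof
    show "\<Omega> \<subseteq> (\<Union>n. A n)"
    proof
      fix x assume x: "x \<in> \<Omega>"
      then have "infdist x (- \<Omega>) \<noteq> 0" using in_closed_iff_infdist_zero[OF cl ne, of x] by auto
      then have "0 < infdist x (- \<Omega>)" using infdist_nonneg[of x "- \<Omega>"] by linarith
      then obtain n1 where n1: "1 / real (Suc n1) < infdist x (- \<Omega>)" by (rule nat_approx_posE)
      obtain n2 where n2: "dist a x < real n2" using reals_Archimedean2 by blast
      have "1 / real (Suc (max n1 n2)) \<le> 1 / real (Suc n1)" by (intro divide_left_mono) auto
      then have "x \<in> A (max n1 n2)" unfolding A_def using n1 n2 by (auto simp: max_def)
      then show "x \<in> (\<Union>n. A n)" by blast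
    qed
  qed (use A\<Omega> in blast)
  moreover have "range A \<subseteq> sets (\<Gamma> F)" using opn by (auto simp: measure_sets[OF F])
  ultimately have eq: "emeasure (\<Gamma> F) \<Omega> = (SUP n. emeasure (\<Gamma> F) (A n))"
    using SUP_emeasure_incseq[of A "\<Gamma> F"] by simp
  show ?thesis
    unfolding eq
  proof (rule SUP_least)
    fix n
    have "AE x in m. x \<in> A n \<longrightarrow> u x = F x" using ae by eventually_elim (use A\<Omega> in blast)
    then have "(A n, F) \<in> {(A, v). A \<in> relcompact_open_subsets \<Omega> \<and> v \<in> \<F> \<and> (AE x in m. x \<in> A \<longrightarrow> u x = v x)}"
      using rel F by simp
    moreover have "\<Omega> \<inter> A n = A n" using A\<Omega> by auto
    ultimately show "emeasure (\<Gamma> F) (A n) \<le> local_energy_measure m \<F> \<Gamma> \<Omega> u \<Omega>"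
      unfolding local_energy_measure_def by (intro SUP_upper2[of "(A n, F)"]) auto
  qed
qed

end

theorem corollary1p14:
  fixes m :: "'a::polish_space measure"
    and p :: real
    and \<F> :: "('a \<Rightarrow> real) set"
    and \<E> :: "('a \<Rightarrow> real) \<Rightarrow> real"
    and \<Gamma> :: "('a \<Rightarrow> real) \<Rightarrow> 'a measure"
    and \<Psi> :: "real \<Rightarrow> real"
  assumes "locally compact (UNIV :: 'a set)"
    and "\<exists>x y :: 'a. x \<noteq> y"
    and "radon_measure m"
    and "full_support m"
    and "1 < p"
    and "p_energy_form m p \<F> \<E> \<Gamma>"
    and "scale_function \<Psi>"
    and "volume_doubling m"
    and "poincare_inequality m p \<F> \<Gamma> \<Psi>"
    and "capacity_upper_bound m \<F> \<E> \<Psi>"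
  shows "\<exists>C::real. 1 \<le> C \<and>
    (\<forall>\<Omega> u. extension_property m p \<F> \<Gamma> \<Omega> \<and> u \<in> finite_energy_domain m p \<F> \<Gamma> \<Omega> \<longrightarrow>
       ennreal (inverse C) * local_energy_measure m \<F> \<Gamma> \<Omega> u \<Omega>
         \<le> Liminf (at_right 0) (\<lambda>r. difference_energy m p \<Omega> u (\<lambda>x y. \<Psi> r) r) \<and>
       Liminf (at_right 0) (\<lambda>r. difference_energy m p \<Omega> u (\<lambda>x y. \<Psi> r) r)
         \<le> Limsup (at_right 0) (\<lambda>r. difference_energy m p \<Omega> u (\<lambda>x y. \<Psi> (dist x y)) r) \<and>
       Limsup (at_right 0) (\<lambda>r. difference_energy m p \<Omega> u (\<lambda>x y. \<Psi> (dist x y)) r)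
         \<le> ennreal C * local_energy_measure m \<F> \<Gamma> \<Omega> u \<Omega>) \<and>
    (\<forall>u\<in>\<F>.
       ennreal (inverse C) * ennreal (\<E> u)
         \<le> Liminf (at_right 0) (\<lambda>r. difference_energy m p UNIV u (\<lambda>x y. \<Psi> r) r) \<and>
       Liminf (at_right 0) (\<lambda>r. difference_energy m p UNIV u (\<lambda>x y. \<Psi> r) r)
         \<le> (SUP r\<in>{0<..}. difference_energy m p UNIV u (\<lambda>x y. \<Psi> (dist x y)) r) \<and>
       (SUP r\<in>{0<..}. difference_energy m p UNIV u (\<lambda>x y. \<Psi> (dist x y)) r)
         \<le> ennreal C * ennreal (\<E> u))"
proof -
  obtain cD where cD: "1 \<le> cD" "\<And>x r. 0 < r \<Longrightarrow> emeasure m (ball x (2 * r)) \<le> ennreal cD * emeasure m (ball x r)"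
    using assms(8) unfolding volume_doubling_def by blast
  obtain C\<^sub>P A\<^sub>P where P: "0 < C\<^sub>P" "1 \<le> A\<^sub>P" "\<And>x r u. u \<in> \<F> \<Longrightarrow> 0 < r \<Longrightarrow>
      (\<integral>\<^sup>+y\<in>ball x r. ennreal (\<bar>u y - average m (ball x r) u\<bar> powr p) \<partial>m)
        \<le> ennreal (C\<^sub>P * \<Psi> r) * emeasure (\<Gamma> u) (ball x (A\<^sub>P * r))"
    using assms(9) unfolding poincare_inequality_def by blast
  obtain C\<^sub>c A\<^sub>1 A\<^sub>2 where c: "1 < C\<^sub>c" "1 < A\<^sub>1" "1 < A\<^sub>2"
    "\<And>x R. 0 < R \<Longrightarrow> ennreal R < ediam (UNIV :: 'a set) / ennreal A\<^sub>2 \<Longrightarrow>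
      (INF u\<in>{u \<in> \<F>. (AE y in m. y \<in> ball x R \<longrightarrow> u y = 1) \<and>
                        (AE y in m. y \<notin> ball x (A\<^sub>1 * R) \<longrightarrow> u y = 0)}. ennreal (\<E> u))
        \<le> ennreal C\<^sub>c * emeasure m (ball x R) / ennreal (\<Psi> R)"
    using assms(10) unfolding capacity_upper_bound_def by blast
  interpret p_energy_form m p \<F> \<E> \<Gamma> by (rule assms(6))
  interpret energy_space m cD p \<F> \<E> \<Gamma> \<Psi> C\<^sub>P A\<^sub>P C\<^sub>c A\<^sub>1 A\<^sub>2
    by unfold_locales (use assms(1-5,7) cD P c in auto)
  obtain C\<^sub>u \<kappa> r\<^sub>0 where C\<^sub>u: "1 \<le> C\<^sub>u" "1 \<le> \<kappa>" "0 < r\<^sub>0"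
    and upper: "\<And>S u r. open S \<Longrightarrow> u \<in> \<F> \<Longrightarrow> 0 < r \<Longrightarrow> r < r\<^sub>0 \<Longrightarrow>
      difference_energy m p S u (\<lambda>x y. \<Psi> (dist x y)) r \<le> ennreal C\<^sub>u * emeasure (\<Gamma> u) (nbhd S (\<kappa> * r))"
    and global: "\<And>u r. u \<in> \<F> \<Longrightarrow> 0 < r \<Longrightarrow>
      difference_energy m p UNIV u (\<lambda>x y. \<Psi> (dist x y)) r \<le> ennreal C\<^sub>u * ennreal (\<E> u)"
    by (rule weighted_upper) (rule that)
  obtain C\<^sub>l where C\<^sub>l: "0 < C\<^sub>l" and lower: "\<And>v S. v \<in> \<F> \<Longrightarrow> open S \<Longrightarrow>
       emeasure (\<Gamma> v) S \<le> ennreal C\<^sub>l * Liminf (at_right 0) (\<lambda>r. difference_energy m p S v (\<lambda>x y. \<Psi> r) r)"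
    by (rule lower_bound) (rule that)
  define C where "C = max C\<^sub>u C\<^sub>l"
  have C: "1 \<le> C" "C\<^sub>u \<le> C" "C\<^sub>l \<le> C" unfolding C_def using C\<^sub>u by auto
  have inv: "ennreal (inverse C) * a \<le> b" if "a \<le> ennreal C\<^sub>l * b" for a b
  proof -
    have "a \<le> ennreal C * b" using that C(3) by (meson ennreal_leI mult_right_mono order_trans zero_le)
    then have "ennreal (inverse C) * a \<le> ennreal (inverse C) * (ennreal C * b)" by (rule mult_left_mono) simp
    also have "\<dots> = b" using C(1) by (simp add: mult.assoc[symmetric] flip: ennreal_mult)
    finally show ?thesis .
  qed
  have Cup: "ennreal C\<^sub>u * a \<le> ennreal C * a" for a using C(2) by (intro mult_right_mono ennreal_leI) auto
  show ?thesis
  proof (intro exI[of _ C] conjI allI ballI impI)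
    show "1 \<le> C" by (rule C)
  next
    fix \<Omega> u assume *: "extension_property m p \<F> \<Gamma> \<Omega> \<and> u \<in> finite_energy_domain m p \<F> \<Gamma> \<Omega>"
    then obtain F where \<Omega>: "open \<Omega>" "\<Omega> \<noteq> UNIV" and F: "F \<in> \<F>"
      and ae: "AE x in m. x \<in> \<Omega> \<longrightarrow> u x = F x" and fr: "emeasure (\<Gamma> F) (frontier \<Omega>) = 0"
      unfolding extension_property_def by blast
    let ?q = "\<lambda>r. difference_energy m p \<Omega> u (\<lambda>x y. \<Psi> r) r"
    \<comment> \<open>A pair \<open>(A, v)\<close> of the supremum is treated by the lower bound for
      \<open>v\<close> on the open set \<open>A\<close>; there the functional of \<open>v\<close> is
      that of \<open>u\<close>, and it grows with the set.\<close>
    have "local_energy_measure m \<F> \<Gamma> \<Omega> u \<Omega> \<le> ennreal C\<^sub>l * Liminf (at_right 0) ?q"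
      unfolding local_energy_measure_def
    proof (rule SUP_least)
      fix Av assume "Av \<in> {(A, v). A \<in> relcompact_open_subsets \<Omega> \<and> v \<in> \<F> \<and> (AE x in m. x \<in> A \<longrightarrow> u x = v x)}"
      then obtain A v where Av: "Av = (A, v)" "A \<in> relcompact_open_subsets \<Omega>" "v \<in> \<F>" "AE x in m. x \<in> A \<longrightarrow> u x = v x"
        by auto
      have A: "open A" "A \<subseteq> \<Omega>" using Av(2) closure_subset unfolding relcompact_open_subsets_def by auto
      have "emeasure (\<Gamma> v) (\<Omega> \<inter> A) = emeasure (\<Gamma> v) A" using A by (simp add: Int_absorb1)
      also have "\<dots> \<le> ennreal C\<^sub>l * Liminf (at_right 0) (\<lambda>r. difference_energy m p A v (\<lambda>x y. \<Psi> r) r)"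
        by (rule lower[OF Av(3) A(1)])
      also have "\<dots> = ennreal C\<^sub>l * Liminf (at_right 0) (\<lambda>r. difference_energy m p A u (\<lambda>x y. \<Psi> r) r)"
        by (simp only: difference_energy_cong[OF Av(4)])
      also have "\<dots> \<le> ennreal C\<^sub>l * Liminf (at_right 0) ?q"
        using difference_energy_mono_set[OF A(2)] by (intro mult_left_mono Liminf_mono always_eventually) auto
      finally show "(case Av of (A, v) \<Rightarrow> emeasure (\<Gamma> v) (\<Omega> \<inter> A)) \<le> ennreal C\<^sub>l * Liminf (at_right 0) ?q"
        unfolding Av(1) by simp
    qed
    then show "ennreal (inverse C) * local_energy_measure m \<F> \<Gamma> \<Omega> u \<Omega> \<le> Liminf (at_right 0) ?q" by (rule inv)
    show "Liminf (at_right 0) ?q \<le> Limsup (at_right 0) (\<lambda>r. difference_energy m p \<Omega> u (\<lambda>x y. \<Psi> (dist x y)) r)"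
      by (rule Liminf_le_Limsup_weighted)
    let ?L = "Limsup (at_right 0) (\<lambda>r. difference_energy m p \<Omega> u (\<lambda>x y. \<Psi> (dist x y)) r)"
    \<comment> \<open>The upper bound at radius \<open>r\<close> involves \<open>F\<close> on the
      \<open>\<kappa> * r\<close>-neighbourhood of \<open>\<Omega>\<close>. For small
      \<open>r\<close> it lies in \<open>W n\<close>, and these open sets decrease to
      \<open>closure \<Omega>\<close>, so finiteness of \<open>\<Gamma> F\<close> gives the
      limit.\<close>
    define W where "W = (\<lambda>n. nbhd \<Omega> (1 / real (Suc n)))"
    interpret \<Gamma>: finite_measure "\<Gamma> F" by (rule measure_finite[OF F])
    have bound: "?L \<le> ennreal (C\<^sub>u * measure (\<Gamma> F) (W n))" for n
    proof (rule Limsup_bounded, unfold eventually_at_right_field, intro exI conjI allI impI)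
      show "0 < min r\<^sub>0 (1 / real (Suc n) / \<kappa>)" using C\<^sub>u by simp
      fix r :: real assume r: "0 < r" "r < min r\<^sub>0 (1 / real (Suc n) / \<kappa>)"
      have "r < 1 / real (Suc n) / \<kappa>" using r by simp
      then have "r * \<kappa> < 1 / real (Suc n)" using C\<^sub>u(2) by (subst (asm) pos_less_divide_eq) auto
      then have "\<kappa> * r \<le> 1 / real (Suc n)" by (simp add: mult.commute)
      then have "emeasure (\<Gamma> F) (nbhd \<Omega> (\<kappa> * r)) \<le> emeasure (\<Gamma> F) (W n)"
        unfolding W_def by (intro emeasure_mono nbhd_mono) (auto simp: measure_sets[OF F])
      then have "ennreal C\<^sub>u * emeasure (\<Gamma> F) (nbhd \<Omega> (\<kappa> * r)) \<le> ennreal C\<^sub>u * emeasure (\<Gamma> F) (W n)"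
        by (rule mult_left_mono) simp
      moreover have "difference_energy m p \<Omega> F (\<lambda>x y. \<Psi> (dist x y)) r \<le> ennreal C\<^sub>u * emeasure (\<Gamma> F) (nbhd \<Omega> (\<kappa> * r))"
        using r by (intro upper \<Omega> F) auto
      ultimately show "difference_energy m p \<Omega> u (\<lambda>x y. \<Psi> (dist x y)) r \<le> ennreal (C\<^sub>u * measure (\<Gamma> F) (W n))"
        using C\<^sub>u unfolding difference_energy_cong[OF ae] by (simp add: emeasure_\<Gamma>[OF F] ennreal_mult)
    qed
    have "decseq W"
      unfolding W_def by (rule decseq_SucI) (intro nbhd_mono divide_left_mono; simp)
    moreover have "(\<Inter>n. W n) = closure \<Omega>"
    proof (intro set_eqI iffI)
      fix x assume x: "x \<in> (\<Inter>n. W n)"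
      show "x \<in> closure \<Omega>"
        unfolding closure_approachable
      proof (intro allI impI)
        fix t :: real assume "0 < t"
        then obtain n where n: "1 / real (Suc n) < t" by (rule nat_approx_posE)
        obtain y where "y \<in> \<Omega>" "dist y x < 1 / real (Suc n)" using x unfolding W_def nbhd_def by force
        then show "\<exists>y\<in>\<Omega>. dist y x < t" using n by (intro bexI[of _ y]) linarith+
      qed
    next
      fix x assume x: "x \<in> closure \<Omega>"
      show "x \<in> (\<Inter>n. W n)"
      proof
        fix n
        obtain y where "y \<in> \<Omega>" "dist y x < 1 / real (Suc n)"
          using x unfolding closure_approachable by (meson of_nat_0_less_iff zero_less_Suc zero_less_divide_1_iff)
        then show "x \<in> W n" unfolding W_def nbhd_def by auto
      qed
    qed
    moreover have "range W \<subseteq> sets (\<Gamma> F)" unfolding W_def by (auto simp: measure_sets[OF F])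
    ultimately have "(\<lambda>n. measure (\<Gamma> F) (W n)) \<longlonglongrightarrow> measure (\<Gamma> F) (closure \<Omega>)"
      using \<Gamma>.finite_Lim_measure_decseq[of W] by simp
    then have "(\<lambda>n. ennreal (C\<^sub>u * measure (\<Gamma> F) (W n))) \<longlonglongrightarrow> ennreal (C\<^sub>u * measure (\<Gamma> F) (closure \<Omega>))"
      by (intro tendsto_ennrealI tendsto_mult_left)
    then have "?L \<le> ennreal (C\<^sub>u * measure (\<Gamma> F) (closure \<Omega>))"
      by (rule LIMSEQ_le_const) (use bound in blast)
    \<comment> \<open>The energy on the closure is reduced to that on \<open>\<Omega>\<close> by the
      second half of the extension property.\<close>
    also have "measure (\<Gamma> F) (closure \<Omega>) \<le> measure (\<Gamma> F) \<Omega> + measure (\<Gamma> F) (frontier \<Omega>)"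
    proof -
      have "closure \<Omega> = \<Omega> \<union> frontier \<Omega>"
        using \<Omega>(1) closure_subset[of \<Omega>] by (auto simp: frontier_def interior_open)
      then show ?thesis using \<Omega>(1) by (simp only:, intro measure_Un_le) (auto simp: measure_sets[OF F])
    qed
    also have "measure (\<Gamma> F) (frontier \<Omega>) = 0" using fr by (simp add: measure_def)
    finally have "?L \<le> ennreal C\<^sub>u * emeasure (\<Gamma> F) \<Omega>"
      using C\<^sub>u by (simp add: emeasure_\<Gamma>[OF F] ennreal_mult ennreal_leI mult_left_mono)
    also have "\<dots> \<le> ennreal C\<^sub>u * local_energy_measure m \<F> \<Gamma> \<Omega> u \<Omega>"
      by (intro mult_left_mono local_energy_ge[OF F \<Omega> ae]) simp
    also have "\<dots> \<le> ennreal C * local_energy_measure m \<F> \<Gamma> \<Omega> u \<Omega>" by (rule Cup)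
    finally show "?L \<le> ennreal C * local_energy_measure m \<F> \<Gamma> \<Omega> u \<Omega>" .
  next
    fix u assume u: "u \<in> \<F>"
    let ?q = "\<lambda>r. difference_energy m p UNIV u (\<lambda>x y. \<Psi> r) r"
    let ?Q = "\<lambda>r. difference_energy m p UNIV u (\<lambda>x y. \<Psi> (dist x y)) r"
    have "ennreal (\<E> u) \<le> ennreal C\<^sub>l * Liminf (at_right 0) ?q"
      using lower[OF u open_UNIV] by (simp add: emeasure_\<Gamma>[OF u] total_mass[OF u])
    then show "ennreal (inverse C) * ennreal (\<E> u) \<le> Liminf (at_right 0) ?q" by (rule inv)
    have "Limsup (at_right 0) ?Q \<le> (SUP r\<in>{0<..}. ?Q r)"
      by (rule Limsup_bounded) (auto simp: eventually_at_right_field intro!: exI[of _ 1] SUP_upper)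
    then show "Liminf (at_right 0) ?q \<le> (SUP r\<in>{0<..}. ?Q r)"
      using Liminf_le_Limsup_weighted[of UNIV u] by (rule order_trans[rotated])
    show "(SUP r\<in>{0<..}. ?Q r) \<le> ennreal C * ennreal (\<E> u)"
    proof (rule SUP_least)
      fix r :: real assume "r \<in> {0<..}"
      then show "?Q r \<le> ennreal C * ennreal (\<E> u)" using global[OF u] Cup by (auto intro: order_trans)
    qed
  qed
qed

end
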